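(* Let $\mathbb I\subset R\times\mathbb R$ be an idealistic filtration. If $\mathbb I$ is of r.f.g. type, then so is its $\mathfrak D$-saturation $\mathfrak D(\mathbb I)$, and (for a simple normal crossing divisor $E$ on $\operatorname{Spec}R$) so is its $\mathfrak D_E$-saturation $\mathfrak D_E(\mathbb I)$.
   Context: $k$ is an algebraically closed field of arbitrary characteristic. $R$ is the coordinate ring of an affine open subset of a variety $W$ smooth over $k$, or its localization by some multiplicative set. Idealistic filtration: for $T\subset R\times\mathbb R$ and $a\in\mathbb R$ write $T_a=\{f\in R:(f,a)\in T\}$. A subset $\mathbb I\subset R\times\mathbb R$ is an idealistic filtration if $\mathbb I_0=R$; each $\mathbb I_a$ is an ideal of $R$; $\mathbb I_a\mathbb I_b\subset\mathbb I_{a+b}$ for all $a,b$; and $\mathbb I_b\supset\mathbb I_a$ whenever $b\le a$. $G(T)$ denotes the smallest idealistic filtration containing $T$. $\mathbb I$ is of r.f.g. type if $\mathbb I=G(T)$ for some finite $T\subset R\times\mathbb Q$. $\operatorname{Diff}^t_R$ denotes the $R$-module of $k$-linear differential operators $R\to R$ of degree $\le t$ in the sense of Grothendieck, i.e. the maps of the form $r\mapsto u\bigl((1\otimes r)\bmod\Delta_R^{t+1}\bigr)$ with $u\in\operatorname{Hom}_R\bigl((R\otimes_kR)/\Delta_R^{t+1},R\bigr)$, where $\Delta_R$ is the kernel of the multiplication map $R\otimes_kR\to R$ and $R$ acts on $R\otimes_kR$ through the first factor. For a simple normal crossing divisor $E$ with ideal $I_E\subset R$, $\operatorname{Diff}^t_{R,E}=\{d\in\operatorname{Diff}^t_R: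 d(I_E^s)\subset I_E^s\ \forall s\in\mathbb Z_{\ge0}\}$. $\mathbb I$ is $\mathfrak D$-saturated (resp. $\mathfrak D_E$-saturated) if $(f,a)\in\mathbb I$ and $d\in\operatorname{Diff}^t_R$ (resp. $\operatorname{Diff}^t_{R,E}$), $t\in\mathbb Z_{\ge0}$, imply $(d(f),a-t)\in\mathbb I$. $\mathfrak D(\mathbb I)$ (resp. $\mathfrak D_E(\mathbb I)$) is the smallest $\mathfrak D$-saturated (resp. $\mathfrak D_E$-saturated) idealistic filtration containing $\mathbb I$. *)

theory Defs
  imports
    "HOL-Computational_Algebra.Computational_Algebra"
    "HOL-Library.Poly_Mapping"
begin

section \<open>Ideals, ring homomorphisms, localizations\<close>

abbreviation ideal :: "'a::comm_ring_1 set \<Rightarrow> bool" where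
  "ideal \<equiv> module.subspace (*)"

abbreviation ideal_gen :: "'a::comm_ring_1 set \<Rightarrow> 'a set" where
  "ideal_gen \<equiv> module.span (*)"

lemma module_times: "module ((*) :: 'a::comm_ring_1 \<Rightarrow> 'a \<Rightarrow> 'a)"
  by unfold_locales (simp_all add: algebra_simps)

definition prime_ideal :: "'a::comm_ring_1 set \<Rightarrow> bool" where
  "prime_ideal P \<longleftrightarrow> ideal P \<and> 1 \<notin> P \<and> (\<forall>x y. x * y \<in> P \<longrightarrow> x \<in> P \<or> y \<in> P)"

definition ideal_prod :: "'a::comm_ring_1 set \<Rightarrow> 'a set \<Rightarrow> 'a set" where
  "ideal_prod I J = ideal_gen {x * y | x y. x \<in> I \<and> y \<in> J}"

primrec ideal_power :: "'a::comm_ring_1 set \<Rightarrow> nat \<Rightarrow> 'a set" where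
  "ideal_power I 0 = UNIV"
| "ideal_power I (Suc n) = ideal_prod I (ideal_power I n)"

definition is_ring_hom :: "('a::comm_ring_1 \<Rightarrow> 'b::comm_ring_1) \<Rightarrow> bool" where
  "is_ring_hom h \<longleftrightarrow> h 1 = 1 \<and> (\<forall>x y. h (x + y) = h x + h y) \<and> (\<forall>x y. h (x * y) = h x * h y)"

definition multiplicative_set :: "'a::comm_ring_1 set \<Rightarrow> bool" where
  "multiplicative_set S \<longleftrightarrow> 1 \<in> S \<and> (\<forall>x\<in>S. \<forall>y\<in>S. x * y \<in> S)"

text \<open>\<open>\<phi>\<close> exhibits its codomain as the localization of its domain at \<open>S\<close>.\<close>

definition is_localization :: "('a::comm_ring_1 \<Rightarrow> 'b::comm_ring_1) \<Rightarrow> 'a set \<Rightarrow> bool" where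
  "is_localization \<phi> S \<longleftrightarrow> is_ring_hom \<phi> \<and> (\<forall>s\<in>S. \<phi> s dvd 1) \<and>
     (\<forall>r. \<exists>x. \<exists>s\<in>S. r * \<phi> s = \<phi> x) \<and> (\<forall>x. \<phi> x = 0 \<longrightarrow> (\<exists>s\<in>S. s * x = 0))"


section \<open>Smooth affine varieties\<close>

text \<open>
  A polynomial in the variables \<open>X\<^sub>0, X\<^sub>1, \<dots>\<close> is a finitely supported map from monomials
  (finitely supported exponent vectors) to coefficients.
\<close>

type_synonym 'k mpoly = "(nat \<Rightarrow>\<^sub>0 nat) \<Rightarrow>\<^sub>0 'k"

definition polys_in :: "nat \<Rightarrow> 'k::comm_ring_1 mpoly set" where
  "polys_in n = {p. \<forall>m \<in> Poly_Mapping.keys p. Poly_Mapping.keys m \<subseteq> {..<n}}"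

text \<open>Evaluation at \<open>a\<close> in a \<open>k\<close>-algebra with structure map \<open>\<iota>\<close>.\<close>

definition mpoly_eval ::
    "('k::comm_ring_1 \<Rightarrow> 'a::comm_ring_1) \<Rightarrow> (nat \<Rightarrow> 'a) \<Rightarrow> 'k mpoly \<Rightarrow> 'a" where
  "mpoly_eval \<iota> a p =
     (\<Sum>m \<in> Poly_Mapping.keys p. \<iota> (Poly_Mapping.lookup p m) *
        (\<Prod>i \<in> Poly_Mapping.keys m. a i ^ Poly_Mapping.lookup m i))"

definition mpoly_deriv :: "nat \<Rightarrow> 'k::comm_ring_1 mpoly \<Rightarrow> 'k mpoly" where
  "mpoly_deriv i p =
     (\<Sum>m \<in> Poly_Mapping.keys p.
        Poly_Mapping.single (m - Poly_Mapping.single i 1)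
          (of_nat (Poly_Mapping.lookup m i) * Poly_Mapping.lookup p m))"

definition alg_generators ::
    "('k::comm_ring_1 \<Rightarrow> 'a::comm_ring_1) \<Rightarrow> nat \<Rightarrow> (nat \<Rightarrow> 'a) \<Rightarrow> bool" where
  "alg_generators \<iota> n a \<longleftrightarrow> mpoly_eval \<iota> a ` polys_in n = UNIV"

text \<open>
  Smoothness of \<open>Spec A\<close> at the point \<open>P\<close>, for the closed embedding of \<open>Spec A\<close> in affine
  \<open>n\<close>-space given by generators \<open>a\<^sub>0, \<dots>, a\<^sub>n\<^sub>-\<^sub>1\<close>: the kernel of
  \<open>k[X\<^sub>0, \<dots>, X\<^sub>n\<^sub>-\<^sub>1] \<rightarrow> A\<close> is generated, locally at \<open>P\<close>, by finitely many
  polynomials \<open>f\<^sub>0, \<dots>, f\<^sub>c\<^sub>-\<^sub>1\<close> whose Jacobian matrix has rank \<open>c\<close> at \<open>P\<close> (its rows are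
  linearly independent over the residue field, equivalently over the domain \<open>A/P\<close>).
\<close>

definition smooth_at ::
    "('k::field \<Rightarrow> 'a::comm_ring_1) \<Rightarrow> nat \<Rightarrow> (nat \<Rightarrow> 'a) \<Rightarrow> 'a set \<Rightarrow> bool" where
  "smooth_at \<iota> n a P \<longleftrightarrow>
     (\<exists>(c::nat) f.
        (\<forall>j<c. f j \<in> polys_in n \<and> mpoly_eval \<iota> a (f j) = 0) \<and>
        (\<forall>h\<in>polys_in n. mpoly_eval \<iota> a h = 0 \<longrightarrow>
           (\<exists>s\<in>polys_in n. mpoly_eval \<iota> a s \<notin> P \<and>
              (\<exists>q. (\<forall>j<c. q j \<in> polys_in n) \<and> s * h = (\<Sum>j<c. q j * f j)))) \<and>
        (\<forall>u :: nat \<Rightarrow> 'a.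
           (\<forall>i<n. (\<Sum>j<c. u j * mpoly_eval \<iota> a (mpoly_deriv i (f j))) \<in> P) \<longrightarrow>
           (\<forall>j<c. u j \<in> P)))"

text \<open>The type class \<open>idom\<close> of \<open>A\<close> makes \<open>Spec A\<close> integral.\<close>

definition smooth_affine_variety :: "('k::field \<Rightarrow> 'a::idom) \<Rightarrow> bool" where
  "smooth_affine_variety \<iota> \<longleftrightarrow> is_ring_hom \<iota> \<and>
     (\<exists>n a. alg_generators \<iota> n a \<and> (\<forall>P. prime_ideal P \<longrightarrow> smooth_at \<iota> n a P))"


section \<open>Differential operators in the sense of Grothendieck\<close>

text \<open>
  Pairs \<open>(x, y) \<in> R \<times> R\<close> under componentwise multiplication, written additively so that
  \<open>'r mult_pair \<Rightarrow>\<^sub>0 'k\<close> is the monoid algebra: the free \<open>k\<close>-module on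
  \<open>R \<times> R\<close> with product \<open>(x, y) (x', y') = (x x', y y')\<close>.
\<close>

datatype 'r mult_pair = Mult_Pair (pair_fst: 'r) (pair_snd: 'r)

instantiation mult_pair :: (comm_monoid_mult) comm_monoid_add
begin

definition "0 = Mult_Pair 1 1"
definition "p + q = Mult_Pair (pair_fst p * pair_fst q) (pair_snd p * pair_snd q)"

instance
  by standard (auto simp: zero_mult_pair_def plus_mult_pair_def algebra_simps mult_pair.expand)

end

type_synonym ('k, 'r) pair_algebra = "'r mult_pair \<Rightarrow>\<^sub>0 'k"

abbreviation pure :: "'r \<Rightarrow> 'r \<Rightarrow> 'k \<Rightarrow> ('k::comm_ring_1, 'r) pair_algebra" where
  "pure x y c \<equiv> Poly_Mapping.single (Mult_Pair x y) c"

text \<open>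
  \<open>R \<otimes>\<^sub>k R\<close> is the quotient of the pair algebra by the submodule generated by the relations
  of \<open>k\<close>-bilinearity. The relations are stable under multiplication by pairs, so this
  submodule is the ideal they generate.
\<close>

definition tensor_ideal ::
    "('k::field \<Rightarrow> 'r::comm_ring_1) \<Rightarrow> ('k, 'r) pair_algebra set" where
  "tensor_ideal \<iota> = ideal_gen
     ({pure (x + x') y 1 - pure x y 1 - pure x' y 1 | x x' y. True} \<union>
      {pure x (y + y') 1 - pure x y 1 - pure x y' 1 | x y y'. True} \<union>
      {pure (\<iota> c * x) y 1 - pure x y c | c x y. True} \<union>
      {pure x (\<iota> c * y) 1 - pure x y c | c x y. True})"

definition mult_map :: "('k::field \<Rightarrow> 'r::comm_ring_1) \<Rightarrow> ('k, 'r) pair_algebra \<Rightarrow> 'r" where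
  "mult_map \<iota> z =
     (\<Sum>p \<in> Poly_Mapping.keys z. \<iota> (Poly_Mapping.lookup z p) * (pair_fst p * pair_snd p))"

text \<open>
  The preimage in the pair algebra of \<open>\<Delta>\<^sub>R\<^sup>n\<close>, where \<open>\<Delta>\<^sub>R\<close> is the kernel of the
  multiplication map \<open>R \<otimes>\<^sub>k R \<rightarrow> R\<close>. Hence the quotient of the pair algebra by this ideal
  is \<open>(R \<otimes>\<^sub>k R) / \<Delta>\<^sub>R\<^sup>n\<close>.
\<close>

definition diag_ideal ::
    "('k::field \<Rightarrow> 'r::comm_ring_1) \<Rightarrow> nat \<Rightarrow> ('k, 'r) pair_algebra set" where
  "diag_ideal \<iota> n = ideal_gen (tensor_ideal \<iota> \<union> ideal_power {z. mult_map \<iota> z = 0} n)"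

definition coset :: "'a::comm_ring_1 set \<Rightarrow> 'a \<Rightarrow> 'a set" where
  "coset J z = {z'. z' - z \<in> J}"

text \<open>
  A linear map \<open>u\<close> on \<open>(R \<otimes>\<^sub>k R) / \<Delta>\<^sub>R\<^sup>n\<close> is a function of cosets; scalars from \<open>R\<close> act
  through the first tensor factor.
\<close>

definition principal_parts_hom ::
    "('k::field \<Rightarrow> 'r::comm_ring_1) \<Rightarrow> nat \<Rightarrow> (('k, 'r) pair_algebra set \<Rightarrow> 'r) \<Rightarrow> bool" where
  "principal_parts_hom \<iota> n u \<longleftrightarrow>
     (\<forall>z w. u (coset (diag_ideal \<iota> n) (z + w)) =
        u (coset (diag_ideal \<iota> n) z) + u (coset (diag_ideal \<iota> n) w)) \<and>
     (\<forall>r z. u (coset (diag_ideal \<iota> n) (pure r 1 1 * z)) = r * u (coset (diag_ideal \<iota> n) z))"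

definition Diff :: "('k::field \<Rightarrow> 'r::comm_ring_1) \<Rightarrow> nat \<Rightarrow> ('r \<Rightarrow> 'r) set" where
  "Diff \<iota> t = {d. \<exists>u. principal_parts_hom \<iota> (Suc t) u \<and>
                    (\<forall>r. d r = u (coset (diag_ideal \<iota> (Suc t)) (pure 1 r 1)))}"

definition Diff_log ::
    "('k::field \<Rightarrow> 'r::comm_ring_1) \<Rightarrow> 'r set \<Rightarrow> nat \<Rightarrow> ('r \<Rightarrow> 'r) set" where
  "Diff_log \<iota> J t = {d \<in> Diff \<iota> t. \<forall>s. d ` ideal_power J s \<subseteq> ideal_power J s}"


section \<open>Simple normal crossing divisors\<close>

text \<open>
  For a prime \<open>P\<close> of a domain \<open>R\<close>, the local ring \<open>R\<^sub>P\<close> is formed inside the fraction field;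
  \<open>loc_ideal P J\<close> is the extension \<open>J R\<^sub>P\<close>. In particular \<open>loc_ideal P UNIV\<close> is
  \<open>R\<^sub>P\<close> and \<open>loc_ideal P P\<close> is its maximal ideal.
\<close>

definition loc_ideal :: "'r::idom set \<Rightarrow> 'r set \<Rightarrow> 'r fract set" where
  "loc_ideal P J = {Fract x s | x s. x \<in> J \<and> s \<notin> P}"

text \<open>
  Regular systems of parameters of \<open>R\<^sub>P\<close>: elements which generate the maximal ideal
  \<open>\<mm>\<close> and are independent modulo \<open>\<mm>\<^sup>2\<close> over the residue field. The notion is used only
  when \<open>R\<^sub>P\<close> is regular, being a local ring of a smooth variety, and then the number \<open>d\<close> of
  such elements is \<open>dim \<mm>/\<mm>\<^sup>2\<close>, that is, the Krull dimension of \<open>R\<^sub>P\<close>.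
\<close>

definition regular_parameters :: "'r::idom set \<Rightarrow> nat \<Rightarrow> (nat \<Rightarrow> 'r fract) \<Rightarrow> bool" where
  "regular_parameters P d x \<longleftrightarrow>
     loc_ideal P P = {\<Sum>i<d. c i * x i | c. \<forall>i<d. c i \<in> loc_ideal P UNIV} \<and>
     (\<forall>c. (\<forall>i<d. c i \<in> loc_ideal P UNIV) \<and>
        (\<Sum>i<d. c i * x i) \<in> loc_ideal P (ideal_power P 2) \<longrightarrow>
        (\<forall>i<d. c i \<in> loc_ideal P P))"

text \<open>
  \<open>J\<close> is the ideal of a simple normal crossing divisor: at every point of its zero locus it is
  generated by the product of some members of a regular system of parameters. As the parameters lie in
  the Zariski local ring, distinct branches through a point belong to distinct components, so
  the crossings are indeed simple. The zero divisor, \<open>J = R\<close>, is allowed.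
\<close>

definition snc_divisor_ideal :: "'r::idom set \<Rightarrow> bool" where
  "snc_divisor_ideal J \<longleftrightarrow> ideal J \<and>
     (\<forall>P. prime_ideal P \<and> J \<subseteq> P \<longrightarrow>
        (\<exists>d x r. regular_parameters P d x \<and> 1 \<le> r \<and> r \<le> d \<and>
           loc_ideal P J = {y * (\<Prod>i<r. x i) | y. y \<in> loc_ideal P UNIV}))"


section \<open>Idealistic filtrations\<close>

definition level :: "('r \<times> real) set \<Rightarrow> real \<Rightarrow> 'r set" where
  "level T a = {f. (f, a) \<in> T}"

definition idealistic_filtration :: "('r::comm_ring_1 \<times> real) set \<Rightarrow> bool" where
  "idealistic_filtration I \<longleftrightarrow>
     level I 0 = UNIV \<and>
     (\<forall>a. ideal (level I a)) \<and>
     (\<forall>a b. ideal_prod (level I a) (level I b) \<subseteq> level I (a + b)) \<and>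
     (\<forall>a b. b \<le> a \<longrightarrow> level I a \<subseteq> level I b)"

text \<open>
  Idealistic filtrations (also the saturated ones, below) are stable under intersection and
  include \<open>R \<times> \<real>\<close>, so the smallest one containing a given set is the intersection of all of
  them.
\<close>

definition generated_filtration :: "('r::comm_ring_1 \<times> real) set \<Rightarrow> ('r \<times> real) set" where
  "generated_filtration T = \<Inter>{I. idealistic_filtration I \<and> T \<subseteq> I}"

definition rfg_type :: "('r::comm_ring_1 \<times> real) set \<Rightarrow> bool" where
  "rfg_type I \<longleftrightarrow> (\<exists>T. finite T \<and> T \<subseteq> UNIV \<times> \<rat> \<and> I = generated_filtration T)"

definition saturated_under :: "(nat \<Rightarrow> ('r \<Rightarrow> 'r) set) \<Rightarrow> ('r \<times> real) set \<Rightarrow> bool" where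
  "saturated_under \<D> I \<longleftrightarrow>
     (\<forall>f a t d. (f, a) \<in> I \<and> d \<in> \<D> t \<longrightarrow> (d f, a - real t) \<in> I)"

definition saturation ::
    "(nat \<Rightarrow> ('r::comm_ring_1 \<Rightarrow> 'r) set) \<Rightarrow> ('r \<times> real) set \<Rightarrow> ('r \<times> real) set" where
  "saturation \<D> I = \<Inter>{J. idealistic_filtration J \<and> saturated_under \<D> J \<and> I \<subseteq> J}"

definition D_saturation ::
    "('k::field \<Rightarrow> 'r::comm_ring_1) \<Rightarrow> ('r \<times> real) set \<Rightarrow> ('r \<times> real) set" where
  "D_saturation \<iota> I = saturation (Diff \<iota>) I"

definition log_D_saturation ::
    "('k::field \<Rightarrow> 'r::comm_ring_1) \<Rightarrow> 'r set \<Rightarrow> ('r \<times> real) set \<Rightarrow> ('r \<times> real) set" where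
  "log_D_saturation \<iota> J I = saturation (Diff_log \<iota> J) I"

end

theory Submission
  imports Defs
begin

text \<open>
  Suppose \<open>I\<close> is generated by finitely many \<open>(f, a)\<close> with \<open>a\<close> rational. As \<open>R\<close> is Noetherian,
  each ideal \<open>{d f | d \<in> Diff\<^sup>t}\<close>, \<open>t \<le> \<lceil>a\<rceil>\<close>, is finitely generated; placing its generators at level \<open>a - t\<close>
  yields a finite set whose filtration \<open>H\<close> lies in the saturation. That \<open>H\<close> is itself saturated follows
  from the higher Leibniz rule: \<open>d (f g)\<close> lies in the ideal of the products \<open>d\<^sub>1 f \<cdot> d\<^sub>2 g\<close> with
  \<open>ord d\<^sub>1 + ord d\<^sub>2 \<le> ord d\<close>, where \<open>d\<^sub>1, d\<^sub>2\<close> are again logarithmic. This may be checked at each prime,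
  where smoothness provides coordinates adapted to the divisor with Hasse derivatives
  \<open>\<partial>\<^sub>i\<^sup>(\<^sup>j\<^sup>)\<close> (lifted from the Jacobian criterion by a Hensel argument for power series), and every
  logarithmic operator is a combination of products of \<open>x\<^sub>i\<^sup>j \<partial>\<^sub>i\<^sup>(\<^sup>j\<^sup>)\<close>, for branches \<open>x\<^sub>i\<close> of the divisor, and
  of \<open>\<partial>\<^sub>i\<^sup>(\<^sup>j\<^sup>)\<close> in the other directions. The plain case is the logarithmic one for \<open>E = R\<close>.
\<close>

section \<open>Ideals and Noetherian rings\<close>

text \<open>The multiplicative set is arbitrary, so even a maximal ideal of R may come from a
  non-closed point of the variety, whose residue field is transcendental over k. At such a point two
  notions of independence must be compared: normal crossings speak of m/m^2, the Jacobian criterion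
  of rows of derivatives. The bridge is a tangent vector for each branch, a derivation of the local
  ring into the residue field with prescribed values on m; it has to be extended over the residue
  field, which is the origin of the graphs of partial derivations and of the ring of p-th powers. A
  second obstacle is that coordinate operators exist only over the fraction field. Each has a common
  denominator, being determined by finitely many values and commutators; and since preserving E^l
  for l up to the order implies it for all l, finitely many denominators also secure the logarithmic
  condition. That distinct branches are coprime is read off their Hasse derivatives.\<close>

lemmas ideal_0 = module.subspace_0[OF module_times]
lemmas ideal_add = module.subspace_add[OF module_times]
lemmas ideal_mult = module.subspace_scale[OF module_times]
lemmas ideal_diff = module.subspace_diff[OF module_times]
lemmas ideal_sum = module.subspace_sum[OF module_times]
lemmas ideal_gen_base = module.span_base[OF module_times]
lemmas ideal_ideal_gen = module.subspace_span[OF module_times]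
lemmas ideal_gen_minimal = module.span_minimal[OF module_times]
lemmas ideal_gen_mono = module.span_mono[OF module_times]
lemmas ideal_def = module.subspace_def[OF module_times]

lemma ideal_mult2: "ideal J \<Longrightarrow> x \<in> J \<Longrightarrow> x * c \<in> J"
  using ideal_mult[of J x c] by (simp add: mult.commute)

lemma ideal_1: "ideal J \<Longrightarrow> 1 \<in> J \<Longrightarrow> J = UNIV"
  using ideal_mult2[of J 1] by auto

lemma idealI:
  assumes "0 \<in> J" "\<And>x y. x \<in> J \<Longrightarrow> y \<in> J \<Longrightarrow> x + y \<in> J" "\<And>c x. x \<in> J \<Longrightarrow> c * x \<in> J"
  shows "ideal J"
  using assms by (simp add: ideal_def)

lemma ideal_UNIV: "ideal UNIV"
  by (rule idealI) auto

lemma ideal_ideal_power: "ideal (ideal_power E s)"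
  by (cases s) (auto simp: ideal_prod_def ideal_UNIV intro: ideal_ideal_gen)

lemma ideal_power_Suc_mult:
  "x \<in> E \<Longrightarrow> y \<in> ideal_power E s \<Longrightarrow> x * y \<in> ideal_power E (Suc s)"
  by (auto simp: ideal_prod_def intro: ideal_gen_base)

lemma ideal_power_UNIV: "ideal_power UNIV s = (UNIV :: 'a::comm_ring_1 set)"
proof (induction s)
  case (Suc s)
  have "1 * 1 \<in> ideal_power (UNIV :: 'a set) (Suc s)"
    using Suc by (intro ideal_power_Suc_mult) simp_all
  hence "1 \<in> ideal_power (UNIV :: 'a set) (Suc s)" by (simp del: ideal_power.simps)
  thus ?case by (rule ideal_1[OF ideal_ideal_power])
qed simp

lemma power_in_ideal_power: "x \<in> E \<Longrightarrow> x ^ s \<in> ideal_power E s"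
  by (induction s) (auto simp: ideal_power_Suc_mult simp del: ideal_power.simps(2))

section \<open>Ring homomorphisms and subrings\<close>

lemma ring_homD:
  assumes "is_ring_hom h"
  shows "h 1 = 1" "h (x + y) = h x + h y" "h (x * y) = h x * h y"
  using assms by (auto simp: is_ring_hom_def)

lemma ring_hom_0: "is_ring_hom h \<Longrightarrow> h 0 = 0"
  using ring_homD(2)[of h 0 0] by simp

lemma ring_hom_uminus: "is_ring_hom h \<Longrightarrow> h (- x) = - h x"
  using ring_homD(2)[of h "- x" x] ring_hom_0[of h] by (simp add: eq_neg_iff_add_eq_0)

lemma ring_hom_diff: "is_ring_hom h \<Longrightarrow> h (x - y) = h x - h y"
  using ring_homD(2)[of h x "- y"] ring_hom_uminus[of h y] by simp

lemma ring_hom_sum: "is_ring_hom h \<Longrightarrow> h (sum f A) = (\<Sum>x\<in>A. h (f x))"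
  by (induction A rule: infinite_finite_induct) (auto simp: ring_hom_0 ring_homD)

lemma ring_hom_prod: "is_ring_hom h \<Longrightarrow> h (prod f A) = (\<Prod>x\<in>A. h (f x))"
  by (induction A rule: infinite_finite_induct) (auto simp: ring_homD)

lemma ring_hom_power: "is_ring_hom h \<Longrightarrow> h (x ^ n) = h x ^ n"
  by (induction n) (auto simp: ring_homD)

lemma ring_hom_of_nat: "is_ring_hom h \<Longrightarrow> h (of_nat n) = of_nat n"
  by (induction n) (auto simp: ring_homD ring_hom_0)

lemma ring_hom_comp: "is_ring_hom g \<Longrightarrow> is_ring_hom h \<Longrightarrow> is_ring_hom (g \<circ> h)"
  by (simp add: is_ring_hom_def)

lemma ring_hom_id: "is_ring_hom (\<lambda>x. x)"
  by (simp add: is_ring_hom_def)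

definition is_subring :: "'a::comm_ring_1 set \<Rightarrow> bool" where
  "is_subring C \<longleftrightarrow> 1 \<in> C \<and> (\<forall>x\<in>C. \<forall>y\<in>C. x - y \<in> C) \<and> (\<forall>x\<in>C. \<forall>y\<in>C. x * y \<in> C)"

lemma subring_1: "is_subring C \<Longrightarrow> 1 \<in> C"
  and subring_mult: "is_subring C \<Longrightarrow> x \<in> C \<Longrightarrow> y \<in> C \<Longrightarrow> x * y \<in> C"
  and subring_diff: "is_subring C \<Longrightarrow> x \<in> C \<Longrightarrow> y \<in> C \<Longrightarrow> x - y \<in> C"
  by (auto simp: is_subring_def)

lemma subring_0: "is_subring C \<Longrightarrow> 0 \<in> C"
  using subring_diff[of C 1 1] subring_1 by auto

lemma subring_uminus: "is_subring C \<Longrightarrow> x \<in> C \<Longrightarrow> - x \<in> C"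
  using subring_diff[of C 0 x] subring_0 by auto

lemma subring_add: "is_subring C \<Longrightarrow> x \<in> C \<Longrightarrow> y \<in> C \<Longrightarrow> x + y \<in> C"
  using subring_diff[of C x "- y"] subring_uminus by auto

lemma subring_sum: "is_subring C \<Longrightarrow> (\<And>x. x \<in> A \<Longrightarrow> f x \<in> C) \<Longrightarrow> sum f A \<in> C"
  by (induction A rule: infinite_finite_induct) (auto intro: subring_0 subring_add)

lemma subring_prod: "is_subring C \<Longrightarrow> (\<And>x. x \<in> A \<Longrightarrow> f x \<in> C) \<Longrightarrow> prod f A \<in> C"
  by (induction A rule: infinite_finite_induct) (auto intro: subring_1 subring_mult)

lemma subring_power: "is_subring C \<Longrightarrow> x \<in> C \<Longrightarrow> x ^ n \<in> C"
  by (induction n) (auto intro: subring_1 subring_mult)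

lemma subring_of_nat: "is_subring C \<Longrightarrow> of_nat n \<in> C"
  by (induction n) (auto intro: subring_0 subring_1 subring_add)

lemma subring_range: "is_ring_hom h \<Longrightarrow> is_subring (range h)"
  unfolding is_subring_def
  by (auto simp flip: ring_homD(3) ring_hom_diff) (metis ring_homD(1) rangeI)

section \<open>The ascending chain condition and Hilbert's basis theorem\<close>

definition ideal_in :: "'a::comm_ring_1 set \<Rightarrow> 'a set \<Rightarrow> bool" where
  "ideal_in C J \<longleftrightarrow> J \<subseteq> C \<and> 0 \<in> J \<and> (\<forall>x\<in>J. \<forall>y\<in>J. x + y \<in> J) \<and> (\<forall>c\<in>C. \<forall>x\<in>J. c * x \<in> J)"

text \<open>Relative to a subring of the ambient type, so that an algebra can be exhausted by
  adjoining its generators one at a time without changing the type.\<close>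

definition noetherian :: "'a::comm_ring_1 set \<Rightarrow> bool" where
  "noetherian C \<longleftrightarrow> (\<forall>J :: nat \<Rightarrow> 'a set. (\<forall>i. ideal_in C (J i)) \<longrightarrow> incseq J \<longrightarrow>
     (\<exists>N. \<forall>i\<ge>N. J i = J N))"

definition adjoin :: "'a::comm_ring_1 set \<Rightarrow> 'a \<Rightarrow> 'a set" where
  "adjoin C z = {poly p z | p. \<forall>i. coeff p i \<in> C}"

lemma ideal_in_UNIV: "ideal_in UNIV J \<longleftrightarrow> ideal J"
  by (auto simp: ideal_in_def ideal_def)

lemma noetherianD:
  "noetherian C \<Longrightarrow> (\<And>i. ideal_in C (J i)) \<Longrightarrow> incseq J \<Longrightarrow> \<exists>N. \<forall>i\<ge>N. J i = J (N::nat)"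
  unfolding noetherian_def by auto

lemma coeff_mult_in_subring:
  "is_subring C \<Longrightarrow> (\<And>i. coeff p i \<in> C) \<Longrightarrow> (\<And>i. coeff q i \<in> C) \<Longrightarrow> coeff (p * q) i \<in> C"
  by (auto simp: coeff_mult intro: subring_sum subring_mult)

lemma is_subring_adjoin:
  assumes "is_subring C" shows "is_subring (adjoin C z)"
proof -
  have "1 = poly 1 z" "\<forall>i. coeff (1::'a poly) i \<in> C"
    using assms by (auto simp: coeff_1 subring_0 subring_1)
  hence "1 \<in> adjoin C z" unfolding adjoin_def by blast
  moreover have "x - y \<in> adjoin C z \<and> x * y \<in> adjoin C z" if "x \<in> adjoin C z" "y \<in> adjoin C z" for x y
  proof -
    obtain p q where pq: "x = poly p z" "y = poly q z" "\<forall>i. coeff p i \<in> C" "\<forall>i. coeff q i \<in> C"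
      using \<open>x \<in> _\<close> \<open>y \<in> _\<close> unfolding adjoin_def by auto
    have "x - y = poly (p - q) z \<and> (\<forall>i. coeff (p - q) i \<in> C)"
      "x * y = poly (p * q) z \<and> (\<forall>i. coeff (p * q) i \<in> C)"
      using pq assms by (simp_all add: subring_diff coeff_mult_in_subring)
    thus ?thesis unfolding adjoin_def by blast
  qed
  ultimately show ?thesis
    unfolding is_subring_def by simp
qed

lemma adjoin_base: assumes "is_subring C" "c \<in> C" shows "c \<in> adjoin C z"
proof -
  have "c = poly [:c:] z \<and> (\<forall>i. coeff [:c:] i \<in> C)"
    using assms by (auto simp: coeff_pCons subring_0 split: nat.split)
  thus ?thesis unfolding adjoin_def by blast
qed

lemma adjoin_gen: assumes "is_subring C" shows "z \<in> adjoin C z"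
proof -
  have "z = poly [:0, 1:] z \<and> (\<forall>i. coeff [:0, 1:] i \<in> C)"
    using assms by (auto simp: coeff_pCons subring_0 subring_1 split: nat.split)
  thus ?thesis unfolding adjoin_def by blast
qed

text \<open>Hilbert's basis theorem for C[z], where z may satisfy relations over C: an ideal is
  studied through the polynomials over C whose value at z lies in it.\<close>

lemma noetherian_adjoin:
  fixes C :: "'a::comm_ring_1 set"
  assumes C: "is_subring C" and "noetherian C"
  shows "noetherian (adjoin C z)"
  unfolding noetherian_def
proof (intro allI impI)
  fix J :: "nat \<Rightarrow> 'a set"
  assume J: "\<forall>i. ideal_in (adjoin C z) (J i)" and inc: "incseq J"
  \<comment> \<open>Degree at most d, not exactly d, puts 0 into \<open>L i d\<close> and makes it
    closed under sums; multiplication by z leads from degree d to d + 1.\<close>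
  define L where "L i d = {coeff p d | p. (\<forall>k. coeff p k \<in> C) \<and> (\<forall>k>d. coeff p k = 0) \<and> poly p z \<in> J i}"
    for i d
  note Jd = J[unfolded ideal_in_def, rule_format]
  have L_ideal: "ideal_in C (L i d)" for i d
    unfolding ideal_in_def
  proof (intro conjI ballI)
    show "L i d \<subseteq> C" by (auto simp: L_def)
    show "0 \<in> L i d" unfolding L_def using Jd[of i] subring_0[OF C]
      by (intro CollectI exI[of _ 0]) auto
  next
    fix x y assume "x \<in> L i d" "y \<in> L i d"
    then obtain p q where "x = coeff p d" "\<forall>k. coeff p k \<in> C" "\<forall>k>d. coeff p k = 0" "poly p z \<in> J i"
      "y = coeff q d" "\<forall>k. coeff q k \<in> C" "\<forall>k>d. coeff q k = 0" "poly q z \<in> J i"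
      unfolding L_def by auto
    thus "x + y \<in> L i d" unfolding L_def using Jd[of i] C
      by (intro CollectI exI[of _ "p + q"]) (auto intro: subring_add)
  next
    fix c x assume c: "c \<in> C" and "x \<in> L i d"
    then obtain p where "x = coeff p d" "\<forall>k. coeff p k \<in> C" "\<forall>k>d. coeff p k = 0" "poly p z \<in> J i"
      unfolding L_def by auto
    thus "c * x \<in> L i d" unfolding L_def using Jd[of i] C c adjoin_base[OF C c, of z]
      by (intro CollectI exI[of _ "smult c p"]) (auto intro: subring_mult)
  qed
  have L_inc1: "L i d \<subseteq> L j d" if "i \<le> j" for i j d
    using incseqD[OF inc that] unfolding L_def by auto
  have L_Suc: "L i d \<subseteq> L i (Suc d)" for i d
  proof
    fix x assume "x \<in> L i d"
    then obtain p where p: "x = coeff p d" "\<forall>k. coeff p k \<in> C" "\<forall>k>d. coeff p k = 0" "poly p z \<in> J i"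
      unfolding L_def by auto
    have "z * poly p z \<in> J i" using Jd[of i] adjoin_gen[OF C] p(4) by blast
    with p show "x \<in> L i (Suc d)" unfolding L_def using subring_0[OF C]
      by (intro CollectI exI[of _ "pCons 0 p"]) (auto simp: coeff_pCons split: nat.split)
  qed
  have L_inc2: "L i d \<subseteq> L i e" if "d \<le> e" for i d e
    using lift_Suc_mono_le[of "L i", OF L_Suc that] .
  \<comment> \<open>The diagonal chain settles all degrees from N on at once. The finitely many
    smaller degrees are stabilized one by one, and \<open>K\<close> dominates all the indices
    involved.\<close>
  have "incseq (\<lambda>i. L i i)"
    by (intro incseq_SucI subset_trans[OF L_inc1 L_Suc]) simp
  then obtain N where N: "L i i = L N N" if "i \<ge> N" for i
    using \<open>noetherian C\<close>[unfolded noetherian_def, rule_format, of "\<lambda>i. L i i"] L_ideal by auto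
  have "\<exists>M. \<forall>i\<ge>M. L i d = L M d" for d
    using \<open>noetherian C\<close>[unfolded noetherian_def, rule_format, of "\<lambda>i. L i d"] L_ideal L_inc1
    by (auto simp: incseq_def)
  then obtain M where M: "\<And>d i. i \<ge> M d \<Longrightarrow> L i d = L (M d) d" by metis
  define K where "K = N + sum M {..<N}"
  have LK: "L i d = L K d" if "i \<ge> K" for i d
  proof (cases "d < N")
    case True
    hence "M d \<le> sum M {..<N}" by (intro member_le_sum) auto
    thus ?thesis using M[of d i] M[of d K] that unfolding K_def by auto
  next
    case False
    have eq: "L j d = L N N" if "j \<ge> N" for j
    proof
      have "L j d \<subseteq> L (max j d) (max j d)"
        by (rule subset_trans[OF L_inc1 L_inc2]) auto
      thus "L j d \<subseteq> L N N" using N[of "max j d"] that by auto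
      show "L N N \<subseteq> L j d" 
        by (rule subset_trans[OF L_inc1[OF that] L_inc2]) (use False in simp)
    qed
    show ?thesis using eq[of i] eq[of K] that unfolding K_def by auto
  qed
  have "J i \<subseteq> J K" if iK: "i \<ge> K" for i
  proof
    \<comment> \<open>Induction on a degree bound: the top coefficient of p is also that of some q
      with the same bound and value in \<open>J K\<close>, and p - q has a smaller bound.\<close>
    have *: "poly p z \<in> J K" if "\<forall>k. coeff p k \<in> C" "\<forall>k\<ge>d. coeff p k = 0" "poly p z \<in> J i" for p d
      using that
    proof (induction d arbitrary: p)
      case 0
      hence "p = 0" by (auto intro: poly_eqI)
      thus ?case using Jd[of K] by auto
    next
      case (Suc d)
      hence "coeff p d \<in> L i d" unfolding L_def by auto
      hence "coeff p d \<in> L K d" using LK[OF iK] by auto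
      then obtain q where q: "coeff p d = coeff q d" "\<forall>k. coeff q k \<in> C" "\<forall>k>d. coeff q k = 0" "poly q z \<in> J K"
        unfolding L_def by auto
      have qi: "poly q z \<in> J i" using q(4) incseqD[OF inc iK] by auto
      have "- 1 \<in> adjoin C z" using C is_subring_adjoin subring_1 subring_uminus by blast
      hence "- 1 * poly q z \<in> J i" using Jd[of i] qi by blast
      hence "poly p z + (- 1 * poly q z) \<in> J i" using Jd[of i] Suc.prems(3) by blast
      moreover have "coeff (p - q) k = 0" if "k \<ge> d" for k
        using that q Suc.prems(2) by (cases "k = d") auto
      ultimately have "poly (p - q) z \<in> J K"
        using Suc.prems(1) q(2) C by (intro Suc.IH) (auto intro: subring_diff)
      hence "poly (p - q) z + poly q z \<in> J K" using q Jd[of K] by blast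
      thus ?case by simp
    qed
    fix x assume x: "x \<in> J i"
    hence "x \<in> adjoin C z" using Jd[of i] by auto
    then obtain p where p: "x = poly p z" "\<forall>i. coeff p i \<in> C" by (auto simp: adjoin_def)
    show "x \<in> J K" using *[of p "Suc (degree p)"] p x by (auto simp: coeff_eq_0)
  qed
  hence "\<forall>i\<ge>K. J i = J K" using incseqD[OF inc, of K] by (auto intro!: subset_antisym)
  thus "\<exists>N. \<forall>i\<ge>N. J i = J N" ..
qed

lemma noetherian_range_field:
  fixes h :: "'k::field \<Rightarrow> 'a::comm_ring_1"
  assumes h: "is_ring_hom h" shows "noetherian (range h)"
  unfolding noetherian_def
proof (intro allI impI)
  fix J :: "nat \<Rightarrow> 'a set"
  assume J: "\<forall>i. ideal_in (range h) (J i)" and inc: "incseq J"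
  have sub: "J i \<subseteq> range h" and zero: "0 \<in> J i" and mult: "\<And>c x. x \<in> J i \<Longrightarrow> h c * x \<in> J i" for i
    using J[rule_format, of i] by (auto simp: ideal_in_def)
  have *: "J i = range h" if x: "x \<in> J i" "x \<noteq> 0" for i x
  proof -
    obtain c where c: "x = h c" using subsetD[OF sub x(1)] by auto
    hence "c \<noteq> 0" using x ring_hom_0[OF h] by auto
    hence "h (inverse c) * x = 1" unfolding c using ring_homD(1,3)[OF h] by (simp flip: ring_homD(3)[OF h])
    hence "1 \<in> J i" using mult[OF x(1), of "inverse c"] by simp
    hence "h y \<in> J i" for y using mult[of 1 i y] by simp
    thus ?thesis using sub[of i] by auto
  qed
  show "\<exists>N. \<forall>i\<ge>N. J i = J N"
  proof (cases "\<exists>i. \<exists>x\<in>J i. x \<noteq> 0")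
    case True
    then obtain i x where "x \<in> J i" "x \<noteq> 0" by auto
    hence "J j = range h" if "j \<ge> i" for j
      using incseqD[OF inc that] \<open>x \<in> J i\<close> \<open>x \<noteq> 0\<close> by (intro *[of x]) auto
    hence "\<forall>j\<ge>i. J j = J i" by simp
    thus ?thesis ..
  next
    case False
    hence "J i = {0}" for i using zero[of i] by auto
    thus ?thesis by simp
  qed
qed

lemma mpoly_eval_in_subring:
  assumes C: "is_subring C" and "range \<iota> \<subseteq> C" "\<And>i. i < n \<Longrightarrow> a i \<in> C" "p \<in> polys_in n"
  shows "mpoly_eval \<iota> a p \<in> C"
  unfolding mpoly_eval_def
  using assms by (intro subring_sum subring_mult subring_prod subring_power) (auto simp: polys_in_def)

lemma noetherian_algebra:
  fixes \<iota> :: "'k::field \<Rightarrow> 'a::comm_ring_1"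
  assumes h: "is_ring_hom \<iota>" and gen: "alg_generators \<iota> n a"
  shows "noetherian (UNIV :: 'a set)"
proof -
  have "\<exists>C. is_subring C \<and> noetherian C \<and> range \<iota> \<subseteq> C \<and> (\<forall>i<n. a i \<in> C)" for n
  proof (induction n)
    case 0
    thus ?case using subring_range[OF h] noetherian_range_field[OF h] by (intro exI[of _ "range \<iota>"]) simp
  next
    case (Suc n)
    then obtain C where C: "is_subring C" "noetherian C" "range \<iota> \<subseteq> C" "\<forall>i<n. a i \<in> C" by auto
    show ?case
      using C adjoin_base[OF C(1), of _ "a n"] adjoin_gen[OF C(1), of "a n"]
      by (intro exI[of _ "adjoin C (a n)"]) (auto simp: is_subring_adjoin noetherian_adjoin less_Suc_eq)
  qed
  then obtain C where C: "is_subring C" "noetherian C" "range \<iota> \<subseteq> C" "\<forall>i<n. a i \<in> C" by blast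
  have "mpoly_eval \<iota> a ` polys_in n \<subseteq> C"
    using mpoly_eval_in_subring[OF C(1,3), of n a] C(4) by auto
  hence "C = UNIV" using gen unfolding alg_generators_def by auto
  thus ?thesis using C by simp
qed

text \<open>Denominators are units, so an ideal of the localization is recovered from its preimage
  under \<phi>; a chain stabilizes as soon as the preimages do.\<close>

lemma noetherian_localization:
  fixes \<phi> :: "'a::comm_ring_1 \<Rightarrow> 'r::comm_ring_1"
  assumes noeth: "noetherian (UNIV :: 'a set)" and loc: "is_localization \<phi> S"
  shows "noetherian (UNIV :: 'r set)"
  unfolding noetherian_def ideal_in_UNIV
proof (intro allI impI)
  fix J :: "nat \<Rightarrow> 'r set"
  assume J: "\<forall>i. ideal (J i)" and inc: "incseq J"
  have h: "is_ring_hom \<phi>" using loc by (simp add: is_localization_def)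
  have "ideal (\<phi> -` J i)" for i
    using J[rule_format, of i] h
    by (intro idealI) (auto simp: ring_homD ring_hom_0 ideal_0 ideal_add ideal_mult)
  moreover have "incseq (\<lambda>i. \<phi> -` J i)" using inc by (auto simp: incseq_def)
  ultimately obtain N where N: "\<phi> -` J i = \<phi> -` J N" if "i \<ge> N" for i
    using noeth[unfolded noetherian_def ideal_in_UNIV, rule_format, of "\<lambda>i. \<phi> -` J i"] by auto
  have "r \<in> J N" if "i \<ge> N" "r \<in> J i" for i r
  proof -
    obtain x s where xs: "s \<in> S" "r * \<phi> s = \<phi> x" "\<phi> s dvd 1"
      using loc unfolding is_localization_def by meson
    then obtain u where u: "1 = \<phi> s * u" by (auto elim: dvdE)
    have "\<phi> x \<in> J i" using ideal_mult2[OF J[rule_format] that(2), of "\<phi> s"] xs by simp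
    hence "\<phi> x \<in> J N" using N[OF that(1)] by auto
    hence "\<phi> x * u \<in> J N" by (rule ideal_mult2[OF J[rule_format]])
    moreover have "\<phi> x * u = r * (\<phi> s * u)" unfolding xs(2)[symmetric] by (simp add: mult.assoc)
    hence "\<phi> x * u = r" using u by simp
    ultimately show ?thesis by simp
  qed
  hence "\<forall>i\<ge>N. J i = J N" using incseqD[OF inc, of N] by (auto intro!: subset_antisym)
  thus "\<exists>N. \<forall>i\<ge>N. J i = J N" ..
qed

section \<open>Consequences of the chain condition: finite generation and primes\<close>

lemma noetherian_maximal:
  assumes "noetherian (UNIV :: 'a::comm_ring_1 set)" "F \<noteq> {}" "\<And>J. J \<in> F \<Longrightarrow> ideal (J :: 'a set)"
  shows "\<exists>M\<in>F. \<forall>J\<in>F. M \<subseteq> J \<longrightarrow> J = M"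
proof (rule ccontr)
  assume "\<not> ?thesis"
  hence *: "\<exists>J\<in>F. M \<subset> J" if "M \<in> F" for M using that by blast
  have "\<exists>J. \<forall>i::nat. J i \<in> F \<and> J i \<subset> J (Suc i)"
    by (rule dependent_nat_choice[of "\<lambda>_ J. J \<in> F" "\<lambda>_ J J'. J \<subset> J'"]) (use * assms(2) in auto)
  then obtain J where J: "\<forall>i. J i \<in> F" "\<forall>i::nat. J i \<subset> J (Suc i)" by blast
  have "incseq J" using J(2) by (intro incseq_SucI) auto
  with assms(3) J(1) have "\<exists>N. \<forall>i\<ge>N. J i = J N"
    by (intro noetherianD[OF assms(1)]) (auto simp: ideal_in_UNIV)
  then obtain N where N: "\<forall>i\<ge>N. J i = J N" by (elim exE)
  have "J (Suc N) = J N" by (rule N[rule_format]) simp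
  thus False using J(2)[rule_format, of N] by simp
qed

lemma noetherian_finitely_generated:
  assumes "noetherian (UNIV :: 'a::comm_ring_1 set)" "ideal (J :: 'a set)"
  obtains F where "finite F" "F \<subseteq> J" "J = ideal_gen F"
proof -
  let ?G = "{ideal_gen F | F. finite F \<and> F \<subseteq> J}"
  have "ideal_gen {} \<in> ?G" by blast
  hence "?G \<noteq> {}" by blast
  have "\<exists>M\<in>?G. \<forall>J\<in>?G. M \<subseteq> J \<longrightarrow> J = M"
    using ideal_ideal_gen by (intro noetherian_maximal[OF assms(1) \<open>?G \<noteq> {}\<close>]) auto
  then obtain M where M: "M \<in> ?G" "\<forall>J\<in>?G. M \<subseteq> J \<longrightarrow> J = M"
    by (elim bexE)
  then obtain F where F0: "finite F" "F \<subseteq> J" "M = ideal_gen F" by auto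
  have F: "finite F" "F \<subseteq> J"
    "\<And>F'. finite F' \<Longrightarrow> F' \<subseteq> J \<Longrightarrow> ideal_gen F \<subseteq> ideal_gen F' \<Longrightarrow> ideal_gen F' = ideal_gen F"
    using F0 M(2) by auto
  have "x \<in> ideal_gen F" if "x \<in> J" for x
  proof -
    have "ideal_gen (insert x F) = ideal_gen F"
      using F that by (intro F(3)) (auto intro!: ideal_gen_mono)
    thus ?thesis using ideal_gen_base[of x "insert x F"] by auto
  qed
  thus ?thesis using that[of F] F ideal_gen_minimal[OF F(2) assms(2)] by auto
qed

lemma ideal_add_principal:
  assumes P: "ideal P"
  shows "ideal {p + c * x | p c. p \<in> P}" (is "ideal ?M")
proof (rule idealI)
  have "0 = 0 + 0 * x" by simp
  thus "0 \<in> ?M" using ideal_0[OF P] by blast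
next
  fix u v assume "u \<in> ?M" "v \<in> ?M"
  then obtain p c q d where u: "u = p + c * x" "v = q + d * x" and pq: "p \<in> P" "q \<in> P" by blast
  have "u + v = (p + q) + (c + d) * x" unfolding u by (simp add: algebra_simps)
  thus "u + v \<in> ?M" using ideal_add[OF P pq] by blast
next
  fix e u assume "u \<in> ?M"
  then obtain p d where u: "u = p + d * x" "p \<in> P" by blast
  have eq: "e * u = e * p + (e * d) * x" unfolding u(1) by (simp only: distrib_left mult.assoc)
  have "e * p \<in> P" by (rule ideal_mult[OF P u(2)])
  with eq show "e * u \<in> ?M" by (intro CollectI exI conjI)
qed

text \<open>A maximal element among the ideals that contain J but not 1 is prime.\<close>

lemma noetherian_prime_ideal:
  assumes "noetherian (UNIV :: 'a::comm_ring_1 set)" "ideal (J :: 'a set)" "1 \<notin> J"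
  obtains P where "prime_ideal P" "J \<subseteq> P"
proof -
  let ?G = "{M. ideal M \<and> J \<subseteq> M \<and> 1 \<notin> M}"
  have "J \<in> ?G" using assms by blast
  hence "?G \<noteq> {}" by auto
  have "\<exists>P\<in>?G. \<forall>M\<in>?G. P \<subseteq> M \<longrightarrow> M = P"
    by (intro noetherian_maximal[OF assms(1) \<open>?G \<noteq> {}\<close>]) auto
  then obtain P where P0: "P \<in> ?G" "\<forall>M\<in>?G. P \<subseteq> M \<longrightarrow> M = P" by (elim bexE)
  have P: "ideal P" "J \<subseteq> P" "1 \<notin> P" using P0(1) by auto
  have max: "M = P" if "ideal M" "P \<subseteq> M" "1 \<notin> M" for M
    using P0(2) that \<open>J \<subseteq> P\<close> by auto
  have "x \<in> P \<or> y \<in> P" if xy: "x * y \<in> P" for x y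
  proof (rule ccontr)
    assume n: "\<not> ?thesis"
    have *: "\<exists>c p. p \<in> P \<and> 1 = p + c * x" if "x \<notin> P" for x
    proof -
      let ?M = "{p + c * x | p c. p \<in> P}"
      have M: "ideal ?M" by (rule ideal_add_principal[OF P(1)])
      have PM: "P \<subseteq> ?M"
      proof
        fix p assume "p \<in> P"
        have "p = p + 0 * x" by simp
        thus "p \<in> ?M" using \<open>p \<in> P\<close> by blast
      qed
      have "x = 0 + 1 * x" "0 \<in> P" using ideal_0[OF P(1)] by simp_all
      hence xM: "x \<in> ?M" by blast
      have "1 \<in> ?M"
      proof (rule ccontr)
        assume "1 \<notin> ?M"
        hence "?M = P" by (rule max[OF M PM])
        hence "x \<in> P" using xM by (rule subst)
        thus False using that by (rule notE[rotated])
      qed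
      thus ?thesis by blast
    qed
    have nx: "x \<notin> P" "y \<notin> P" using n by auto
    obtain c p where cp: "p \<in> P" "1 = p + c * x" using *[OF nx(1)] by (elim exE conjE) (rule that)
    obtain d q where dq: "q \<in> P" "1 = q + d * y" using *[OF nx(2)] by (elim exE conjE) (rule that)
    have eq: "(p + c * x) * (q + d * y) = p * (q + d * y) + c * x * q + c * d * (x * y)"
      by (simp add: algebra_simps)
    have "(p + c * x) * (q + d * y) \<in> P" unfolding eq
      by (rule ideal_add[OF P(1) ideal_add[OF P(1) ideal_mult2[OF P(1) cp(1)] ideal_mult[OF P(1) dq(1)]]
        ideal_mult[OF P(1) xy]])
    hence "1 \<in> P" unfolding cp(2)[symmetric] dq(2)[symmetric] by simp
    with P(3) show False ..
  qed
  hence "prime_ideal P" using P unfolding prime_ideal_def by simp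
  thus ?thesis using P(2) by (rule that)
qed

section \<open>Polynomials\<close>

lemma poly_mapping_sum_single: "z = (\<Sum>k\<in>Poly_Mapping.keys z. Poly_Mapping.single k (Poly_Mapping.lookup z k))"
proof (rule poly_mapping_eqI)
  fix k
  show "Poly_Mapping.lookup z k =
      Poly_Mapping.lookup (\<Sum>k\<in>Poly_Mapping.keys z. Poly_Mapping.single k (Poly_Mapping.lookup z k)) k"
    by (cases "k \<in> Poly_Mapping.keys z")
      (auto simp: lookup_sum lookup_single when_def in_keys_iff intro!: sum.neutral)
qed

lemma poly_mapping_additive_induct:
  fixes z :: "'a \<Rightarrow>\<^sub>0 'b::comm_monoid_add"
  assumes "P 0" "\<And>k c. k \<in> Poly_Mapping.keys z \<Longrightarrow> P (Poly_Mapping.single k c)"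
    "\<And>x y. P x \<Longrightarrow> P y \<Longrightarrow> P (x + y)"
  shows "P z"
proof -
  have "P (\<Sum>k\<in>S. Poly_Mapping.single k (Poly_Mapping.lookup z k))" if "S \<subseteq> Poly_Mapping.keys z" for S
    using finite_subset[OF that finite_keys] that
    by (induction S rule: finite_induct) (auto intro: assms)
  from this[OF order_refl] show ?thesis by (simp flip: poly_mapping_sum_single)
qed

definition mpoly_monom :: "(nat \<Rightarrow> 'a::comm_ring_1) \<Rightarrow> (nat \<Rightarrow>\<^sub>0 nat) \<Rightarrow> 'a" where
  "mpoly_monom a m = (\<Prod>i\<in>Poly_Mapping.keys m. a i ^ Poly_Mapping.lookup m i)"

definition mpoly_var :: "nat \<Rightarrow> 'k::comm_ring_1 mpoly" where
  "mpoly_var i = Poly_Mapping.single (Poly_Mapping.single i 1) 1"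

lemma mpoly_monom_superset:
  "finite S \<Longrightarrow> Poly_Mapping.keys m \<subseteq> S \<Longrightarrow> mpoly_monom a m = (\<Prod>i\<in>S. a i ^ Poly_Mapping.lookup m i)"
  unfolding mpoly_monom_def by (rule prod.mono_neutral_left) (auto simp: in_keys_iff)

lemma mpoly_monom_add: "mpoly_monom a (m + m') = mpoly_monom a m * mpoly_monom a m'"
proof -
  let ?S = "Poly_Mapping.keys m \<union> Poly_Mapping.keys m'"
  have "mpoly_monom a (m + m') = (\<Prod>i\<in>?S. a i ^ Poly_Mapping.lookup (m + m') i)"
    using Poly_Mapping.keys_add[of m m'] by (intro mpoly_monom_superset) auto
  also have "\<dots> = (\<Prod>i\<in>?S. a i ^ Poly_Mapping.lookup m i) * (\<Prod>i\<in>?S. a i ^ Poly_Mapping.lookup m' i)"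
    by (simp add: lookup_add power_add prod.distrib)
  also have "\<dots> = mpoly_monom a m * mpoly_monom a m'"
    by (simp add: mpoly_monom_superset[of ?S])
  finally show ?thesis .
qed

lemma mpoly_monom_simps [simp]: "mpoly_monom a 0 = 1" "mpoly_monom a (Poly_Mapping.single i (Suc 0)) = a i"
  unfolding mpoly_monom_def by simp_all

context
  fixes \<iota> :: "'k::comm_ring_1 \<Rightarrow> 'a::comm_ring_1"
  assumes hom: "is_ring_hom \<iota>"
begin

lemma mpoly_eval_add: "mpoly_eval \<iota> a (p + q) = mpoly_eval \<iota> a p + mpoly_eval \<iota> a q"
  unfolding mpoly_eval_def
  by (rule setsum_keys_plus_distrib) (auto simp: ring_hom_0[OF hom] ring_homD[OF hom] algebra_simps)

lemma mpoly_eval_0: "mpoly_eval \<iota> a 0 = 0"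
  by (simp add: mpoly_eval_def)

lemma mpoly_eval_single: "mpoly_eval \<iota> a (Poly_Mapping.single m c) = \<iota> c * mpoly_monom a m"
  by (cases "c = 0") (auto simp: mpoly_eval_def mpoly_monom_def ring_hom_0[OF hom])

lemma mpoly_eval_const: "mpoly_eval \<iota> a (Poly_Mapping.single 0 c) = \<iota> c"
  by (simp add: mpoly_eval_single)

lemma mpoly_eval_var: "mpoly_eval \<iota> a (mpoly_var i) = a i"
  by (simp add: mpoly_var_def mpoly_eval_single ring_homD[OF hom])

lemma mpoly_eval_mult: "mpoly_eval \<iota> a (p * q) = mpoly_eval \<iota> a p * mpoly_eval \<iota> a q"
proof (induction p rule: poly_mapping_additive_induct)
  case (2 k c)
  show ?case
  proof (induction q rule: poly_mapping_additive_induct)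
    case (2 l e)
    show ?case
      by (simp add: mult_single mpoly_eval_single mpoly_monom_add ring_homD[OF hom] algebra_simps)
  qed (simp_all add: mpoly_eval_0 mpoly_eval_add algebra_simps)
qed (simp_all add: mpoly_eval_0 mpoly_eval_add algebra_simps)

lemma mpoly_eval_uminus: "mpoly_eval \<iota> a (- p) = - mpoly_eval \<iota> a p"
  using mpoly_eval_add[of a p "- p"] by (simp add: mpoly_eval_0 eq_neg_iff_add_eq_0 add.commute)

lemma mpoly_eval_sum: "mpoly_eval \<iota> a (sum f S) = (\<Sum>i\<in>S. mpoly_eval \<iota> a (f i))"
  by (induction S rule: infinite_finite_induct) (auto simp: mpoly_eval_0 mpoly_eval_add)

end

lemma mpoly_eval_hom:
  "is_ring_hom h \<Longrightarrow> h (mpoly_eval \<iota> a p) = mpoly_eval (h \<circ> \<iota>) (h \<circ> a) p"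
  by (simp add: mpoly_eval_def ring_hom_sum ring_hom_prod ring_hom_power ring_homD)

lemma polys_in_const: "Poly_Mapping.single 0 c \<in> polys_in n"
  by (simp add: polys_in_def)

lemma polys_in_0: "0 \<in> polys_in n"
  by (simp add: polys_in_def)

lemma polys_in_1: "1 \<in> polys_in n"
  using polys_in_const[of 1 n] by simp

lemma polys_in_var: "i < n \<Longrightarrow> mpoly_var i \<in> polys_in n"
  by (simp add: polys_in_def mpoly_var_def)

lemma polys_in_add: "p \<in> polys_in n \<Longrightarrow> q \<in> polys_in n \<Longrightarrow> p + q \<in> polys_in n"
  using Poly_Mapping.keys_add[of p q] by (auto simp: polys_in_def)

lemma polys_in_uminus: "p \<in> polys_in n \<Longrightarrow> - p \<in> polys_in n"
  by (simp add: polys_in_def in_keys_iff)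

lemma polys_in_mult:
  assumes "p \<in> polys_in n" "q \<in> polys_in n" shows "p * q \<in> polys_in n"
  unfolding polys_in_def
proof (intro CollectI ballI)
  fix m assume "m \<in> Poly_Mapping.keys (p * q)"
  then obtain k l where "k \<in> Poly_Mapping.keys p" "l \<in> Poly_Mapping.keys q" "m = k + l"
    using keys_mult[of p q] by blast
  thus "Poly_Mapping.keys m \<subseteq> {..<n}"
    using assms Poly_Mapping.keys_add[of k l] unfolding polys_in_def by fastforce
qed

text \<open>The product step is restricted to a single variable factor, which is the case in which
  derivatives and evaluations have a simple rule. Monomials are reached by induction on their total
  degree.\<close>

lemma polys_in_induct [consumes 1, case_names const add var]:
  assumes "p \<in> polys_in n"
    and const: "\<And>c. P (Poly_Mapping.single 0 c)"
    and add: "\<And>p q. p \<in> polys_in n \<Longrightarrow> q \<in> polys_in n \<Longrightarrow> P p \<Longrightarrow> P q \<Longrightarrow> P (p + q)"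
    and var: "\<And>i p. i < n \<Longrightarrow> p \<in> polys_in n \<Longrightarrow> P p \<Longrightarrow> P (mpoly_var i * p)"
  shows "P p"
proof -
  let ?Q = "\<lambda>p. p \<in> polys_in n \<and> P p"
  have single: "?Q (Poly_Mapping.single m c)" if "Poly_Mapping.keys m \<subseteq> {..<n}" for m c
    using that
  proof (induction "sum (Poly_Mapping.lookup m) {..<n}" arbitrary: m rule: less_induct)
    case less
    show ?case
    proof (cases "m = 0")
      case True
      thus ?thesis using const polys_in_const by simp
    next
      case False
      then obtain i where i: "i \<in> Poly_Mapping.keys m"
        by (metis lookup_zero not_in_keys_iff_lookup_eq_zero poly_mapping_eqI)
      hence "i < n" using less.prems by auto
      define m' where "m' = m - Poly_Mapping.single i 1"
      have m: "m = Poly_Mapping.single i 1 + m'"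
        unfolding m'_def using i
        by (intro poly_mapping_eqI) (auto simp: lookup_add lookup_minus lookup_single when_def in_keys_iff)
      have "Poly_Mapping.keys m' \<subseteq> Poly_Mapping.keys m"
        unfolding m'_def by (auto simp: in_keys_iff lookup_minus)
      hence "Poly_Mapping.keys m' \<subseteq> {..<n}" using less.prems by (rule order_trans)
      moreover have "sum (Poly_Mapping.lookup m') {..<n} < sum (Poly_Mapping.lookup m) {..<n}"
        using \<open>i < n\<close> unfolding m
        by (intro sum_strict_mono_ex1) (auto simp: lookup_add lookup_single when_def intro!: bexI[of _ i])
      ultimately have "?Q (Poly_Mapping.single m' c)" using less.hyps by blast
      moreover have "Poly_Mapping.single m c = mpoly_var i * Poly_Mapping.single m' c"
        by (simp add: mpoly_var_def mult_single m)
      ultimately show ?thesis using var \<open>i < n\<close> polys_in_mult polys_in_var by metis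
    qed
  qed
  have "?Q p"
  proof (rule poly_mapping_additive_induct[where P = ?Q])
    show "?Q 0" using const[of 0] polys_in_0 by simp
    show "?Q (Poly_Mapping.single k c)" if "k \<in> Poly_Mapping.keys p" for k c
      using that assms(1) by (intro single) (auto simp: polys_in_def)
    show "?Q (x + y)" if "?Q x" "?Q y" for x y using that add[of x y] polys_in_add[of x n y] by simp
  qed
  thus ?thesis by simp
qed

section \<open>Formal partial derivatives and first-order Taylor expansion\<close>

lemma mpoly_deriv_add: "mpoly_deriv i (p + q) = mpoly_deriv i p + mpoly_deriv i q"
  unfolding mpoly_deriv_def
  by (rule setsum_keys_plus_distrib) (auto simp: algebra_simps single_add)

lemma mpoly_deriv_single:
  "mpoly_deriv i (Poly_Mapping.single m c) =
    Poly_Mapping.single (m - Poly_Mapping.single i 1) (of_nat (Poly_Mapping.lookup m i) * c)"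
  by (cases "c = 0") (auto simp: mpoly_deriv_def)

lemma mpoly_deriv_const: "mpoly_deriv i (Poly_Mapping.single 0 c) = 0"
  by (simp add: mpoly_deriv_single)

lemma mpoly_deriv_0: "mpoly_deriv i 0 = 0"
  by (simp add: mpoly_deriv_def)

lemma mpoly_deriv_var_mult:
  "mpoly_deriv i (mpoly_var j * p) = (if i = j then p else 0) + mpoly_var j * mpoly_deriv i p"
proof (induction p rule: poly_mapping_additive_induct)
  case 1
  show ?case by (simp add: mpoly_deriv_0)
next
  case (2 m c)
  let ?s = "\<lambda>i. Poly_Mapping.single i (1::nat)"
  have split: "?s j + m - ?s i = ?s j + (m - ?s i)" if "Poly_Mapping.lookup m i \<noteq> 0"
    using that by (intro poly_mapping_eqI) (auto simp: lookup_add lookup_minus lookup_single when_def)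
  have diag: "?s i + m - ?s i = m"
    by (intro poly_mapping_eqI) (auto simp: lookup_add lookup_minus)
  show ?case
  proof (cases "Poly_Mapping.lookup m i = 0")
    case True
    thus ?thesis
      by (auto simp: mpoly_var_def mult_single mpoly_deriv_single lookup_add lookup_single diag[simplified])
  next
    case False
    thus ?thesis using split diag
      by (auto simp: mpoly_var_def mult_single mpoly_deriv_single lookup_add lookup_single
          algebra_simps single_add)
  qed
next
  case (3 p q)
  thus ?case by (simp add: distrib_left mpoly_deriv_add)
qed

lemma mpoly_deriv_var: "mpoly_deriv i (mpoly_var j :: 'k::comm_ring_1 mpoly) = (if i = j then 1 else 0)"
  using mpoly_deriv_var_mult[of i j "1 :: 'k mpoly"] mpoly_deriv_const[of i "1::'k"] by simp

text \<open>Only the products \<open>e i * e j\<close> are discarded, so the expansion is valid in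
  every characteristic, with J as the ideal of error terms.\<close>

lemma mpoly_taylor:
  assumes hom: "is_ring_hom \<iota>" and J: "ideal J" and e: "\<And>i j. i < n \<Longrightarrow> j < n \<Longrightarrow> e i * e j \<in> J"
    and p: "p \<in> polys_in n"
  shows "mpoly_eval \<iota> (\<lambda>i. u i + e i) p - mpoly_eval \<iota> u p - (\<Sum>i<n. mpoly_eval \<iota> u (mpoly_deriv i p) * e i) \<in> J"
  using p
proof (induction p rule: polys_in_induct)
  case (const c)
  show ?case by (simp add: mpoly_eval_const[OF hom] mpoly_deriv_const mpoly_eval_0[OF hom] ideal_0[OF J])
next
  case (add p q)
  show ?case
    using ideal_add[OF J add(3,4)]
    by (simp add: mpoly_eval_add[OF hom] mpoly_deriv_add distrib_right sum.distrib algebra_simps)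
next
  case (var j p)
  let ?E = "mpoly_eval \<iota> u p" and ?E' = "mpoly_eval \<iota> (\<lambda>i. u i + e i) p"
    and ?D = "\<lambda>i. mpoly_eval \<iota> u (mpoly_deriv i p)"
  have s: "(\<Sum>i<n. mpoly_eval \<iota> u (mpoly_deriv i (mpoly_var j * p)) * e i) = ?E * e j + u j * (\<Sum>i<n. ?D i * e i)"
  proof -
    have "mpoly_eval \<iota> u (mpoly_deriv i (mpoly_var j * p)) * e i =
      (if i = j then ?E * e i else 0) + u j * (?D i * e i)" for i
      by (simp add: mpoly_deriv_var_mult mpoly_eval_add[OF hom] mpoly_eval_mult[OF hom]
          mpoly_eval_var[OF hom] mpoly_eval_0[OF hom] distrib_right mult.assoc)
    thus ?thesis using var(1) by (simp add: sum.distrib sum_distrib_left)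
  qed
  have "(\<Sum>i<n. ?D i * (e j * e i)) \<in> J"
    using var(1) by (intro ideal_sum[OF J] ideal_mult[OF J] e) auto
  hence "(u j + e j) * (?E' - ?E - (\<Sum>i<n. ?D i * e i)) + (\<Sum>i<n. ?D i * (e j * e i)) \<in> J"
    using ideal_add[OF J ideal_mult[OF J var(3)]] by blast
  moreover have "(\<Sum>i<n. ?D i * (e j * e i)) = e j * (\<Sum>i<n. ?D i * e i)"
    by (simp add: sum_distrib_left algebra_simps)
  ultimately show ?case
    unfolding s by (simp add: mpoly_eval_mult[OF hom] mpoly_eval_var[OF hom] algebra_simps)
qed

section \<open>Differential operators via commutators\<close>

text \<open>The structure map h is a parameter so that operators on R, on its fraction field, and
  from R to its fraction field share one calculus.\<close>

definition commutator :: "('r::comm_ring_1 \<Rightarrow> 's::comm_ring_1) \<Rightarrow> 'r \<Rightarrow> ('r \<Rightarrow> 's) \<Rightarrow> 'r \<Rightarrow> 's" where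
  "commutator h y d = (\<lambda>x. d (y * x) - h y * d x)"

definition klinear ::
    "('r::comm_ring_1 \<Rightarrow> 's::comm_ring_1) \<Rightarrow> ('k::field \<Rightarrow> 'r) \<Rightarrow> ('r \<Rightarrow> 's) \<Rightarrow> bool" where
  "klinear h \<iota> d \<longleftrightarrow> (\<forall>x y. d (x + y) = d x + d y) \<and> (\<forall>c x. d (\<iota> c * x) = h (\<iota> c) * d x)"

text \<open>
  \<open>diffop h \<iota> n d\<close>: \<open>d\<close> is a \<open>k\<close>-linear differential operator of order strictly less than \<open>n\<close>
  from \<open>R\<close> to the \<open>R\<close>-algebra given by \<open>h\<close>.
\<close>

primrec diffop ::
    "('r::comm_ring_1 \<Rightarrow> 's::comm_ring_1) \<Rightarrow> ('k::field \<Rightarrow> 'r) \<Rightarrow> nat \<Rightarrow> ('r \<Rightarrow> 's) \<Rightarrow> bool" where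
  "diffop h \<iota> 0 d \<longleftrightarrow> (\<forall>x. d x = 0)"
| "diffop h \<iota> (Suc n) d \<longleftrightarrow> klinear h \<iota> d \<and> (\<forall>y. diffop h \<iota> n (commutator h y d))"

lemma klinearD: "klinear h \<iota> d \<Longrightarrow> d (x + y) = d x + d y" "klinear h \<iota> d \<Longrightarrow> d (\<iota> c * x) = h (\<iota> c) * d x"
  by (auto simp: klinear_def)

lemma klinear_0: "klinear h \<iota> d \<Longrightarrow> d 0 = 0"
  using klinearD(1)[of h \<iota> d 0 0] by simp

lemma klinear_diff: "klinear h \<iota> d \<Longrightarrow> d (x - y) = d x - d y"
  using klinearD(1)[of h \<iota> d "x - y" y] by simp

lemma diffop_klinear: "diffop h \<iota> n d \<Longrightarrow> klinear h \<iota> d"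
  by (cases n) (auto simp: klinear_def)

lemma diffop_commutator: "diffop h \<iota> (Suc n) d \<Longrightarrow> diffop h \<iota> n (commutator h y d)"
  by simp

lemma diffop_zero: "diffop h \<iota> n (\<lambda>x. 0)"
  by (induction n) (auto simp: commutator_def klinear_def)

lemma diffop_Suc: "diffop h \<iota> n d \<Longrightarrow> diffop h \<iota> (Suc n) d"
proof (induction n arbitrary: d)
  case 0
  hence "d = (\<lambda>x. 0)" by auto
  thus ?case using diffop_zero by blast
next
  case (Suc n)
  show ?case unfolding diffop.simps(2)[of h \<iota> "Suc n" d]
    using Suc.IH Suc.prems by auto
qed

lemma diffop_mono: "n \<le> m \<Longrightarrow> diffop h \<iota> n d \<Longrightarrow> diffop h \<iota> m d"
  by (induction m rule: dec_induct) (auto intro: diffop_Suc simp del: diffop.simps)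

lemma diffop_add: "diffop h \<iota> n d \<Longrightarrow> diffop h \<iota> n e \<Longrightarrow> diffop h \<iota> n (\<lambda>x. d x + e x)"
proof (induction n arbitrary: d e)
  case (Suc n)
  have "commutator h y (\<lambda>x. d x + e x) = (\<lambda>x. commutator h y d x + commutator h y e x)" for y
    by (auto simp: commutator_def algebra_simps)
  thus ?case using Suc by (auto simp: klinear_def algebra_simps)
qed simp

lemma diffop_scale: "diffop h \<iota> n d \<Longrightarrow> diffop h \<iota> n (\<lambda>x. c * d x)"
proof (induction n arbitrary: d)
  case (Suc n)
  have "commutator h y (\<lambda>x. c * d x) = (\<lambda>x. c * commutator h y d x)" for y
    by (auto simp: commutator_def algebra_simps)
  thus ?case using Suc by (auto simp: klinear_def algebra_simps)
qed simp

lemma diffop_diff: "diffop h \<iota> n d \<Longrightarrow> diffop h \<iota> n e \<Longrightarrow> diffop h \<iota> n (\<lambda>x. d x - e x)"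
  using diffop_add[of h \<iota> n d "\<lambda>x. - 1 * e x"] diffop_scale[of h \<iota> n e "- 1"] by simp

lemma diffop_sum:
  "(\<And>i. i \<in> S \<Longrightarrow> diffop h \<iota> n (f i)) \<Longrightarrow> diffop h \<iota> n (\<lambda>x. \<Sum>i\<in>S. f i x)"
  by (induction S rule: infinite_finite_induct) (auto intro: diffop_zero diffop_add simp del: diffop.simps)

lemma commutator_commute:
  "is_ring_hom h \<Longrightarrow> commutator h x (commutator h y d) = commutator h y (commutator h x d)"
  by (auto simp: commutator_def algebra_simps)

lemma diffop_premult:
  assumes "is_ring_hom h" "diffop h \<iota> n d" shows "diffop h \<iota> n (\<lambda>x. d (r * x))"
proof -
  have "diffop h \<iota> n (commutator h r d)"
  proof (cases n)
    case 0
    thus ?thesis using assms(2) by (simp add: commutator_def)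
  next
    case (Suc m)
    thus ?thesis using diffop_Suc[of h \<iota> m "commutator h r d"] assms(2) by simp
  qed
  from diffop_add[OF this diffop_scale[OF assms(2), of "h r"]] show ?thesis
    by (simp add: commutator_def)
qed

text \<open>\<open>[d e, y] = d [e, y] + [d, h y] e\<close>, and both summands have smaller total
  order. The arguments are strict bounds, hence \<open>Suc (n + m)\<close> from \<open>Suc n\<close>
  and \<open>Suc m\<close>.\<close>

lemma diffop_comp:
  assumes "is_ring_hom h" "is_ring_hom g"
  shows "diffop g (h \<circ> \<iota>) (Suc n) d \<Longrightarrow> diffop h \<iota> (Suc m) e \<Longrightarrow> diffop (g \<circ> h) \<iota> (Suc (n + m)) (d \<circ> e)"
proof (induction "n + m" arbitrary: n m d e rule: less_induct)
  case less
  have d: "klinear g (h \<circ> \<iota>) d" and e: "klinear h \<iota> e" using less.prems by simp_all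
  have lin: "klinear (g \<circ> h) \<iota> (d \<circ> e)"
    using d e unfolding klinear_def by simp
  have "diffop (g \<circ> h) \<iota> (n + m) (commutator (g \<circ> h) y (d \<circ> e))" for y
  proof -
    have eq: "commutator (g \<circ> h) y (d \<circ> e) =
        (\<lambda>x. (d \<circ> commutator h y e) x + (commutator g (h y) d \<circ> e) x)"
      using klinear_diff[OF d] by (auto simp: commutator_def)
    have 1: "diffop (g \<circ> h) \<iota> (n + m) (d \<circ> commutator h y e)"
    proof (cases m)
      case 0
      hence "d \<circ> commutator h y e = (\<lambda>x. 0)" using less.prems(2) klinear_0[OF d] by auto
      thus ?thesis using diffop_zero by simp
    next
      case (Suc m')
      thus ?thesis using less.hyps[of n m' d "commutator h y e"] less.prems by simp
    qed
    have 2: "diffop (g \<circ> h) \<iota> (n + m) (commutator g (h y) d \<circ> e)"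
    proof (cases n)
      case 0
      hence "commutator g (h y) d \<circ> e = (\<lambda>x. 0)" using less.prems(1) by auto
      thus ?thesis using diffop_zero by simp
    next
      case (Suc n')
      thus ?thesis using less.hyps[of n' m "commutator g (h y) d" e] less.prems by simp
    qed
    show ?thesis unfolding eq by (rule diffop_add[OF 1 2])
  qed
  thus ?case using lin by simp
qed

lemma diffop_ident:
  assumes "is_ring_hom h" shows "diffop h \<iota> (Suc 0) h"
  using assms by (simp add: klinear_def commutator_def ring_homD)

subsection \<open>Comparison with principal parts\<close>

lemma mult_map_add:
  "is_ring_hom \<iota> \<Longrightarrow> mult_map \<iota> (z + w) = mult_map \<iota> z + mult_map \<iota> w"
  unfolding mult_map_def
  by (rule setsum_keys_plus_distrib) (auto simp: ring_hom_0 ring_homD algebra_simps)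

lemma mult_map_single: "is_ring_hom \<iota> \<Longrightarrow> mult_map \<iota> (pure x y c) = \<iota> c * (x * y)"
  by (cases "c = 0") (auto simp: mult_map_def ring_hom_0)

lemma pure_mult: "pure x y c * pure x' y' c' = pure (x * x') (y * y') (c * c')"
  by (simp add: mult_single plus_mult_pair_def)

lemma coset_eq:
  assumes J: "ideal J" and "z - w \<in> J" shows "coset J z = coset J w"
proof -
  have "z' - z \<in> J \<longleftrightarrow> z' - w \<in> J" for z'
    using ideal_add[OF J _ assms(2), of "z' - z"] ideal_diff[OF J _ assms(2), of "z' - w"] by auto
  thus ?thesis by (auto simp: coset_def)
qed

text \<open>Commuting with y amounts to multiplying the argument of u by the difference of 1
  \<otimes> y and y \<otimes> 1, an element of the kernel of multiplication. After t + 1 commutators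
  the argument lies in the power of the diagonal ideal on which u vanishes.\<close>

lemma Diff_imp_diffop:
  fixes \<iota> :: "'k::field \<Rightarrow> 'r::comm_ring_1"
  assumes hom: "is_ring_hom \<iota>" and "d \<in> Diff \<iota> t"
  shows "diffop (\<lambda>x. x) \<iota> (Suc t) d"
proof -
  let ?D = "diag_ideal \<iota> (Suc t)" and ?K = "{z. mult_map \<iota> z = 0}"
  obtain u where u: "principal_parts_hom \<iota> (Suc t) u" and d: "\<And>r. d r = u (coset ?D (pure 1 r 1))"
    using assms(2) unfolding Diff_def by auto
  define U where "U z = u (coset ?D z)" for z
  have U_add: "U (z + w) = U z + U w" and U_scale: "U (pure r 1 1 * z) = r * U z" for z w r
    using u unfolding principal_parts_hom_def U_def by auto
  have D: "ideal ?D" unfolding diag_ideal_def by (rule ideal_ideal_gen)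
  have U_eq: "U z = U w" if "z - w \<in> ?D" for z w
    unfolding U_def using coset_eq[OF D that] by simp
  have "U (0 + 0) = U 0 + U 0" by (rule U_add)
  hence U_D: "U z = 0" if "z \<in> ?D" for z using U_eq[of z 0] that by simp
  have U_diff: "U (z - w) = U z - U w" for z w using U_add[of "z - w" w] by simp
  have T: "tensor_ideal \<iota> \<subseteq> ?D" unfolding diag_ideal_def by (auto intro: ideal_gen_base)
  \<comment> \<open>The multiplier z has absorbed j commutators already and n are still to
    come.\<close>
  have "diffop (\<lambda>x. x) \<iota> n (\<lambda>x. U (z * pure 1 x 1))"
    if "z \<in> ideal_power ?K j" "j + n = Suc t" for n j z
    using that
  proof (induction n arbitrary: j z)
    case 0
    have "z \<in> ?D" unfolding diag_ideal_def using 0 by (intro ideal_gen_base) auto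
    thus ?case using U_D ideal_mult2[OF D] by simp
  next
    case (Suc n)
    let ?e = "\<lambda>x. U (z * pure 1 x 1)"
    have "?e (x + y) = ?e x + ?e y" for x y
    proof -
      have "pure 1 (x + y) 1 - pure 1 x 1 - pure 1 y 1 \<in> ?D"
        by (rule subsetD[OF T], unfold tensor_ideal_def, rule ideal_gen_base, blast)
      hence "z * (pure 1 (x + y) 1 - pure 1 x 1 - pure 1 y 1) \<in> ?D" by (rule ideal_mult[OF D])
      from U_D[OF this] show ?thesis by (simp add: right_diff_distrib U_diff diff_eq_eq add.commute)
    qed
    moreover have "?e (\<iota> c * x) = \<iota> c * ?e x" for c x
    proof -
      have "pure 1 (\<iota> c * x) 1 - pure 1 x c \<in> ?D" "pure (\<iota> c * 1) x 1 - pure 1 x c \<in> ?D"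
        by (rule subsetD[OF T], unfold tensor_ideal_def, rule ideal_gen_base, blast)+
      hence "pure 1 (\<iota> c * x) 1 - pure (\<iota> c) x 1 \<in> ?D" using ideal_diff[OF D] by fastforce
      hence "z * (pure 1 (\<iota> c * x) 1 - pure (\<iota> c) x 1) \<in> ?D" by (rule ideal_mult[OF D])
      from U_D[OF this] have "?e (\<iota> c * x) = U (z * pure (\<iota> c) x 1)" by (simp add: right_diff_distrib U_diff)
      also have "z * pure (\<iota> c) x 1 = pure (\<iota> c) 1 1 * (z * pure 1 x 1)"
        by (simp add: mult.left_commute pure_mult)
      finally show ?thesis by (simp only: U_scale)
    qed
    ultimately have lin: "klinear (\<lambda>x. x) \<iota> ?e" by (simp add: klinear_def)
    have "diffop (\<lambda>x. x) \<iota> n (commutator (\<lambda>x. x) y ?e)" for y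
    proof -
      let ?dl = "pure 1 y 1 - pure y 1 1 :: ('k, 'r) pair_algebra"
      have "mult_map \<iota> ?dl + mult_map \<iota> (pure y 1 1) = mult_map \<iota> (pure 1 y 1)"
        by (simp flip: mult_map_add[OF hom])
      hence "?dl \<in> ?K" by (simp add: mult_map_single[OF hom])
      hence "?dl * z \<in> ideal_power ?K (Suc j)" using Suc.prems(1) by (rule ideal_power_Suc_mult)
      hence "diffop (\<lambda>x. x) \<iota> n (\<lambda>x. U ((?dl * z) * pure 1 x 1))" using Suc.prems(2) by (intro Suc.IH) auto
      moreover have "(\<lambda>x. U ((?dl * z) * pure 1 x 1)) = commutator (\<lambda>x. x) y ?e"
      proof
        fix x
        have "(?dl * z) * pure 1 x 1 = z * (pure 1 y 1 * pure 1 x 1) - pure y 1 1 * (z * pure 1 x 1)"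
          by (simp add: algebra_simps)
        thus "U ((?dl * z) * pure 1 x 1) = commutator (\<lambda>x. x) y ?e x"
          by (simp only: U_diff U_scale commutator_def pure_mult mult_1)
      qed
      ultimately show ?thesis by simp
    qed
    thus ?case using lin by simp
  qed
  from this[of 1 0 "Suc t"] have "diffop (\<lambda>x. x) \<iota> (Suc t) (\<lambda>x. U (pure 1 x 1))" by simp
  moreover have "(\<lambda>x. U (pure 1 x 1)) = d" using d by (auto simp: U_def)
  ultimately show ?thesis by simp
qed

text \<open>The R-linear extension of d that sends the pair (x, y) to x d(y), before any quotient is
  taken.\<close>

definition apply_pairs :: "('k::field \<Rightarrow> 'r::comm_ring_1) \<Rightarrow> ('r \<Rightarrow> 'r) \<Rightarrow> ('k, 'r) pair_algebra \<Rightarrow> 'r" where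
  "apply_pairs \<iota> d z =
     (\<Sum>p\<in>Poly_Mapping.keys z. \<iota> (Poly_Mapping.lookup z p) * (pair_fst p * d (pair_snd p)))"

context
  fixes \<iota> :: "'k::field \<Rightarrow> 'r::comm_ring_1"
  assumes hom: "is_ring_hom \<iota>"
begin

lemma apply_pairs_add: "apply_pairs \<iota> d (z + w) = apply_pairs \<iota> d z + apply_pairs \<iota> d w"
  unfolding apply_pairs_def
  by (rule setsum_keys_plus_distrib) (auto simp: ring_hom_0[OF hom] ring_homD[OF hom] algebra_simps)

lemma apply_pairs_0: "apply_pairs \<iota> d 0 = 0"
  by (simp add: apply_pairs_def)

lemma apply_pairs_diff: "apply_pairs \<iota> d (z - w) = apply_pairs \<iota> d z - apply_pairs \<iota> d w"
  using apply_pairs_add[of d "z - w" w] by simp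

lemma apply_pairs_single: "apply_pairs \<iota> d (pure x y c) = \<iota> c * (x * d y)"
  by (cases "c = 0") (auto simp: apply_pairs_def ring_hom_0[OF hom])

lemma apply_pairs_single_mult:
  "apply_pairs \<iota> d (pure x y c * z) = \<iota> c * (x * apply_pairs \<iota> (\<lambda>s. d (y * s)) z)"
proof (induction z rule: poly_mapping_additive_induct)
  case (2 p e)
  show ?case
    by (cases p) (simp add: pure_mult apply_pairs_single ring_homD[OF hom] algebra_simps)
qed (simp_all add: apply_pairs_0 apply_pairs_add distrib_left algebra_simps)

lemma apply_pairs_op_add:
  "apply_pairs \<iota> (\<lambda>x. d x + e x) z = apply_pairs \<iota> d z + apply_pairs \<iota> e z"
  by (simp add: apply_pairs_def distrib_left sum.distrib)

lemma apply_pairs_op_scale: "apply_pairs \<iota> (\<lambda>x. c * d x) z = c * apply_pairs \<iota> d z"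
  by (simp add: apply_pairs_def sum_distrib_left algebra_simps)

text \<open>Multiplication by z costs commutators: if \<open>mult_map \<iota> z = 0\<close>, only
  terms with operators of smaller order remain.\<close>

lemma apply_pairs_mult:
  "apply_pairs \<iota> d (z * w) = mult_map \<iota> z * apply_pairs \<iota> d w +
     (\<Sum>p\<in>Poly_Mapping.keys z. \<iota> (Poly_Mapping.lookup z p) *
        (pair_fst p * apply_pairs \<iota> (commutator (\<lambda>x. x) (pair_snd p) d) w))" (is "?L z = ?R z")
proof -
  define S where "S z = (\<Sum>p\<in>Poly_Mapping.keys z. \<iota> (Poly_Mapping.lookup z p) *
        (pair_fst p * apply_pairs \<iota> (commutator (\<lambda>x. x) (pair_snd p) d) w))" for z
  have S_add: "S (x + y) = S x + S y" for x y
    unfolding S_def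
    by (rule setsum_keys_plus_distrib) (auto simp: ring_hom_0[OF hom] ring_homD[OF hom] algebra_simps)
  have S_single: "S (pure x y c) = \<iota> c * (x * apply_pairs \<iota> (commutator (\<lambda>x. x) y d) w)" for x y c
    by (cases "c = 0") (auto simp: S_def ring_hom_0[OF hom])
  have "?L z = mult_map \<iota> z * apply_pairs \<iota> d w + S z"
  proof (induction z rule: poly_mapping_additive_induct)
    case 1
    show ?case by (simp add: apply_pairs_0 mult_map_def S_def)
  next
    case (2 p c)
    obtain x y where p: "p = Mult_Pair x y" by (cases p)
    have "(\<lambda>s. d (y * s)) = (\<lambda>s. commutator (\<lambda>x. x) y d s + y * d s)"
      by (simp add: commutator_def)
    thus ?case unfolding p
      by (simp only: apply_pairs_single_mult mult_map_single[OF hom] S_single apply_pairs_op_add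
          apply_pairs_op_scale) (simp add: algebra_simps)
  next
    case (3 x y)
    thus ?case by (simp add: distrib_right apply_pairs_add S_add mult_map_add[OF hom] algebra_simps)
  qed
  thus ?thesis unfolding S_def .
qed

lemma apply_pairs_ideal_power:
  assumes "diffop (\<lambda>x. x) \<iota> n d" "z \<in> ideal_power {z. mult_map \<iota> z = 0} n"
  shows "apply_pairs \<iota> d (z * w) = 0"
  using assms
proof (induction n arbitrary: d z w)
  case 0
  thus ?case by (simp add: apply_pairs_def)
next
  case (Suc n)
  let ?K = "{z. mult_map \<iota> z = 0}"
  \<comment> \<open>The quantified factor w makes the annihilated set an ideal, so that generators
    suffice.\<close>
  let ?N = "{z. \<forall>w. apply_pairs \<iota> d (z * w) = 0}"
  have N: "ideal ?N"
  proof (rule idealI)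
    fix c x assume "x \<in> ?N"
    hence "apply_pairs \<iota> d (x * (c * w)) = 0" for w by blast
    thus "c * x \<in> ?N" by (simp add: ac_simps)
  qed (auto simp: apply_pairs_0 apply_pairs_add distrib_right)
  have "x * y \<in> ?N" if "x \<in> ?K" "y \<in> ideal_power ?K n" for x y
  proof (intro CollectI allI)
    fix w
    have "apply_pairs \<iota> (commutator (\<lambda>x. x) s d) (y * w) = 0" for s
      using Suc.prems(1) that(2) by (intro Suc.IH) auto
    thus "apply_pairs \<iota> d (x * y * w) = 0"
      using that(1) apply_pairs_mult[of d x "y * w"] by (simp add: mult.assoc)
  qed
  hence "ideal_power ?K (Suc n) \<subseteq> ?N"
    unfolding ideal_power.simps ideal_prod_def by (intro ideal_gen_minimal N) blast
  thus ?case using Suc.prems(2) by blast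
qed

lemma apply_pairs_tensor_ideal:
  assumes d: "klinear (\<lambda>x. x) \<iota> d" and z: "z \<in> tensor_ideal \<iota>"
  shows "apply_pairs \<iota> d (z * w) = 0"
proof -
  let ?N = "{z. \<forall>w. apply_pairs \<iota> d (z * w) = 0}"
  have N: "ideal ?N"
  proof (rule idealI)
    fix c x assume "x \<in> ?N"
    hence "apply_pairs \<iota> d (x * (c * w)) = 0" for w by blast
    thus "c * x \<in> ?N" by (simp add: ac_simps)
  qed (auto simp: apply_pairs_0 apply_pairs_add distrib_right)
  have *: "apply_pairs \<iota> (\<lambda>s. d (\<iota> c * y * s)) w = \<iota> c * apply_pairs \<iota> (\<lambda>s. d (y * s)) w" for c y w
    using klinearD(2)[OF d] by (simp add: mult.assoc apply_pairs_op_scale)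
  have "tensor_ideal \<iota> \<subseteq> ?N"
    unfolding tensor_ideal_def
    by (intro ideal_gen_minimal N)
      (auto simp: left_diff_distrib apply_pairs_diff apply_pairs_single_mult distrib_right distrib_left
        klinearD(1)[OF d] apply_pairs_op_add * ring_homD(1)[OF hom]; simp add: ac_simps)
  thus ?thesis using z by blast
qed

lemma diffop_imp_Diff:
  assumes d: "diffop (\<lambda>x. x) \<iota> (Suc t) d"
  shows "d \<in> Diff \<iota> t"
proof -
  let ?D = "diag_ideal \<iota> (Suc t)"
  let ?N = "{z. \<forall>w. apply_pairs \<iota> d (z * w) = 0}"
  have N: "ideal ?N"
  proof (rule idealI)
    fix c x assume "x \<in> ?N"
    hence "apply_pairs \<iota> d (x * (c * w)) = 0" for w by blast
    thus "c * x \<in> ?N" by (simp add: ac_simps)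
  qed (auto simp: apply_pairs_0 apply_pairs_add distrib_right)
  have "?D \<subseteq> ?N" unfolding diag_ideal_def
    using apply_pairs_tensor_ideal[OF diffop_klinear[OF d]] apply_pairs_ideal_power[OF d]
    by (intro ideal_gen_minimal N) auto
  hence D0: "apply_pairs \<iota> d z = 0" if "z \<in> ?D" for z
    using that by (metis (mono_tags, lifting) mem_Collect_eq mult_1_right subsetD)
  have D: "ideal ?D" unfolding diag_ideal_def by (rule ideal_ideal_gen)
  \<comment> \<open>A functional on cosets is obtained by evaluating at a chosen representative;
    \<open>D0\<close> makes the value independent of the choice.\<close>
  define u where "u X = apply_pairs \<iota> d (SOME z. z \<in> X)" for X
  have u: "u (coset ?D z) = apply_pairs \<iota> d z" for z
  proof -
    have "z \<in> coset ?D z" using ideal_0[OF D] by (simp add: coset_def)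
    hence "(SOME z'. z' \<in> coset ?D z) \<in> coset ?D z" by (rule someI)
    hence "apply_pairs \<iota> d ((SOME z'. z' \<in> coset ?D z) - z) = 0" by (intro D0) (simp add: coset_def)
    thus ?thesis by (simp add: u_def apply_pairs_diff)
  qed
  have "principal_parts_hom \<iota> (Suc t) u"
    unfolding principal_parts_hom_def u
    by (simp add: apply_pairs_add apply_pairs_single_mult ring_homD(1)[OF hom])
  moreover have "d r = u (coset ?D (pure 1 r 1))" for r
    by (simp add: u apply_pairs_single ring_homD(1)[OF hom])
  ultimately show ?thesis unfolding Diff_def by blast
qed

end

lemma Diff_iff: "is_ring_hom \<iota> \<Longrightarrow> d \<in> Diff \<iota> t \<longleftrightarrow> diffop (\<lambda>x. x) \<iota> (Suc t) d"
  using Diff_imp_diffop diffop_imp_Diff by blast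

section \<open>Local subrings of fields\<close>

text \<open>A local ring inside a field. Its residue field is not formed as a type; statements over
  it appear as congruences modulo m.\<close>

locale local_subring =
  fixes B m :: "'f::field set"
  assumes B: "is_subring B"
    and m_sub: "m \<subseteq> B"
    and m_0: "0 \<in> m"
    and m_add: "\<And>x y. x \<in> m \<Longrightarrow> y \<in> m \<Longrightarrow> x + y \<in> m"
    and m_mult: "\<And>b x. b \<in> B \<Longrightarrow> x \<in> m \<Longrightarrow> b * x \<in> m"
    and m_1: "1 \<notin> m"
    and B_inverse: "\<And>x. x \<in> B \<Longrightarrow> x \<notin> m \<Longrightarrow> inverse x \<in> B"
begin

lemmas B_intros = subring_0[OF B] subring_1[OF B] subring_add[OF B] subring_mult[OF B]
  subring_diff[OF B] subring_uminus[OF B] subring_sum[OF B] subring_prod[OF B] subring_power[OF B]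
  subring_of_nat[OF B]

lemma minus_1_in_B: "- 1 \<in> B"
  by (intro B_intros)

lemma m_in_B: "x \<in> m \<Longrightarrow> x \<in> B"
  using m_sub by auto

lemma m_mult2: "x \<in> m \<Longrightarrow> b \<in> B \<Longrightarrow> x * b \<in> m"
  using m_mult[of b x] by (simp add: mult.commute)

lemma m_uminus: "x \<in> m \<Longrightarrow> - x \<in> m"
  using m_mult[OF minus_1_in_B, of x] by simp

lemma m_diff: "x \<in> m \<Longrightarrow> y \<in> m \<Longrightarrow> x - y \<in> m"
  using m_add[of x "- y"] m_uminus by simp

lemma m_sum: "(\<And>i. i \<in> S \<Longrightarrow> f i \<in> m) \<Longrightarrow> sum f S \<in> m"
  by (induction S rule: infinite_finite_induct) (auto simp: m_0 m_add)

lemma m_prime: "x \<in> B \<Longrightarrow> y \<in> B \<Longrightarrow> x * y \<in> m \<Longrightarrow> x \<notin> m \<Longrightarrow> y \<in> m"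
proof -
  assume a: "x \<in> B" "y \<in> B" "x * y \<in> m" "x \<notin> m"
  hence "inverse x * (x * y) \<in> m" by (auto intro: m_mult[OF B_inverse])
  moreover have "x \<noteq> 0" using a m_0 by auto
  hence "inverse x * (x * y) = y" by simp
  ultimately show "y \<in> m" by (simp only:)
qed

lemma m_power: "x \<in> B \<Longrightarrow> x ^ n \<in> m \<Longrightarrow> x \<in> m"
proof (induction n)
  case (Suc n)
  thus ?case using m_prime[of x "x ^ n"] subring_power[OF B, of x n] by auto
qed (simp add: m_1)

lemma m_diff_cancel: "x - y \<in> m \<Longrightarrow> y \<in> m \<Longrightarrow> x \<in> m"
  using m_add[of "x - y" y] by simp

lemma not_m_nonzero: "x \<notin> m \<Longrightarrow> x \<noteq> 0"
  using m_0 by auto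

lemma poly_in_B: "(\<And>i. coeff p i \<in> B) \<Longrightarrow> z \<in> B \<Longrightarrow> poly p z \<in> B"
  by (auto simp: poly_altdef intro!: B_intros)

lemma poly_in_m: "(\<And>i. coeff p i \<in> m) \<Longrightarrow> z \<in> B \<Longrightarrow> poly p z \<in> m"
  by (auto simp: poly_altdef intro!: B_intros m_sum m_mult2)

text \<open>
  Steinitz exchange modulo the maximal ideal: rows \<open>V\<^sub>0, \<dots>, V\<^sub>q\<^sub>-\<^sub>1\<close> that are independent over
  the residue field become, together with some unit vectors, the rows of a matrix \<open>W\<close> with
  inverse \<open>N\<close> over \<open>B\<close>; row \<open>V\<^sub>j\<close> is placed at position \<open>\<sigma> j\<close>.
\<close>

lemma exchange:
  fixes V :: "nat \<Rightarrow> nat \<Rightarrow> 'f" and q n :: nat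
  assumes "\<And>j i. j < q \<Longrightarrow> i < n \<Longrightarrow> V j i \<in> B"
    and "\<And>u. (\<And>j. j < q \<Longrightarrow> u j \<in> B) \<Longrightarrow> (\<And>i. i < n \<Longrightarrow> (\<Sum>j<q. u j * V j i) \<in> m) \<Longrightarrow>
      (\<forall>j<q. u j \<in> m)"
  shows "\<exists>\<sigma> W N. inj_on \<sigma> {..<q} \<and> \<sigma> ` {..<q} \<subseteq> {..<n} \<and>
    (\<forall>j<q. \<forall>i<n. W (\<sigma> j) i = V j i) \<and>
    (\<forall>l<n. l \<notin> \<sigma> ` {..<q} \<longrightarrow> (\<exists>s<n. \<forall>i<n. W l i = (if i = s then 1 else 0))) \<and>
    (\<forall>j<n. \<forall>i<n. W j i \<in> B \<and> N i j \<in> B) \<and>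
    (\<forall>j<n. \<forall>l<n. (\<Sum>i<n. W j i * N i l) = (if j = l then 1 else 0)) \<and>
    (\<forall>i<n. \<forall>l<n. (\<Sum>j<n. N i j * W j l) = (if i = l then 1 else 0))"
  using assms
proof (induction q)
  case 0
  let ?I = "\<lambda>i j. if i = j then 1 else 0 :: 'f"
  have I: "(\<Sum>k<n. ?I i k * ?I k l) = ?I i l" if "i < n" for i l
    using that by (simp add: if_distrib[of "\<lambda>x. x * _"] cong: if_cong)
  show ?case
    by (rule exI[of _ id], rule exI[of _ ?I], rule exI[of _ ?I]) (use I subring_0[OF B] subring_1[OF B] in \<open>auto\<close>)
next
  case (Suc q)
  have "\<exists>\<sigma> W N. inj_on \<sigma> {..<q} \<and> \<sigma> ` {..<q} \<subseteq> {..<n} \<and>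
    (\<forall>j<q. \<forall>i<n. W (\<sigma> j) i = V j i) \<and>
    (\<forall>l<n. l \<notin> \<sigma> ` {..<q} \<longrightarrow> (\<exists>s<n. \<forall>i<n. W l i = (if i = s then 1 else 0))) \<and>
    (\<forall>j<n. \<forall>i<n. W j i \<in> B \<and> N i j \<in> B) \<and>
    (\<forall>j<n. \<forall>l<n. (\<Sum>i<n. W j i * N i l) = (if j = l then 1 else 0)) \<and>
    (\<forall>i<n. \<forall>l<n. (\<Sum>j<n. N i j * W j l) = (if i = l then 1 else 0))"
  proof (rule Suc.IH)
    fix u assume u: "\<And>j. j < q \<Longrightarrow> u j \<in> B" "\<And>i. i < n \<Longrightarrow> (\<Sum>j<q. u j * V j i) \<in> m"
    have "\<forall>j<Suc q. (if j = q then 0 else u j) \<in> m"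
      using u by (intro Suc.prems(2)) (auto simp: B_intros)
    thus "\<forall>j<q. u j \<in> m" by (metis less_SucI less_irrefl_nat)
  qed (use Suc.prems(1) in auto)
  then obtain \<sigma> W N where inj: "inj_on \<sigma> {..<q}" and \<sigma>: "\<sigma> ` {..<q} \<subseteq> {..<n}"
    and H: "\<forall>j<q. \<forall>i<n. W (\<sigma> j) i = V j i"
      "\<forall>l<n. l \<notin> \<sigma> ` {..<q} \<longrightarrow> (\<exists>s<n. \<forall>i<n. W l i = (if i = s then 1 else 0))"
      "\<forall>j<n. \<forall>i<n. W j i \<in> B \<and> N i j \<in> B"
      "\<forall>j<n. \<forall>l<n. (\<Sum>i<n. W j i * N i l) = (if j = l then 1 else 0)"
      "\<forall>i<n. \<forall>l<n. (\<Sum>j<n. N i j * W j l) = (if i = l then 1 else 0)"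
    by (elim exE conjE) (rule that)
  note WV = H(1)[rule_format] and unit = H(2)[rule_format] and WN = H(4)[rule_format]
    and NW = H(5)[rule_format] and WB = H(3)[rule_format, THEN conjunct1]
    and NB = H(3)[rule_format, THEN conjunct2]
  \<comment> \<open>Coordinates of the new row \<open>V q\<close> with respect to the rows of
    W.\<close>
  define t where "t l = (\<Sum>i<n. V q i * N i l)" for l
  have tB: "t l \<in> B" if "l < n" for l
    unfolding t_def using that Suc.prems(1) NB by (intro B_intros) auto
  have Vq: "V q i = (\<Sum>l<n. t l * W l i)" if "i < n" for i
  proof -
    have "(\<Sum>l<n. t l * W l i) = (\<Sum>l<n. \<Sum>k<n. V q k * (N k l * W l i))"
      by (simp add: t_def sum_distrib_right mult.assoc)
    also have "\<dots> = (\<Sum>k<n. V q k * (\<Sum>l<n. N k l * W l i))"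
      by (subst sum.swap) (simp add: sum_distrib_left)
    also have "\<dots> = (\<Sum>k<n. V q k * (if k = i then 1 else 0))"
      using that by (intro sum.cong) (auto simp: NW)
    finally show ?thesis using that by (simp add: if_distrib[of "\<lambda>x. _ * x"] cong: if_cong)
  qed
  \<comment> \<open>A pivot outside the occupied positions exists; otherwise \<open>V q\<close>
    would be, modulo m, a combination of the earlier rows of V, against independence.\<close>
  have "\<exists>p<n. p \<notin> \<sigma> ` {..<q} \<and> t p \<notin> m"
  proof (rule ccontr)
    assume n: "\<not> ?thesis"
    let ?u = "\<lambda>j. if j = q then 1 else - t (\<sigma> j)"
    have "\<forall>j<Suc q. ?u j \<in> m"
    proof (rule Suc.prems(2))
      fix j assume "j < Suc q"
      hence "\<sigma> j \<in> {..<n}" if "j \<noteq> q" using that by (intro subsetD[OF \<sigma>] imageI) auto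
      hence "t (\<sigma> j) \<in> B" if "j \<noteq> q" using that tB by simp
      thus "?u j \<in> B" by (simp add: B_intros)
    next
      fix i assume i: "i < n"
      have "(\<Sum>j<q. t (\<sigma> j) * V j i) = (\<Sum>l\<in>\<sigma> ` {..<q}. t l * W l i)"
        using inj i WV by (simp add: sum.reindex)
      hence "(\<Sum>j<Suc q. ?u j * V j i) = (\<Sum>l<n. t l * W l i) - (\<Sum>l\<in>\<sigma> ` {..<q}. t l * W l i)"
        using Vq[OF i] by (simp add: sum_negf)
      also have "\<dots> = (\<Sum>l\<in>{..<n} - \<sigma> ` {..<q}. t l * W l i)"
        using \<sigma> by (simp add: sum_diff)
      also have "\<dots> \<in> m" using n WB i by (intro m_sum m_mult2) auto
      finally show "(\<Sum>j<Suc q. ?u j * V j i) \<in> m" .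
    qed
    thus False using m_1 by auto
  qed
  then obtain p where p: "p < n" "p \<notin> \<sigma> ` {..<q}" "t p \<notin> m" by auto
  have tp: "t p \<noteq> 0" "inverse (t p) \<in> B" using p tB B_inverse not_m_nonzero by auto
  define \<sigma>' where "\<sigma>' = \<sigma>(q := p)"
  define W' where "W' = W(p := V q)"
  \<comment> \<open>\<open>W'\<close> is T W, where T is the identity matrix with row p replaced by
    t; accordingly \<open>N'\<close> is N times the inverse of T.\<close>
  define N' where "N' i l = (if l = p then N i p * inverse (t p) else N i l - t l * inverse (t p) * N i p)" for i l
  have s: "\<sigma>' ` {..<Suc q} = insert p (\<sigma> ` {..<q})"
    by (auto simp: \<sigma>'_def lessThan_Suc)
  have 1: "inj_on \<sigma>' {..<Suc q}"
    using inj p(2) by (auto simp: \<sigma>'_def lessThan_Suc inj_on_def)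
  have 2: "\<sigma>' ` {..<Suc q} \<subseteq> {..<n}" using \<sigma> p(1) by (auto simp: s)
  have 3: "\<forall>j<Suc q. \<forall>i<n. W' (\<sigma>' j) i = V j i"
    using WV p(2) by (auto simp: W'_def \<sigma>'_def less_Suc_eq)
  have 4: "\<forall>l<n. l \<notin> \<sigma>' ` {..<Suc q} \<longrightarrow> (\<exists>s<n. \<forall>i<n. W' l i = (if i = s then 1 else 0))"
    unfolding s using unit by (auto simp: W'_def)
  have 5: "\<forall>j<n. \<forall>i<n. W' j i \<in> B \<and> N' i j \<in> B"
    using WB NB Suc.prems(1) tp tB p(1) by (auto simp: W'_def N'_def intro!: B_intros)
  have WN': "(\<Sum>i<n. X i * N' i l) = (if l = p then (\<Sum>i<n. X i * N i p) * inverse (t p)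
      else (\<Sum>i<n. X i * N i l) - t l * inverse (t p) * (\<Sum>i<n. X i * N i p))" for X l
    by (auto simp: N'_def sum_distrib_right sum_distrib_left right_diff_distrib sum_subtractf algebra_simps)
  have 6: "\<forall>j<n. \<forall>l<n. (\<Sum>i<n. W' j i * N' i l) = (if j = l then 1 else 0)"
    unfolding WN' using tp p(1) by (auto simp: W'_def WN simp flip: t_def)
  have 7: "\<forall>i<n. \<forall>l<n. (\<Sum>j<n. N' i j * W' j l) = (if i = l then 1 else 0)"
  proof (intro allI impI)
    fix i l assume il: "i < n" "l < n"
    have *: "(\<Sum>j<n. f j) = f p + (\<Sum>j\<in>{..<n} - {p}. f j)" for f :: "nat \<Rightarrow> 'f"
      using p(1) by (simp add: sum.remove)
    have "(\<Sum>j<n. N' i j * W' j l) = N i p * inverse (t p) * V q l +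
        (\<Sum>j\<in>{..<n} - {p}. (N i j - t j * inverse (t p) * N i p) * W j l)"
      unfolding * by (simp add: N'_def W'_def)
    also have "(\<Sum>j\<in>{..<n} - {p}. (N i j - t j * inverse (t p) * N i p) * W j l) =
        (\<Sum>j\<in>{..<n} - {p}. N i j * W j l) - N i p * inverse (t p) * (\<Sum>j\<in>{..<n} - {p}. t j * W j l)"
      by (simp add: left_diff_distrib sum_subtractf sum_distrib_left algebra_simps)
    also have "N i p * inverse (t p) * V q l + \<dots> = (\<Sum>j<n. N i j * W j l)"
      using tp(1) unfolding Vq[OF il(2)] * by (simp add: field_simps)
    finally show "(\<Sum>j<n. N' i j * W' j l) = (if i = l then 1 else 0)" using NW[OF il] by simp
  qed
  show ?case using 1 2 3 4 5 6 7 by blast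
qed

end

section \<open>Derivations into the residue field\<close>

text \<open>
  A derivation \<open>C \<rightarrow> B/m\<close> on a subring \<open>C\<close> of \<open>B\<close> is encoded as a subring of the dual numbers
  over \<open>B\<close>, the preimage of its graph.
\<close>

definition dual_subring :: "('f::field \<times> 'f) set \<Rightarrow> bool" where
  "dual_subring G \<longleftrightarrow> (1, 0) \<in> G \<and>
     (\<forall>c d c' d'. (c, d) \<in> G \<longrightarrow> (c', d') \<in> G \<longrightarrow>
        (c - c', d - d') \<in> G \<and> (c * c', c * d' + c' * d) \<in> G)"

lemma dual_subringD:
  assumes "dual_subring G"
  shows "(1, 0) \<in> G" "(0, 0) \<in> G"
    and "(c, d) \<in> G \<Longrightarrow> (c', d') \<in> G \<Longrightarrow> (c + c', d + d') \<in> G"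
    and "(c, d) \<in> G \<Longrightarrow> (c', d') \<in> G \<Longrightarrow> (c - c', d - d') \<in> G"
    and "(c, d) \<in> G \<Longrightarrow> (c', d') \<in> G \<Longrightarrow> (c * c', c * d' + c' * d) \<in> G"
proof -
  show 1: "(1, 0) \<in> G" and diff: "\<And>c d c' d'. (c, d) \<in> G \<Longrightarrow> (c', d') \<in> G \<Longrightarrow> (c - c', d - d') \<in> G"
    and "(c, d) \<in> G \<Longrightarrow> (c', d') \<in> G \<Longrightarrow> (c * c', c * d' + c' * d) \<in> G"
    using assms by (auto simp: dual_subring_def)
  show 0: "(0, 0) \<in> G" using diff[OF 1 1] by simp
  assume "(c, d) \<in> G" "(c', d') \<in> G"
  thus "(c + c', d + d') \<in> G" using diff[of c d "- c'" "- d'"] diff[of 0 0 c' d'] 0 by simp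
qed

lemma dual_subring_sum:
  assumes "dual_subring G" "\<And>i. i \<in> S \<Longrightarrow> (f i, g i) \<in> G"
  shows "(sum f S, sum g S) \<in> G"
  using assms(2)
  by (induction S rule: infinite_finite_induct) (auto intro: dual_subringD[OF assms(1)])

definition dual_polys :: "('f::field \<times> 'f) set \<Rightarrow> ('f poly \<times> 'f poly) set" where
  "dual_polys G = {(c, d). \<forall>i. (coeff c i, coeff d i) \<in> G}"

text \<open>With eps^2 = 0, this is the eps-part of c + eps d evaluated at z + eps v.\<close>

definition dual_eval :: "'f::field \<Rightarrow> 'f \<Rightarrow> 'f poly \<Rightarrow> 'f poly \<Rightarrow> 'f" where
  "dual_eval z v c d = poly d z + poly (pderiv c) z * v"

lemma dual_eval_diff: "dual_eval z v (c - c') (d - d') = dual_eval z v c d - dual_eval z v c' d'"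
  by (simp add: dual_eval_def pderiv_diff algebra_simps)

lemma dual_eval_mult:
  "dual_eval z v (c * c') (c * d' + c' * d) = poly c z * dual_eval z v c' d' + poly c' z * dual_eval z v c d"
  by (simp add: dual_eval_def pderiv_mult algebra_simps)

lemma dual_polys_diff:
  assumes "dual_subring G" "(c, d) \<in> dual_polys G" "(c', d') \<in> dual_polys G"
  shows "(c - c', d - d') \<in> dual_polys G"
  using assms by (auto simp: dual_polys_def intro: dual_subringD)

lemma dual_polys_mult:
  assumes G: "dual_subring G" and "(c, d) \<in> dual_polys G" "(c', d') \<in> dual_polys G"
  shows "(c * c', c * d' + c' * d) \<in> dual_polys G"
  unfolding dual_polys_def
proof (intro CollectI case_prodI allI)
  fix i
  have e: "coeff (c' * d) i = (\<Sum>j\<le>i. coeff d j * coeff c' (i - j))"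
    by (subst mult.commute) (rule coeff_mult)
  have "coeff (c * d' + c' * d) i =
      (\<Sum>j\<le>i. coeff c j * coeff d' (i - j) + coeff c' (i - j) * coeff d j)"
    unfolding coeff_add e coeff_mult[of c] sum.distrib by (simp add: mult.commute)
  thus "(coeff (c * c') i, coeff (c * d' + c' * d) i) \<in> G"
    using assms unfolding coeff_mult[of c]
    by (auto simp: dual_polys_def intro!: dual_subring_sum[OF G] dual_subringD(5)[OF G])
qed

lemma dual_polys_monom:
  "dual_subring G \<Longrightarrow> (c, d) \<in> G \<Longrightarrow> (monom c n, monom d n) \<in> dual_polys G"
  by (auto simp: dual_polys_def dual_subringD)

text \<open>A linear form from m/m^2 to B/m, written with congruences. That it kills m^2 is
  contained in \<open>lam_mult\<close>, taken for b in m.\<close>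

locale residue_functional = local_subring B m for B m :: "'f::field set" +
  fixes lam :: "'f \<Rightarrow> 'f"
  assumes lam_B: "\<And>x. x \<in> m \<Longrightarrow> lam x \<in> B"
    and lam_add: "\<And>x y. x \<in> m \<Longrightarrow> y \<in> m \<Longrightarrow> lam (x + y) - (lam x + lam y) \<in> m"
    and lam_mult: "\<And>b x. b \<in> B \<Longrightarrow> x \<in> m \<Longrightarrow> lam (b * x) - b * lam x \<in> m"
begin

lemma lam_0: "lam 0 \<in> m"
  using m_uminus[OF lam_add[OF m_0 m_0]] by simp

lemma lam_minus: "x \<in> m \<Longrightarrow> lam (- x) + lam x \<in> m"
  using lam_mult[OF minus_1_in_B, of x] by simp

lemma lam_diff:
  assumes "x \<in> m" "y \<in> m" shows "lam (x - y) - (lam x - lam y) \<in> m"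
  using m_add[OF lam_add[OF assms(1) m_uminus[OF assms(2)]] lam_minus[OF assms(2)]]
  by (simp add: algebra_simps)

text \<open>F plays the role of a ring of constants, and the last conjunct says that the derivation
  is single-valued modulo m.\<close>

definition derivation_graph :: "'f set \<Rightarrow> ('f \<times> 'f) set \<Rightarrow> bool" where
  "derivation_graph F G \<longleftrightarrow> dual_subring G \<and> G \<subseteq> B \<times> B \<and> (\<forall>y\<in>m. (y, lam y) \<in> G) \<and>
     (\<forall>x\<in>F. (x, 0) \<in> G) \<and> (\<forall>d. (0, d) \<in> G \<longrightarrow> d \<in> m)"

lemma derivation_graphD:
  assumes "derivation_graph F G"
  shows "dual_subring G" "(c, d) \<in> G \<Longrightarrow> c \<in> B" "(c, d) \<in> G \<Longrightarrow> d \<in> B"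
    "y \<in> m \<Longrightarrow> (y, lam y) \<in> G" "x \<in> F \<Longrightarrow> (x, 0) \<in> G" "(0, d) \<in> G \<Longrightarrow> d \<in> m"
  using assms by (auto simp: derivation_graph_def)

lemma derivation_graph_lam:
  assumes "derivation_graph F G" "(y, d) \<in> G" "y \<in> m" shows "d - lam y \<in> m"
  using derivation_graphD(6)[OF assms(1), of "d - lam y"]
    dual_subringD(4)[OF derivation_graphD(1)[OF assms(1)] assms(2) derivation_graphD(4)[OF assms(1,3)]]
  by simp

text \<open>Coefficient by coefficient, d agrees with the values of \<open>lam\<close> on c modulo
  m, and \<open>lam\<close> is B-linear modulo m, so the sums weighted with powers of z agree as
  well.\<close>

lemma derivation_graph_lam_poly:
  assumes G: "derivation_graph F G" and z: "z \<in> B"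
    and cd: "(c, d) \<in> dual_polys G" and cm: "\<And>i. coeff c i \<in> m"
  shows "poly d z - lam (poly c z) \<in> m"
proof -
  have "\<forall>d. (c, d) \<in> dual_polys G \<longrightarrow> (\<forall>i. coeff c i \<in> m) \<longrightarrow> poly d z - lam (poly c z) \<in> m"
    if "degree c < N \<or> c = 0" for N c
    using that
  proof (induction N arbitrary: c)
    case 0
    hence c: "c = 0" by simp
    {
      fix d assume "(c, d) \<in> dual_polys G"
      hence "coeff d i \<in> m" for i
        using derivation_graphD(6)[OF G] by (auto simp: dual_polys_def c)
      hence "poly d z \<in> m" using z by (rule poly_in_m)
      hence "poly d z - lam (poly c z) \<in> m" unfolding c using lam_0 m_diff by simp
    }
    thus ?case by blast
  next
    case (Suc N)
    show ?case
    proof (intro allI impI)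
      fix d assume cd: "(c, d) \<in> dual_polys G" and cm: "\<forall>i. coeff c i \<in> m"
      obtain c0 c1 where c: "c = pCons c0 c1" by (cases c)
      obtain d0 d1 where d: "d = pCons d0 d1" by (cases d)
      have "(c0, d0) \<in> G" using cd[unfolded dual_polys_def c d] by (auto dest: spec[of _ 0])
      moreover have c0: "c0 \<in> m" using cm[unfolded c] by (auto dest: spec[of _ 0])
      ultimately have 0: "d0 - lam c0 \<in> m" by (rule derivation_graph_lam[OF G])
      have "(coeff c1 i, coeff d1 i) \<in> G" for i
        using cd[unfolded dual_polys_def c d] by (auto dest: spec[of _ "Suc i"])
      hence cd1: "(c1, d1) \<in> dual_polys G" by (auto simp: dual_polys_def)
      have c1: "coeff c1 i \<in> m" for i using cm[unfolded c] by (auto dest: spec[of _ "Suc i"])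
      have "degree c1 < N \<or> c1 = 0" using Suc.prems unfolding c by (auto split: if_splits)
      hence 1: "poly d1 z - lam (poly c1 z) \<in> m" using Suc.IH cd1 c1 by blast
      have pm: "poly c1 z \<in> m" using c1 z by (rule poly_in_m)
      have "lam (c0 + z * poly c1 z) - (lam c0 + lam (z * poly c1 z)) \<in> m"
        using c0 pm z by (intro lam_add m_mult)
      from m_diff[OF m_diff[OF m_add[OF 0 m_mult[OF z 1]] this] lam_mult[OF z pm]]
      have "(d0 - lam c0) + z * (poly d1 z - lam (poly c1 z)) -
          (lam (c0 + z * poly c1 z) - (lam c0 + lam (z * poly c1 z))) -
          (lam (z * poly c1 z) - z * lam (poly c1 z)) \<in> m" .
      thus "poly d z - lam (poly c z) \<in> m" unfolding c d by (simp add: algebra_simps)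
    qed
  qed
  from this[of c "Suc (degree c)"] show ?thesis using cd cm by simp
qed

lemma dual_eval_in_B:
  assumes G: "derivation_graph F G" and cd: "(c, d) \<in> dual_polys G" and z: "z \<in> B" "v \<in> B"
  shows "poly c z \<in> B" "dual_eval z v c d \<in> B"
proof -
  have c: "coeff c i \<in> B" and d: "coeff d i \<in> B" for i
    using cd derivation_graphD(2,3)[OF G, of "coeff c i" "coeff d i"] by (auto simp: dual_polys_def)
  show "poly c z \<in> B" using c z by (intro poly_in_B)
  have "poly (pderiv c) z \<in> B"
    using c z by (intro poly_in_B) (auto simp: coeff_pderiv simp del: of_nat_Suc intro!: B_intros)
  moreover have "poly d z \<in> B" using d z by (intro poly_in_B)
  ultimately show "dual_eval z v c d \<in> B" unfolding dual_eval_def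
    using z by (intro B_intros)
qed

text \<open>The derivation extends to C[z], where C is the domain of G, once all polynomial
  relations satisfied by z are respected; \<open>key\<close> expresses this.\<close>

lemma derivation_graph_extend:
  assumes G: "derivation_graph F G" and z: "z \<in> B" and v: "v \<in> B"
    and key: "\<And>c d. (c, d) \<in> dual_polys G \<Longrightarrow> poly c z = 0 \<Longrightarrow> dual_eval z v c d \<in> m"
  shows "\<exists>G'. derivation_graph F G' \<and> G \<subseteq> G' \<and> (z, v) \<in> G'"
proof -
  note ds = derivation_graphD(1)[OF G]
  define G' where "G' = {(poly c z, dual_eval z v c d) | c d. (c, d) \<in> dual_polys G}"
  have G'I: "(poly c z, dual_eval z v c d) \<in> G'" if "(c, d) \<in> dual_polys G" for c d
    using that unfolding G'_def by blast
  have sub: "G \<subseteq> G'"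
  proof
    fix x assume x: "x \<in> G"
    obtain c d where cd: "x = (c, d)" by (cases x)
    from dual_polys_monom[OF ds x[unfolded cd], of 0] show "x \<in> G'"
      using G'I[of "[:c:]" "[:d:]"] by (simp add: cd dual_eval_def pderiv_pCons monom_0)
  qed
  have zv: "(z, v) \<in> G'"
    using G'I[OF dual_polys_monom[OF ds dual_subringD(1)[OF ds], of 1]]
    by (simp add: dual_eval_def poly_monom pderiv_monom)
  have "dual_subring G'"
    unfolding dual_subring_def
  proof (intro conjI allI impI)
    show "(1, 0) \<in> G'" using sub dual_subringD(1)[OF ds] by blast
    fix c d c' d' assume "(c, d) \<in> G'" "(c', d') \<in> G'"
    then obtain p q p' q' where pq: "(p, q) \<in> dual_polys G" "(p', q') \<in> dual_polys G"
      and eq: "c = poly p z" "d = dual_eval z v p q" "c' = poly p' z" "d' = dual_eval z v p' q'"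
      unfolding G'_def by blast
    show "(c - c', d - d') \<in> G'" using G'I[OF dual_polys_diff[OF ds pq]]
      by (simp add: eq dual_eval_diff)
    show "(c * c', c * d' + c' * d) \<in> G'" using G'I[OF dual_polys_mult[OF ds pq]]
      by (simp add: eq dual_eval_mult)
  qed
  moreover have "G' \<subseteq> B \<times> B"
  proof -
    have "poly c z \<in> B \<and> dual_eval z v c d \<in> B" if "(c, d) \<in> dual_polys G" for c d
      using dual_eval_in_B[OF G that z v] by simp
    thus ?thesis unfolding G'_def by blast
  qed
  moreover have "d \<in> m" if "(0, d) \<in> G'" for d
    using that key unfolding G'_def by force
  ultimately have "derivation_graph F G'"
    using sub derivation_graphD(4,5)[OF G] unfolding derivation_graph_def by blast
  thus ?thesis using sub zv by blast
qed

text \<open>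
  The image \<open>v\<close> of \<open>z\<close> under an extension is read off a polynomial \<open>g\<close> of least degree among those
  not vanishing modulo \<open>m\<close> that have a root at \<open>z\<close> modulo \<open>m\<close>. If \<open>g\<close> is inseparable modulo \<open>m\<close>,
  it can be replaced by \<open>X\<^sup>p - z\<^sup>p\<close>.
\<close>

lemma derivation_value_exists:
  fixes \<iota> :: "'k::field \<Rightarrow> 'f"
  assumes G: "derivation_graph F G" and z: "z \<in> B"
    and hom: "is_ring_hom \<iota>" and \<iota>B: "range \<iota> \<subseteq> B"
    and F: "CHAR('k) > 0 \<Longrightarrow> z ^ CHAR('k) \<in> F"
  shows "\<exists>v\<in>B. \<forall>c d. (c, d) \<in> dual_polys G \<longrightarrow> poly c z \<in> m \<longrightarrow>
    dual_eval z v c d - lam (poly c z) \<in> m"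
proof -
  note ds = derivation_graphD(1)[OF G]
  \<comment> \<open>z satisfies, modulo m, a nontrivial relation of degree below N over the domain
    of G.\<close>
  define Q where "Q N \<longleftrightarrow> (\<exists>g d. (g, d) \<in> dual_polys G \<and> (\<forall>k\<ge>N. coeff g k = 0) \<and>
      poly g z \<in> m \<and> (\<exists>k. coeff g k \<notin> m))" for N
  show ?thesis
  proof (cases "\<exists>N. Q N")
    case False
    \<comment> \<open>Here z is transcendental modulo m, so its value is free; 0 is taken.\<close>
    have "dual_eval z 0 c d - lam (poly c z) \<in> m" if cd: "(c, d) \<in> dual_polys G" "poly c z \<in> m" for c d
    proof -
      have "\<forall>k\<ge>Suc (degree c). coeff c k = 0" by (auto simp: coeff_eq_0)
      hence "coeff c i \<in> m" for i using False cd unfolding Q_def by blast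
      thus ?thesis using derivation_graph_lam_poly[OF G z cd(1)] by (simp add: dual_eval_def)
    qed
    thus ?thesis using subring_0[OF B] by blast
  next
    case True
    define N where "N = (LEAST N. Q N)"
    have QN: "Q N" unfolding N_def using True by (rule LeastI_ex)
    have Qmin: "\<not> Q k" if "k < N" for k using that not_less_Least unfolding N_def by blast
    obtain g d where g: "(g, d) \<in> dual_polys G" "\<forall>k\<ge>N. coeff g k = 0" "poly g z \<in> m"
      and gm: "\<exists>k. coeff g k \<notin> m" using QN unfolding Q_def by blast
    have "N \<noteq> 0" using g(2) gm m_0 by (metis zero_le)
    then obtain n where N: "N = Suc n" by (cases N) auto
    have Min: "coeff h k \<in> m" if "(h, e) \<in> dual_polys G" "\<forall>k\<ge>n. coeff h k = 0" "poly h z \<in> m" for h e k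
      using Qmin[of n] that N unfolding Q_def by blast
    \<comment> \<open>Otherwise dropping the leading term would leave a shorter relation.\<close>
    have lc: "coeff g n \<notin> m"
    proof
      assume lc: "coeff g n \<in> m"
      let ?g = "g - monom (coeff g n) n"
      have "(coeff g n, coeff d n) \<in> G" using g(1) by (auto simp: dual_polys_def)
      hence 1: "(?g, d - monom (coeff d n) n) \<in> dual_polys G"
        by (intro dual_polys_diff[OF ds g(1)] dual_polys_monom[OF ds])
      have "coeff ?g k = 0" if "k \<ge> n" for k using g(2) N that by (cases "k = n") auto
      hence 2: "\<forall>k\<ge>n. coeff ?g k = 0" by blast
      have "coeff g n * z ^ n \<in> m" using lc z by (intro m_mult2 B_intros)
      hence 3: "poly ?g z \<in> m" using g(3) by (auto simp: poly_monom intro: m_diff)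
      have g2: "coeff ?g k \<in> m" for k using Min[OF 1 2 3] .
      have "coeff g k \<in> m" for k using g2[of k] lc by (cases "k = n") auto
      thus False using gm by blast
    qed
    have n0: "n \<noteq> 0"
    proof
      assume "n = 0"
      hence "degree g \<le> 0" using g(2) N by (intro degree_le) auto
      hence "degree g = 0" by simp
      then obtain c where "g = [:c:]" by (rule degree_eq_zeroE)
      thus False using g(3) lc \<open>n = 0\<close> by simp
    qed
    have "\<exists>g d v. (g, d) \<in> dual_polys G \<and> (\<forall>k\<ge>Suc n. coeff g k = 0) \<and> coeff g n \<notin> m \<and>
      poly g z \<in> m \<and> v \<in> B \<and> dual_eval z v g d - lam (poly g z) \<in> m"
    proof (cases "poly (pderiv g) z \<in> m")
      case False
      \<comment> \<open>Separable case: the condition on v is a linear equation with unit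
        coefficient \<open>poly (pderiv g) z\<close>.\<close>
      have dB: "poly d z \<in> B" using dual_eval_in_B(2)[OF G g(1) z subring_0[OF B]] by (simp add: dual_eval_def)
      have "dual_eval z 1 g d \<in> B" using g(1) z subring_1[OF B] by (intro dual_eval_in_B(2)[OF G])
      hence "poly (pderiv g) z \<in> B" using subring_diff[OF B _ dB, of "dual_eval z 1 g d"] by (simp add: dual_eval_def)
      hence "(lam (poly g z) - poly d z) * inverse (poly (pderiv g) z) \<in> B"
        using False lam_B[OF g(3)] dB by (intro B_intros B_inverse)
      moreover have "dual_eval z ((lam (poly g z) - poly d z) * inverse (poly (pderiv g) z)) g d = lam (poly g z)"
        using not_m_nonzero[OF False] by (simp add: dual_eval_def field_simps)
      ultimately show ?thesis using g N lc m_0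
        by (intro exI[of _ g] exI[of _ d] exI[of _ "(lam (poly g z) - poly d z) * inverse (poly (pderiv g) z)"]) simp
    next
      case True
      \<comment> \<open>Inseparable case: the derivative of g is a shorter relation, so minimality
        puts its coefficient \<open>of_nat n * coeff g n\<close> into m, and the characteristic
        divides n.\<close>
      have nG: "(of_nat k * c, of_nat k * d) \<in> G" if "(c, d) \<in> G" for k c d
        by (induction k) (use that dual_subringD[OF ds] in \<open>auto simp: distrib_right\<close>)
      have "(pderiv g, pderiv d) \<in> dual_polys G"
        using g(1) nG unfolding dual_polys_def by (auto simp: coeff_pderiv simp del: of_nat_Suc)
      moreover have "\<forall>k\<ge>n. coeff (pderiv g) k = 0" using g(2) N by (simp add: coeff_pderiv)
      ultimately have "coeff (pderiv g) (n - 1) \<in> m" using True by (intro Min)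
      hence "of_nat n * coeff g n \<in> m" using n0 by (simp add: coeff_pderiv)
      hence "coeff g n * of_nat n \<in> m" by (simp add: mult.commute)
      moreover have "coeff g n \<in> B" using g(1) derivation_graphD(2)[OF G] by (auto simp: dual_polys_def)
      ultimately have "of_nat n \<in> m" using lc by (intro m_prime[of "coeff g n" "of_nat n"] B_intros)
      hence nm: "\<iota> (of_nat n) \<in> m" by (simp add: ring_hom_of_nat[OF hom])
      have "of_nat n = (0::'k)"
      proof (rule ccontr)
        assume "of_nat n \<noteq> (0::'k)"
        hence "\<iota> (inverse (of_nat n)) * \<iota> (of_nat n) = 1"
          by (simp flip: ring_homD(3)[OF hom] add: ring_homD(1)[OF hom])
        moreover have "\<iota> (inverse (of_nat n)) * \<iota> (of_nat n) \<in> m" using nm \<iota>B by (intro m_mult) auto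
        ultimately show False using m_1 by simp
      qed
      hence dvd: "CHAR('k) dvd n" by (simp add: of_nat_eq_0_iff_char_dvd)
      let ?p = "CHAR('k)"
      have p: "?p > 0" "?p \<le> n" using dvd n0 by (auto intro!: Nat.gr0I dvd_imp_le)
      \<comment> \<open>The p-th power of z is a constant, so this relation has dual part 0 and v =
        0 satisfies it. Its degree p is at most n, and minimality makes it equal to n.\<close>
      let ?h = "monom 1 ?p - monom (z ^ ?p) 0"
      have "(z ^ ?p, 0) \<in> G" using F[OF p(1)] derivation_graphD(5)[OF G] by blast
      from dual_polys_diff[OF ds dual_polys_monom[OF ds dual_subringD(1)[OF ds]] dual_polys_monom[OF ds this]]
      have h: "(?h, 0) \<in> dual_polys G" by simp
      have hz: "poly ?h z = 0" by (simp add: poly_monom)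
      have "?p = n"
      proof (rule ccontr)
        assume "?p \<noteq> n"
        hence "\<forall>k\<ge>n. coeff ?h k = 0" using p by auto
        hence "coeff ?h ?p \<in> m" using h hz m_0 by (intro Min) auto
        thus False using p(1) m_1 by simp
      qed
      hence "\<forall>k\<ge>Suc n. coeff ?h k = 0" "coeff ?h n \<notin> m" using p m_1 by auto
      moreover have "dual_eval z 0 ?h 0 - lam (poly ?h z) \<in> m"
        unfolding hz using lam_0 m_uminus by (simp add: dual_eval_def)
      moreover have "poly ?h z \<in> m" using hz m_0 by simp
      ultimately show ?thesis using h subring_0[OF B] by blast
    qed
    then obtain g d v where g: "(g, d) \<in> dual_polys G" "\<forall>k\<ge>Suc n. coeff g k = 0" "coeff g n \<notin> m"
      "poly g z \<in> m" and v: "v \<in> B" and gv: "dual_eval z v g d - lam (poly g z) \<in> m" by blast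
    have "\<forall>h e. (h, e) \<in> dual_polys G \<longrightarrow> (\<forall>k\<ge>N. coeff h k = 0) \<longrightarrow> poly h z \<in> m \<longrightarrow>
      dual_eval z v h e - lam (poly h z) \<in> m" for N
    proof (induction N)
      case 0
      {
        fix h e assume h: "(h, e) \<in> dual_polys G" "\<forall>k\<ge>0. coeff h k = 0"
        hence "h = 0" by (auto intro: poly_eqI)
        hence "dual_eval z v h e - lam (poly h z) \<in> m"
          using derivation_graph_lam_poly[OF G z h(1)] m_0 by (simp add: dual_eval_def)
      }
      thus ?case by blast
    next
      case (Suc N)
      show ?case
      proof (intro allI impI)
        fix h e assume h: "(h, e) \<in> dual_polys G" "\<forall>k\<ge>Suc N. coeff h k = 0" "poly h z \<in> m"
        show "dual_eval z v h e - lam (poly h z) \<in> m"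
        proof (cases "N < n")
          case True
          hence hm: "coeff h k \<in> m" for k using h by (intro Min) auto
          have "poly (pderiv h) z \<in> m"
            using hm z by (intro poly_in_m) (auto simp: coeff_pderiv simp del: of_nat_Suc intro!: m_mult B_intros)
          hence "(poly e z - lam (poly h z)) + poly (pderiv h) z * v \<in> m"
            using derivation_graph_lam_poly[OF G z h(1) hm] v by (intro m_add m_mult2)
          thus ?thesis by (simp add: dual_eval_def algebra_simps)
        next
          case False
          \<comment> \<open>Pseudo-division by g: h is multiplied by the leading coefficient of g,
            whose inverse lies in B but perhaps not in the domain of the derivation.\<close>
          define s where "s = N - n"
          define lc a where "lc = coeff g n" and "a = coeff h N"
          have lG: "(lc, coeff d n) \<in> G" and aG: "(a, coeff e N) \<in> G"
            using g(1) h(1) by (auto simp: dual_polys_def lc_def a_def)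
          have lcB: "lc \<in> B" and aB: "a \<in> B" using lG aG derivation_graphD(2)[OF G] by blast+
          note ml = dual_polys_monom[OF ds lG, of 0] and ma = dual_polys_monom[OF ds aG, of s]
          define h2 where "h2 = monom lc 0 * h - monom a s * g"
          define e2 where "e2 = (monom lc 0 * e + h * monom (coeff d n) 0) - (monom a s * d + g * monom (coeff e N) s)"
          have h2: "(h2, e2) \<in> dual_polys G" unfolding h2_def e2_def
            by (rule dual_polys_diff[OF ds dual_polys_mult[OF ds ml h(1)] dual_polys_mult[OF ds ma g(1)]])
          have "coeff h2 k = 0" if "k \<ge> N" for k
          proof (cases "k = N")
            case True
            thus ?thesis using False by (simp add: h2_def coeff_monom_mult s_def lc_def a_def)
          next
            case kN: False
            hence "coeff h k = 0" using h(2) that by simp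
            moreover have "coeff g (k - s) = 0" using g(2) that kN False by (simp add: s_def)
            ultimately show ?thesis by (simp add: h2_def coeff_monom_mult)
          qed
          moreover have hz: "poly h2 z = lc * poly h z - a * z ^ s * poly g z"
            by (simp add: h2_def poly_monom)
          have asB: "a * z ^ s \<in> B" using aB z by (intro B_intros)
          have m1: "lc * poly h z \<in> m" and m2: "a * z ^ s * poly g z \<in> m"
            using lcB asB h(3) g(4) by (auto intro!: m_mult)
          have "poly h2 z \<in> m" unfolding hz using m1 m2 by (rule m_diff)
          ultimately have X: "dual_eval z v h2 e2 - lam (poly h2 z) \<in> m" using Suc.IH h2 by blast
          define \<delta>1 where "\<delta>1 = dual_eval z v (monom lc 0) (monom (coeff d n) 0)"
          define \<delta>2 where "\<delta>2 = dual_eval z v (monom a s) (monom (coeff e N) s)"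
          have ev: "dual_eval z v h2 e2 = lc * dual_eval z v h e + poly h z * \<delta>1 -
              (a * z ^ s * dual_eval z v g d + poly g z * \<delta>2)"
            unfolding h2_def e2_def dual_eval_diff dual_eval_mult \<delta>1_def \<delta>2_def by (simp add: poly_monom)
          have \<delta>: "\<delta>1 \<in> B" "\<delta>2 \<in> B" unfolding \<delta>1_def \<delta>2_def
            using dual_eval_in_B(2)[OF G ml z v] dual_eval_in_B(2)[OF G ma z v] by auto
          have Y: "lam (poly h2 z) - (lam (lc * poly h z) - lam (a * z ^ s * poly g z)) \<in> m"
            unfolding hz by (rule lam_diff[OF m1 m2])
          have Y1: "lam (lc * poly h z) - lc * lam (poly h z) \<in> m" using lcB h(3) by (rule lam_mult)
          have Y2: "lam (a * z ^ s * poly g z) - a * z ^ s * lam (poly g z) \<in> m" using asB g(4) by (rule lam_mult)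
          \<comment> \<open>A formal identity: seven elements of m add up to \<open>lc\<close> times
            the difference that is to be shown in m.\<close>
          have alg: "(D2 - L2) + (L2 - (La - Lb)) + (La - lc * Lh) - (Lb - u * Lg) - x * \<delta>1 + u * (Dg - Lg) + y * \<delta>2 =
              lc * (Dh - Lh)" if "D2 = lc * Dh + x * \<delta>1 - (u * Dg + y * \<delta>2)" for D2 L2 La Lb Lh Lg Dg Dh u x y
            unfolding that by (simp add: algebra_simps)
          have "lc * (dual_eval z v h e - lam (poly h z)) \<in> m"
            using m_add[OF m_add[OF m_diff[OF m_diff[OF m_add[OF m_add[OF X Y] Y1] Y2]
              m_mult2[OF h(3) \<delta>(1)]] m_mult[OF asB gv]] m_mult2[OF g(4) \<delta>(2)]]
            unfolding alg[OF ev] .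
          moreover have "dual_eval z v h e - lam (poly h z) \<in> B"
            using dual_eval_in_B(2)[OF G h(1) z v] lam_B[OF h(3)] by (rule subring_diff[OF B])
          ultimately show ?thesis using m_prime[OF lcB _ _ g(3)[folded lc_def]] by blast
        qed
      qed
    qed
    note * = this
    have "dual_eval z v c d - lam (poly c z) \<in> m" if "(c, d) \<in> dual_polys G" "poly c z \<in> m" for c d
    proof -
      have "\<forall>k\<ge>Suc (degree c). coeff c k = 0" by (auto simp: coeff_eq_0)
      with * that show ?thesis by blast
    qed
    thus ?thesis using v by blast
  qed
qed

text \<open>The starting domain is F + m, with x + y sent to \<open>lam y\<close>. This is well
  defined modulo m because \<open>lam\<close> takes values in m on F \<inter> m; the summand e
  closes the graph under congruence.\<close>

lemma derivation_graph_exists: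
  assumes F: "is_subring F" "F \<subseteq> B" "\<And>x. x \<in> F \<Longrightarrow> x \<in> m \<Longrightarrow> lam x \<in> m"
  shows "\<exists>G. derivation_graph F G"
proof -
  define G where "G = {(x + y, lam y + e) | x y e. x \<in> F \<and> y \<in> m \<and> e \<in> m}"
  have GI: "(c, d) \<in> G" if "x \<in> F" "y \<in> m" "c = x + y" "d - lam y \<in> m" for x y c d
    unfolding G_def using that by (intro CollectI exI[of _ x] exI[of _ y] exI[of _ "d - lam y"]) auto
  have F0: "(x, 0) \<in> G" if "x \<in> F" for x
    using that m_0 m_uminus[OF lam_0] by (intro GI[of x 0]) auto
  have "dual_subring G"
    unfolding dual_subring_def
  proof (intro conjI allI impI)
    show "(1, 0) \<in> G" using F0 subring_1[OF F(1)] by blast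
    fix c d c' d' assume "(c, d) \<in> G" "(c', d') \<in> G"
    then obtain x y e x' y' e' where eq: "c = x + y" "d = lam y + e" "c' = x' + y'" "d' = lam y' + e'"
      and x: "x \<in> F" "x' \<in> F" and y: "y \<in> m" "y' \<in> m" and e: "e \<in> m" "e' \<in> m"
      unfolding G_def by blast
    have xB: "x \<in> B" "x' \<in> B" using x F(2) by auto
    note yB = y[THEN m_in_B]
    show "(c - c', d - d') \<in> G"
    proof (rule GI[of "x - x'" "y - y'"])
      show "x - x' \<in> F" using x F(1) by (intro subring_diff)
      show "y - y' \<in> m" using y by (rule m_diff)
      have "e - e' - (lam (y - y') - (lam y - lam y')) \<in> m"
        by (rule m_diff[OF m_diff[OF e] lam_diff[OF y]])
      thus "d - d' - lam (y - y') \<in> m" by (simp add: eq algebra_simps)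
    qed (simp add: eq)
    show "(c * c', c * d' + c' * d) \<in> G"
    proof (rule GI[of "x * x'" "(x + y) * y' + x' * y"])
      show "x * x' \<in> F" using x F(1) by (intro subring_mult)
      have xy: "x + y \<in> B" and xy': "x' + y' \<in> B" using xB yB by (auto intro: subring_add[OF B])
      have 1: "(x + y) * y' \<in> m" "x' * y \<in> m" using y xy xB by (auto intro: m_mult)
      thus "(x + y) * y' + x' * y \<in> m" by (rule m_add)
      have "(x + y) * e' + (x' + y') * e + y' * lam y -
        (lam ((x + y) * y' + x' * y) - (lam ((x + y) * y') + lam (x' * y))) -
        (lam ((x + y) * y') - (x + y) * lam y') - (lam (x' * y) - x' * lam y) \<in> m"
        by (rule m_diff[OF m_diff[OF m_diff[OF m_add[OF m_add[OF m_mult[OF xy e(2)] m_mult[OF xy' e(1)]]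
          m_mult2[OF y(2) lam_B[OF y(1)]]] lam_add[OF 1]] lam_mult[OF xy y(2)]] lam_mult[OF xB(2) y(1)]])
      thus "c * d' + c' * d - lam ((x + y) * y' + x' * y) \<in> m" by (simp add: eq algebra_simps)
    qed (simp add: eq algebra_simps)
  qed
  moreover have "G \<subseteq> B \<times> B"
    unfolding G_def using F(2) m_in_B lam_B by (auto intro!: B_intros)
  moreover have "(y, lam y) \<in> G" if "y \<in> m" for y
    using that subring_0[OF F(1)] m_0 by (intro GI[of 0 y]) auto
  moreover have "d \<in> m" if d: "(0, d) \<in> G" for d
  proof -
    obtain x y e where xy: "0 = x + y" "d = lam y + e" "x \<in> F" "y \<in> m" "e \<in> m"
      using d unfolding G_def by blast
    have "y = - x" using xy(1) by (simp add: eq_neg_iff_add_eq_0 add.commute)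
    hence "y \<in> F" using subring_uminus[OF F(1) xy(3)] by simp
    hence "lam y \<in> m" using F(3) xy(4) by blast
    thus ?thesis using xy m_add by blast
  qed
  ultimately show ?thesis using F0 unfolding derivation_graph_def by blast
qed

text \<open>By Zorn's lemma: a maximal graph is defined on all of B, since any missing z could be
  adjoined with the value from \<open>derivation_value_exists\<close>.\<close>

lemma total_derivation_exists:
  fixes \<iota> :: "'k::field \<Rightarrow> 'f"
  assumes F: "is_subring F" "F \<subseteq> B" "\<And>x. x \<in> F \<Longrightarrow> x \<in> m \<Longrightarrow> lam x \<in> m"
    and hom: "is_ring_hom \<iota>" and \<iota>B: "range \<iota> \<subseteq> B"
    and Fp: "\<And>z. CHAR('k) > 0 \<Longrightarrow> z \<in> B \<Longrightarrow> z ^ CHAR('k) \<in> F"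
  shows "\<exists>G. derivation_graph F G \<and> (\<forall>z\<in>B. \<exists>v. (z, v) \<in> G)"
proof -
  let ?A = "{G. derivation_graph F G}"
  have "\<exists>M\<in>?A. \<forall>X\<in>?A. M \<subseteq> X \<longrightarrow> X = M"
  proof (rule subset_Zorn_nonempty)
    show "?A \<noteq> {}" using derivation_graph_exists[OF F] by blast
  next
    fix C assume ne: "C \<noteq> {}" and chain: "subset.chain ?A C"
    have CG: "derivation_graph F G" if "G \<in> C" for G using chain that unfolding subset_chain_def by blast
    have two: "\<exists>G\<in>C. x \<in> G \<and> y \<in> G" if xy: "x \<in> \<Union>C" "y \<in> \<Union>C" for x y
    proof -
      obtain X Y where XY: "X \<in> C" "Y \<in> C" "x \<in> X" "y \<in> Y" using xy by blast
      have "X \<subseteq> Y \<or> Y \<subseteq> X" using chain XY unfolding subset_chain_def by blast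
      thus ?thesis using XY by blast
    qed
    obtain G0 where G0: "G0 \<in> C" using ne by blast
    have "dual_subring (\<Union>C)"
      unfolding dual_subring_def
    proof (intro conjI allI impI)
      show "(1, 0) \<in> \<Union>C" using dual_subringD(1)[OF derivation_graphD(1)[OF CG[OF G0]]] G0 by blast
      fix c d c' d' assume "(c, d) \<in> \<Union>C" "(c', d') \<in> \<Union>C"
      then obtain G where G: "G \<in> C" "(c, d) \<in> G" "(c', d') \<in> G" using two by blast
      show "(c - c', d - d') \<in> \<Union>C" "(c * c', c * d' + c' * d) \<in> \<Union>C"
        using dual_subringD(4,5)[OF derivation_graphD(1)[OF CG[OF G(1)]] G(2,3)] G(1) by blast+
    qed
    moreover have "\<Union>C \<subseteq> B \<times> B" using CG derivation_graph_def by blast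
    moreover have "\<forall>y\<in>m. (y, lam y) \<in> \<Union>C" "\<forall>x\<in>F. (x, 0) \<in> \<Union>C"
      using derivation_graphD(4,5)[OF CG[OF G0]] G0 by auto
    moreover have "\<forall>d. (0, d) \<in> \<Union>C \<longrightarrow> d \<in> m"
      using derivation_graphD(6)[OF CG] by auto
    ultimately show "\<Union>C \<in> ?A" unfolding derivation_graph_def by simp
  qed
  then obtain G where G: "derivation_graph F G"
    and max: "\<And>X. derivation_graph F X \<Longrightarrow> G \<subseteq> X \<Longrightarrow> X = G" by auto
  have "\<exists>v. (z, v) \<in> G" if z: "z \<in> B" for z
  proof -
    obtain v where v: "v \<in> B" and key: "\<And>c d. (c, d) \<in> dual_polys G \<Longrightarrow> poly c z \<in> m \<Longrightarrow>
        dual_eval z v c d - lam (poly c z) \<in> m"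
      using derivation_value_exists[OF G z hom \<iota>B Fp[OF _ z]] by blast
    have "dual_eval z v c d \<in> m" if cd: "(c, d) \<in> dual_polys G" "poly c z = 0" for c d
      using key[OF cd(1)] m_diff_cancel[OF _ lam_0] m_0 unfolding cd(2) by blast
    from derivation_graph_extend[OF G z v this] max show ?thesis by blast
  qed
  thus ?thesis using G by blast
qed

text \<open>This is where perfectness of the ground field is used.\<close>

lemma tangent_vector_exists:
  fixes \<iota> :: "'k::alg_closed_field \<Rightarrow> 'f"
  assumes hom: "is_ring_hom \<iota>" and \<iota>B: "range \<iota> \<subseteq> B" and aB: "\<And>i. i < n \<Longrightarrow> a i \<in> B"
  shows "\<exists>e. (\<forall>i<n. e i \<in> B) \<and> (\<forall>p\<in>polys_in n. mpoly_eval \<iota> a p \<in> m \<longrightarrow>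
    (\<Sum>i<n. mpoly_eval \<iota> a (mpoly_deriv i p) * e i) - lam (mpoly_eval \<iota> a p) \<in> m)"
proof -
  let ?p = "CHAR('k)"
  \<comment> \<open>The ring of constants has to contain k and, in positive characteristic, all p-th
    powers, and \<open>lam\<close> must vanish modulo m where it meets m. In characteristic 0 the
    image of k serves, meeting m only in 0.\<close>
  have "\<exists>F. is_subring F \<and> F \<subseteq> B \<and> (\<forall>x\<in>F. x \<in> m \<longrightarrow> lam x \<in> m) \<and> range \<iota> \<subseteq> F \<and>
    (\<forall>z\<in>B. ?p > 0 \<longrightarrow> z ^ ?p \<in> F)"
  proof (cases "?p = 0")
    case True
    have "lam (\<iota> c) \<in> m" if "\<iota> c \<in> m" for c
    proof -
      have "c = 0"
      proof (rule ccontr)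
        assume "c \<noteq> 0"
        hence "\<iota> (inverse c) * \<iota> c = 1" by (simp flip: ring_homD(3)[OF hom] add: ring_homD(1)[OF hom])
        moreover have "\<iota> (inverse c) * \<iota> c \<in> m" using that \<iota>B by (intro m_mult) auto
        ultimately show False using m_1 by simp
      qed
      thus ?thesis using lam_0 by (simp add: ring_hom_0[OF hom])
    qed
    thus ?thesis using True subring_range[OF hom] \<iota>B by (intro exI[of _ "range \<iota>"]) auto
  next
    case False
    hence prime: "prime ?p" by (intro prime_CHAR_semidom) simp
    have "of_nat ?p = \<iota> (of_nat ?p)" by (simp only: ring_hom_of_nat[OF hom])
    hence "of_nat ?p = (0::'f)" by (simp add: ring_hom_0[OF hom])
    hence "CHAR('f) dvd ?p" by (simp only: of_nat_eq_0_iff_char_dvd)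
    moreover have "CHAR('f) \<noteq> 1" by simp
    ultimately have char: "CHAR('f) = ?p" using prime unfolding prime_nat_iff by blast
    have add: "(x + y) ^ ?p = x ^ ?p + y ^ ?p" for x y :: 'f
      by (rule freshmans_dream) (simp_all only: char prime)
    have diff: "(x - y) ^ ?p = x ^ ?p - y ^ ?p" for x y :: 'f
      using add[of "x - y" y] by simp
    \<comment> \<open>In characteristic p the p-th powers serve: they include k because k has p-th
      roots, and for b in m the value of \<open>lam\<close> at b^p is congruent to b^(p-1) times
      \<open>lam b\<close>, hence in m.\<close>
    let ?F = "(\<lambda>b. b ^ ?p) ` B"
    have "is_subring ?F"
      unfolding is_subring_def
    proof (intro conjI ballI)
      show "1 \<in> ?F" using subring_1[OF B] by (intro image_eqI[of _ _ 1]) auto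
      fix x y assume "x \<in> ?F" "y \<in> ?F"
      then obtain b b' where b: "x = b ^ ?p" "y = b' ^ ?p" "b \<in> B" "b' \<in> B" by blast
      show "x - y \<in> ?F" using b B_intros(5) by (intro image_eqI[of _ _ "b - b'"]) (auto simp: diff)
      show "x * y \<in> ?F" using b B_intros(4) by (intro image_eqI[of _ _ "b * b'"]) (auto simp: power_mult_distrib)
    qed
    moreover have "lam (b ^ ?p) \<in> m" if b: "b \<in> B" "b ^ ?p \<in> m" for b
    proof -
      have bm: "b \<in> m" using m_power b by blast
      have p: "?p = Suc (Suc (?p - 2))" using prime_ge_2_nat[OF prime] by simp
      have "b * b ^ (?p - 2) * b = b ^ ?p" by (subst (2) p) simp
      moreover have c: "b * b ^ (?p - 2) \<in> m" using bm b by (intro m_mult2 B_intros)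
      ultimately have "lam (b ^ ?p) - b * b ^ (?p - 2) * lam b \<in> m" using lam_mult[OF m_in_B[OF c] bm] by simp
      moreover have "b * b ^ (?p - 2) * lam b \<in> m" using c lam_B[OF bm] by (rule m_mult2)
      ultimately show ?thesis by (rule m_diff_cancel)
    qed
    moreover have "\<iota> c \<in> ?F" for c
    proof -
      obtain b where "b ^ ?p = c" using nth_root_exists[of ?p c] False by auto
      thus ?thesis using \<iota>B by (intro image_eqI[of _ _ "\<iota> b"]) (auto simp flip: ring_hom_power[OF hom])
    qed
    ultimately show ?thesis using B_intros(9) by (intro exI[of _ ?F]) auto
  qed
  then obtain F where F: "is_subring F" "F \<subseteq> B" "\<And>x. x \<in> F \<Longrightarrow> x \<in> m \<Longrightarrow> lam x \<in> m"
    and \<iota>F: "range \<iota> \<subseteq> F" and Fp: "\<And>z. ?p > 0 \<Longrightarrow> z \<in> B \<Longrightarrow> z ^ ?p \<in> F" by blast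
  obtain G where G: "derivation_graph F G" and tot: "\<forall>z\<in>B. \<exists>v. (z, v) \<in> G"
    using total_derivation_exists[OF F hom \<iota>B Fp] by blast
  note ds = derivation_graphD(1)[OF G]
  have "\<forall>i. \<exists>v. i < n \<longrightarrow> (a i, v) \<in> G" using tot aB by blast
  then obtain e where e: "\<And>i. i < n \<Longrightarrow> (a i, e i) \<in> G" by metis
  \<comment> \<open>The chain rule for the derivation whose values at the a i are the e i.\<close>
  have "(mpoly_eval \<iota> a p, \<Sum>i<n. mpoly_eval \<iota> a (mpoly_deriv i p) * e i) \<in> G" if "p \<in> polys_in n" for p
    using that
  proof (induction p rule: polys_in_induct)
    case (const c)
    show ?case using derivation_graphD(5)[OF G, of "\<iota> c"] \<iota>F
      by (auto simp: mpoly_eval_const[OF hom] mpoly_deriv_const mpoly_eval_0[OF hom])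
  next
    case (add p q)
    thus ?case using dual_subringD(3)[OF ds add(3,4)]
      by (simp add: mpoly_eval_add[OF hom] mpoly_deriv_add distrib_right sum.distrib)
  next
    case (var j p)
    have "mpoly_eval \<iota> a (mpoly_deriv i (mpoly_var j * p)) * e i =
        (if i = j then mpoly_eval \<iota> a p * e i else 0) + a j * (mpoly_eval \<iota> a (mpoly_deriv i p) * e i)" for i
      by (simp add: mpoly_deriv_var_mult mpoly_eval_add[OF hom] mpoly_eval_mult[OF hom]
          mpoly_eval_var[OF hom] mpoly_eval_0[OF hom] distrib_right mult.assoc)
    hence "(\<Sum>i<n. mpoly_eval \<iota> a (mpoly_deriv i (mpoly_var j * p)) * e i) =
        a j * (\<Sum>i<n. mpoly_eval \<iota> a (mpoly_deriv i p) * e i) + mpoly_eval \<iota> a p * e j"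
      using var(1) by (simp add: sum.distrib sum_distrib_left)
    thus ?case using dual_subringD(5)[OF ds e[OF var(1)] var(3)]
      by (simp add: mpoly_eval_mult[OF hom] mpoly_eval_var[OF hom])
  qed
  hence "\<forall>p\<in>polys_in n. mpoly_eval \<iota> a p \<in> m \<longrightarrow>
    (\<Sum>i<n. mpoly_eval \<iota> a (mpoly_deriv i p) * e i) - lam (mpoly_eval \<iota> a p) \<in> m"
    using derivation_graph_lam[OF G] by blast
  thus ?thesis using e derivation_graphD(3)[OF G] by blast
qed

end

section \<open>Hasse-Schmidt derivations\<close>

lemma mpoly_eval_cong_ideal:
  assumes hom: "is_ring_hom \<iota>" and J: "ideal J" and uv: "\<And>i. i < n \<Longrightarrow> u i - v i \<in> J"
    and p: "p \<in> polys_in n"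
  shows "mpoly_eval \<iota> u p - mpoly_eval \<iota> v p \<in> J"
  using p
proof (induction p rule: polys_in_induct)
  case (const c)
  show ?case by (simp add: mpoly_eval_const[OF hom] ideal_0[OF J])
next
  case (add p q)
  show ?case using ideal_add[OF J add(3,4)] by (simp add: mpoly_eval_add[OF hom] algebra_simps)
next
  case (var i p)
  have "(u i - v i) * mpoly_eval \<iota> u p + v i * (mpoly_eval \<iota> u p - mpoly_eval \<iota> v p) \<in> J"
    by (intro ideal_add[OF J] ideal_mult2[OF J uv[OF var(1)]] ideal_mult[OF J var(3)])
  thus ?case by (simp add: mpoly_eval_mult[OF hom] mpoly_eval_var[OF hom] algebra_simps)
qed

lemma ideal_fps_low: "ideal {f :: 'a::comm_ring_1 fps. \<forall>s<N. fps_nth f s = 0}"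
  by (rule idealI) (auto simp: fps_mult_nth)

lemma ring_hom_fps_nth_0: "is_ring_hom (\<lambda>f :: 'a::comm_ring_1 fps. fps_nth f 0)"
  by (simp add: is_ring_hom_def)

lemma ring_hom_fps_const: "is_ring_hom \<iota> \<Longrightarrow> is_ring_hom (fps_const \<circ> \<iota>)"
  by (auto simp: is_ring_hom_def)

section \<open>Power series over the local ring and Hensel lifting\<close>

definition fps_over :: "'a::comm_ring_1 set \<Rightarrow> 'a fps set" where
  "fps_over B = {f. \<forall>k. fps_nth f k \<in> B}"

lemma is_subring_fps_over: assumes "is_subring B" shows "is_subring (fps_over B)"
  unfolding is_subring_def fps_over_def
proof (intro conjI ballI)
  show "1 \<in> {f. \<forall>k. fps_nth f k \<in> B}" using subring_0[OF assms] subring_1[OF assms] by (simp add: fps_one_nth)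
  fix x y assume xy: "x \<in> {f. \<forall>k. fps_nth f k \<in> B}" "y \<in> {f. \<forall>k. fps_nth f k \<in> B}"
  show "x - y \<in> {f. \<forall>k. fps_nth f k \<in> B}" using xy subring_diff[OF assms] by simp
  show "x * y \<in> {f. \<forall>k. fps_nth f k \<in> B}" using xy
    by (auto simp: fps_mult_nth intro!: subring_sum[OF assms] subring_mult[OF assms])
qed

lemma fps_const_over: "is_subring B \<Longrightarrow> c \<in> B \<Longrightarrow> fps_const c \<in> fps_over B"
  by (auto simp: fps_over_def subring_0)

text \<open>\<open>K\<close> is the field of fractions, \<open>B\<close> the localization at a prime, of the algebra \<open>k[a\<^sub>0, \<dots>, a\<^sub>n\<^sub>-\<^sub>1]\<close>.\<close>

locale algebra_point = local_subring B m for B m :: "'f::field set" +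
  fixes \<iota> :: "'k::field \<Rightarrow> 'f" and n :: nat and a :: "nat \<Rightarrow> 'f"
  assumes hom: "is_ring_hom \<iota>" and \<iota>B: "range \<iota> \<subseteq> B"
    and aB: "\<And>i. i < n \<Longrightarrow> a i \<in> B"
    and frac: "\<And>z. \<exists>p\<in>polys_in n. \<exists>q\<in>polys_in n. mpoly_eval \<iota> a q \<noteq> 0 \<and> z * mpoly_eval \<iota> a q = mpoly_eval \<iota> a p"
    and frac_B: "\<And>z. z \<in> B \<Longrightarrow>
      \<exists>p\<in>polys_in n. \<exists>q\<in>polys_in n. mpoly_eval \<iota> a q \<notin> m \<and> z * mpoly_eval \<iota> a q = mpoly_eval \<iota> a p"
begin

abbreviation ev :: "'k mpoly \<Rightarrow> 'f" where "ev \<equiv> mpoly_eval \<iota> a"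
abbreviation ev_fps :: "(nat \<Rightarrow> 'f fps) \<Rightarrow> 'k mpoly \<Rightarrow> 'f fps" where
  "ev_fps \<equiv> mpoly_eval (fps_const \<circ> \<iota>)"

lemmas hom_fps = ring_hom_fps_const[OF hom]

lemma ev_in_B: "p \<in> polys_in n \<Longrightarrow> ev p \<in> B"
  using B \<iota>B aB by (intro mpoly_eval_in_subring) auto

lemma ev_fps_over:
  assumes "\<And>i. i < n \<Longrightarrow> A i \<in> fps_over B" "p \<in> polys_in n" shows "ev_fps A p \<in> fps_over B"
proof (rule mpoly_eval_in_subring[OF is_subring_fps_over[OF B] _ assms])
  show "range (fps_const \<circ> \<iota>) \<subseteq> fps_over B" using \<iota>B fps_const_over[OF B] by auto
qed

lemma ev_fps_nth_0:
  assumes "\<And>i. fps_nth (A i) 0 = a i" shows "fps_nth (ev_fps A p) 0 = ev p"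
proof -
  have "(\<lambda>f. fps_nth f 0) \<circ> (fps_const \<circ> \<iota>) = \<iota>" "(\<lambda>f. fps_nth f 0) \<circ> A = a" using assms by auto
  thus ?thesis using mpoly_eval_hom[OF ring_hom_fps_nth_0, of "fps_const \<circ> \<iota>" A p] by simp
qed

text \<open>A Newton step: corrections b i X^(k+1) change the coefficients of X^(k+1) in the values
  of the F j by the Jacobian matrix at a times b, so b is N applied to the error. Products of
  corrections start in degree 2k + 2 and do not interfere.\<close>

lemma hensel_step:
  assumes F: "\<And>j. j < n \<Longrightarrow> F j \<in> polys_in n"
    and NB: "\<And>i j. i < n \<Longrightarrow> j < n \<Longrightarrow> N i j \<in> B"
    and inv: "\<And>j l. j < n \<Longrightarrow> l < n \<Longrightarrow> (\<Sum>i<n. ev (mpoly_deriv i (F j)) * N i l) = (if j = l then 1 else 0)"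
    and T: "\<And>j. j < n \<Longrightarrow> T j \<in> fps_over B"
    and A: "\<And>i. i < n \<Longrightarrow> A i \<in> fps_over B" and A0: "\<And>i. fps_nth (A i) 0 = a i"
    and FA: "\<And>j s. j < n \<Longrightarrow> s \<le> k \<Longrightarrow> fps_nth (ev_fps A (F j)) s = fps_nth (T j) s"
  shows "\<exists>A'. (\<forall>i<n. A' i \<in> fps_over B) \<and> (\<forall>i. fps_nth (A' i) 0 = a i) \<and>
    (\<forall>j<n. \<forall>s\<le>Suc k. fps_nth (ev_fps A' (F j)) s = fps_nth (T j) s) \<and>
    (\<forall>i. \<forall>s\<le>k. fps_nth (A' i) s = fps_nth (A i) s)"
proof -
  define err where "err l = fps_nth (T l) (Suc k) - fps_nth (ev_fps A (F l)) (Suc k)" for l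
  have errB: "err l \<in> B" if "l < n" for l
    using T[OF that] ev_fps_over[OF A F[OF that]] unfolding err_def fps_over_def by (auto intro: subring_diff[OF B])
  define b where "b i = (\<Sum>l<n. N i l * err l)" for i
  have bB: "b i \<in> B" if "i < n" for i
    unfolding b_def using that errB NB by (intro B_intros) auto
  define e where "e i = fps_const (b i) * fps_X ^ Suc k" for i
  have e_nth: "fps_nth (e i) s = (if s = Suc k then b i else 0)" for i s
    by (simp add: e_def fps_X_power_nth del: power_Suc)
  define A' where "A' i = (if i < n then A i + e i else A i)" for i
  let ?J = "{f :: 'f fps. \<forall>s<Suc (Suc k). fps_nth f s = 0}"
  have ee: "e i * e j \<in> ?J" for i j
    by (auto simp: fps_mult_nth e_nth intro!: sum.neutral)
  have Mb: "(\<Sum>i<n. ev (mpoly_deriv i (F j)) * b i) = err j" if "j < n" for j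
  proof -
    have "(\<Sum>i<n. ev (mpoly_deriv i (F j)) * b i) = (\<Sum>i<n. \<Sum>l<n. ev (mpoly_deriv i (F j)) * N i l * err l)"
      by (simp add: b_def sum_distrib_left mult.assoc)
    also have "\<dots> = (\<Sum>l<n. (\<Sum>i<n. ev (mpoly_deriv i (F j)) * N i l) * err l)"
      by (subst sum.swap) (simp add: sum_distrib_right)
    also have "\<dots> = (\<Sum>l<n. if l = j then err l else 0)"
      using inv[OF that] by (intro sum.cong) auto
    finally show ?thesis using that by simp
  qed
  have "fps_nth (ev_fps A' (F j)) s = fps_nth (T j) s" if j: "j < n" and s: "s \<le> Suc k" for j s
  proof -
    have z: "ideal {0 :: 'f fps}" by (rule idealI) auto
    have eqA: "ev_fps A' (F j) = ev_fps (\<lambda>i. A i + e i) (F j)"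
      using mpoly_eval_cong_ideal[OF hom_fps z, of n A' "\<lambda>i. A i + e i" "F j"] F[OF j]
      by (simp add: A'_def)
    have "ev_fps (\<lambda>i. A i + e i) (F j) - ev_fps A (F j) - (\<Sum>i<n. ev_fps A (mpoly_deriv i (F j)) * e i) \<in> ?J"
      by (rule mpoly_taylor[OF hom_fps ideal_fps_low ee F[OF j]])
    hence "fps_nth (ev_fps A' (F j)) s = fps_nth (ev_fps A (F j)) s +
        (\<Sum>i<n. fps_nth (ev_fps A (mpoly_deriv i (F j)) * e i) s)"
      using s unfolding eqA by (simp add: fps_sum_nth less_Suc_eq_le algebra_simps)
    also have "\<dots> = fps_nth (T j) s"
    proof (cases "s = Suc k")
      case True
      have "fps_nth (ev_fps A (mpoly_deriv i (F j)) * e i) s = ev (mpoly_deriv i (F j)) * b i" for i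
        using ev_fps_nth_0[OF A0] True
        by (simp add: fps_mult_nth e_nth if_distrib[of "\<lambda>x. _ * x"] sum.delta[of _ 0] cong: if_cong)
          (subst sum.cong[OF refl, where h = "\<lambda>i'. if i' = 0 then ev (mpoly_deriv i (F j)) * b i else 0"], auto)
      thus ?thesis using Mb[OF j] by (simp add: err_def True)
    next
      case False
      have "fps_nth (ev_fps A (mpoly_deriv i (F j)) * e i) s = 0" for i
        using False s by (auto simp: fps_mult_nth e_nth intro!: sum.neutral)
      thus ?thesis using FA[OF j, of s] False s by simp
    qed
    finally show ?thesis .
  qed
  moreover have "A' i \<in> fps_over B" if "i < n" for i
    using A[OF that] bB[OF that] that B_intros(1) unfolding fps_over_def A'_def
    by (auto simp: e_nth intro!: subring_add[OF B])
  moreover have "fps_nth (A' i) s = fps_nth (A i) s" if "s \<le> k" for i s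
    using that by (simp add: A'_def e_nth)
  moreover have "fps_nth (A' i) 0 = a i" for i using A0 by (simp add: A'_def e_nth)
  ultimately show ?thesis by blast
qed

lemma hensel:
  assumes F: "\<And>j. j < n \<Longrightarrow> F j \<in> polys_in n"
    and NB: "\<And>i j. i < n \<Longrightarrow> j < n \<Longrightarrow> N i j \<in> B"
    and inv: "\<And>j l. j < n \<Longrightarrow> l < n \<Longrightarrow> (\<Sum>i<n. ev (mpoly_deriv i (F j)) * N i l) = (if j = l then 1 else 0)"
    and T: "\<And>j. j < n \<Longrightarrow> T j \<in> fps_over B" and T0: "\<And>j. j < n \<Longrightarrow> fps_nth (T j) 0 = ev (F j)"
  obtains A where "\<And>i. i < n \<Longrightarrow> A i \<in> fps_over B" "\<And>i. fps_nth (A i) 0 = a i"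
    "\<And>j. j < n \<Longrightarrow> ev_fps A (F j) = T j"
proof -
  let ?P = "\<lambda>k A. (\<forall>i<n. A i \<in> fps_over B) \<and> (\<forall>i. fps_nth (A i) 0 = a i) \<and>
    (\<forall>j<n. \<forall>s\<le>k. fps_nth (ev_fps A (F j)) s = fps_nth (T j) s)"
  \<comment> \<open>Coherence of successive approximations, so that the diagonal series
    \<open>L\<close> agrees with the k-th approximation up to degree k.\<close>
  let ?Q = "\<lambda>k A A'. \<forall>i. \<forall>s\<le>k. fps_nth (A' i) s = fps_nth ((A :: nat \<Rightarrow> 'f fps) i) s"
  have init: "\<exists>A. ?P 0 A"
    using T0 ev_fps_nth_0[of "\<lambda>i. fps_const (a i)"] aB
    by (intro exI[of _ "\<lambda>i. fps_const (a i)"]) (auto intro: fps_const_over[OF B])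
  have step: "\<exists>A'. ?P (Suc k) A' \<and> ?Q k A A'" if "?P k A" for A k
    using hensel_step[OF F NB inv T, where A = A and k = k] that by auto
  have "\<exists>A. \<forall>k. ?P k (A k) \<and> ?Q k (A k) (A (Suc k))"
    by (rule dependent_nat_choice[of ?P ?Q, OF init]) (rule step)
  then obtain A where PQ: "\<forall>k. ?P k (A k) \<and> ?Q k (A k) (A (Suc k))" by (elim exE)
  have A: "?P k (A k)" "?Q k (A k) (A (Suc k))" for k
    using PQ[rule_format, of k] by blast+
  have stable: "fps_nth (A (s + d) i) s = fps_nth (A s i) s" for s d i
    by (induction d) (use A(2) in auto)
  define L where "L i = Abs_fps (\<lambda>s. fps_nth (A s i) s)" for i
  have L_nth: "fps_nth (L i) s = fps_nth (A k i) s" if "s \<le> k" for i s k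
    using stable[of s "k - s" i] that by (simp add: L_def)
  show ?thesis
  proof (rule that[of L])
    show "L i \<in> fps_over B" if "i < n" for i
      using A(1) that unfolding fps_over_def L_def by auto
    show "fps_nth (L i) 0 = a i" for i using A(1)[of 0] by (simp add: L_def)
    show "ev_fps L (F j) = T j" if "j < n" for j
    proof (rule fps_ext)
      fix s
      have "ev_fps L (F j) - ev_fps (A s) (F j) \<in> {f :: 'f fps. \<forall>t<Suc s. fps_nth f t = 0}"
        using L_nth by (intro mpoly_eval_cong_ideal[OF hom_fps ideal_fps_low _ F[OF that]]) auto
      hence "fps_nth (ev_fps L (F j)) s = fps_nth (ev_fps (A s) (F j)) s" by simp
      thus "fps_nth (ev_fps L (F j)) s = fps_nth (T j) s" using A(1)[of s] that by auto
    qed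
  qed
qed

text \<open>The D j are the coefficients of a ring homomorphism K \<rightarrow> K[[X]] that lifts
  the identity, is constant on k and maps B to B[[X]].\<close>

definition hasse_schmidt :: "(nat \<Rightarrow> 'f \<Rightarrow> 'f) \<Rightarrow> bool" where
  "hasse_schmidt D \<longleftrightarrow> (\<forall>z. D 0 z = z) \<and> (\<forall>j z w. D j (z + w) = D j z + D j w) \<and>
     (\<forall>j z w. D j (z * w) = (\<Sum>i\<le>j. D i z * D (j - i) w)) \<and> (\<forall>j c. j > 0 \<longrightarrow> D j (\<iota> c) = 0) \<and>
     (\<forall>j. \<forall>z\<in>B. D j z \<in> B)"

text \<open>By \<open>ker\<close>, evaluation at A respects all relations among the generators, so
  it is defined on the algebra. It extends to fractions because a nonzero denominator becomes a
  series with nonzero constant term.\<close>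

lemma hasse_schmidt_exists:
  assumes A: "\<And>i. i < n \<Longrightarrow> A i \<in> fps_over B" and A0: "\<And>i. fps_nth (A i) 0 = a i"
    and ker: "\<And>h. h \<in> polys_in n \<Longrightarrow> ev h = 0 \<Longrightarrow> ev_fps A h = 0"
  shows "\<exists>D. hasse_schmidt D \<and> (\<forall>h\<in>polys_in n. \<forall>j. D j (ev h) = fps_nth (ev_fps A h) j)"
proof -
  let ?E = "ev_fps A"
  note E0 = ev_fps_nth_0[OF A0]
  note hs = mpoly_eval_mult[OF hom] mpoly_eval_add[OF hom]
    mpoly_eval_mult[OF hom_fps] mpoly_eval_add[OF hom_fps]
  \<comment> \<open>w is the image of z computed from some fraction representing z;
    \<open>rel_eq\<close> shows that every other fraction gives the same image.\<close>
  define rel where "rel z w \<longleftrightarrow> (\<exists>p\<in>polys_in n. \<exists>q\<in>polys_in n. ev q \<noteq> 0 \<and> z * ev q = ev p \<and> w * ?E q = ?E p)" for z w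
  have E_nz: "?E q \<noteq> 0" if "ev q \<noteq> 0" for q using that E0[of q] by auto
  have rel_ex: "\<exists>w. rel z w" for z
  proof -
    obtain p q where pq: "p \<in> polys_in n" "q \<in> polys_in n" "ev q \<noteq> 0" "z * ev q = ev p" using frac[of z] by blast
    have "inverse (?E q) * ?E q = 1" using pq(3) by (intro inverse_mult_eq_1) (simp add: E0)
    hence "?E p * inverse (?E q) * ?E q = ?E p" by (simp add: mult.assoc)
    thus ?thesis using pq unfolding rel_def by blast
  qed
  have rel_eq: "w * ?E q = ?E p" if r: "rel z w" and pq: "p \<in> polys_in n" "q \<in> polys_in n" "z * ev q = ev p" for z w p q
  proof -
    obtain p0 q0 where 0: "p0 \<in> polys_in n" "q0 \<in> polys_in n" "ev q0 \<noteq> 0" "z * ev q0 = ev p0" "w * ?E q0 = ?E p0"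
      using r unfolding rel_def by blast
    have "ev (p * q0 + - (p0 * q)) = 0"
      unfolding hs mpoly_eval_uminus[OF hom] 0(4)[symmetric] pq(3)[symmetric] by (simp add: algebra_simps)
    moreover have "p * q0 + - (p0 * q) \<in> polys_in n"
      using 0 pq by (intro polys_in_add polys_in_mult polys_in_uminus)
    ultimately have "?E (p * q0 + - (p0 * q)) = 0" using ker by blast
    hence "?E p * ?E q0 = ?E p0 * ?E q" unfolding hs mpoly_eval_uminus[OF hom_fps] by simp
    moreover have "(w * ?E q) * ?E q0 = (w * ?E q0) * ?E q" by (simp only: ac_simps)
    ultimately have "(w * ?E q) * ?E q0 = ?E p * ?E q0" using 0(5) by simp
    thus ?thesis using mult_right_cancel[OF E_nz[OF 0(3)]] by blast
  qed
  have rel_unique: "w = w'" if "rel z w" "rel z w'" for z w w'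
  proof -
    obtain p q where pq: "p \<in> polys_in n" "q \<in> polys_in n" "ev q \<noteq> 0" "z * ev q = ev p" using frac[of z] by blast
    have "w * ?E q = w' * ?E q" using rel_eq[OF _ pq(1,2,4)] that by simp
    thus ?thesis using E_nz[OF pq(3)] by simp
  qed
  define \<Phi> where "\<Phi> z = (SOME w. rel z w)" for z
  have rel: "rel z (\<Phi> z)" for z unfolding \<Phi>_def using rel_ex by (rule someI_ex)
  have \<Phi>I: "\<Phi> z = w" if "rel z w" for z w using rel_unique[OF rel that] .
  have \<Phi>_ev: "\<Phi> (ev h) = ?E h" if "h \<in> polys_in n" for h
  proof (rule \<Phi>I)
    have "ev 1 = 1" "?E 1 = 1"
      using mpoly_eval_const[OF hom, of a 1] mpoly_eval_const[OF hom_fps, of A 1] ring_homD(1)[OF hom] by simp_all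
    hence "ev 1 \<noteq> 0 \<and> ev h * ev 1 = ev h \<and> ?E h * ?E 1 = ?E h" by simp
    thus "rel (ev h) (?E h)" unfolding rel_def using that polys_in_1 by blast
  qed
  have \<Phi>_add_mult: "\<Phi> (z + w) = \<Phi> z + \<Phi> w \<and> \<Phi> (z * w) = \<Phi> z * \<Phi> w" for z w
  proof -
    obtain p q where 1: "p \<in> polys_in n" "q \<in> polys_in n" "ev q \<noteq> 0" "z * ev q = ev p" "\<Phi> z * ?E q = ?E p"
      using rel[of z] unfolding rel_def by blast
    obtain p' q' where 2: "p' \<in> polys_in n" "q' \<in> polys_in n" "ev q' \<noteq> 0" "w * ev q' = ev p'" "\<Phi> w * ?E q' = ?E p'"
      using rel[of w] unfolding rel_def by blast
    have q: "q * q' \<in> polys_in n" "ev (q * q') \<noteq> 0" using 1 2 by (auto simp: hs intro: polys_in_mult)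
    have "rel (z + w) (\<Phi> z + \<Phi> w)"
      unfolding rel_def
    proof (rule bexI[of _ "p * q' + p' * q"], rule bexI[of _ "q * q'"], intro conjI q)
      show "(z + w) * ev (q * q') = ev (p * q' + p' * q)"
        unfolding hs 1(4)[symmetric] 2(4)[symmetric] by (simp add: algebra_simps)
      show "(\<Phi> z + \<Phi> w) * ?E (q * q') = ?E (p * q' + p' * q)"
        unfolding hs 1(5)[symmetric] 2(5)[symmetric] by (simp add: algebra_simps)
    qed (use 1 2 q in \<open>auto intro: polys_in_add polys_in_mult\<close>)
    moreover have "rel (z * w) (\<Phi> z * \<Phi> w)"
      unfolding rel_def
    proof (rule bexI[of _ "p * p'"], rule bexI[of _ "q * q'"], intro conjI q)
      show "z * w * ev (q * q') = ev (p * p')"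
        unfolding hs 1(4)[symmetric] 2(4)[symmetric] by (simp add: algebra_simps)
      show "\<Phi> z * \<Phi> w * ?E (q * q') = ?E (p * p')"
        unfolding hs 1(5)[symmetric] 2(5)[symmetric] by (simp add: algebra_simps)
    qed (use 1 2 q in \<open>auto intro: polys_in_mult\<close>)
    ultimately show ?thesis using \<Phi>I by blast
  qed
  have \<Phi>0: "fps_nth (\<Phi> z) 0 = z" for z
  proof -
    obtain p q where 1: "p \<in> polys_in n" "q \<in> polys_in n" "ev q \<noteq> 0" "z * ev q = ev p" "\<Phi> z * ?E q = ?E p"
      using rel[of z] unfolding rel_def by blast
    have "fps_nth (\<Phi> z * ?E q) 0 = fps_nth (?E p) 0" using 1(5) by simp
    hence "fps_nth (\<Phi> z) 0 * ev q = z * ev q" using 1(4) by (simp add: E0)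
    thus ?thesis using 1(3) by simp
  qed
  have \<Phi>\<iota>: "\<Phi> (\<iota> c) = fps_const (\<iota> c)" for c
    using \<Phi>_ev[OF polys_in_const, of c] by (simp add: mpoly_eval_const[OF hom] mpoly_eval_const[OF hom_fps])
  \<comment> \<open>The image is a quotient of series over B whose denominator has a unit of B as
    constant term, so its coefficients are found recursively in B.\<close>
  have \<Phi>B: "fps_nth (\<Phi> z) j \<in> B" if z: "z \<in> B" for z j
  proof -
    obtain p q where pq: "p \<in> polys_in n" "q \<in> polys_in n" "ev q \<notin> m" "z * ev q = ev p"
      using frac_B[OF z] by blast
    have eq: "\<Phi> z * ?E q = ?E p" using rel_eq[OF rel pq(1,2,4)] .
    have EB: "fps_nth (?E p) i \<in> B" "fps_nth (?E q) i \<in> B" for i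
      using ev_fps_over[OF A pq(1)] ev_fps_over[OF A pq(2)] by (auto simp: fps_over_def)
    have unit: "inverse (ev q) \<in> B" using ev_in_B[OF pq(2)] pq(3) by (rule B_inverse)
    show ?thesis
    proof (induction j rule: less_induct)
      case (less j)
      have "fps_nth (?E p) j = (\<Sum>i\<le>j. fps_nth (\<Phi> z) i * fps_nth (?E q) (j - i))"
        unfolding eq[symmetric] by (simp add: fps_mult_nth atLeast0AtMost)
      also have "{..j} = insert j {..<j}" by auto
      also have "(\<Sum>i\<in>\<dots>. fps_nth (\<Phi> z) i * fps_nth (?E q) (j - i)) =
          fps_nth (\<Phi> z) j * ev q + (\<Sum>i<j. fps_nth (\<Phi> z) i * fps_nth (?E q) (j - i))"
        by (simp add: E0)
      finally have "fps_nth (?E p) j - (\<Sum>i<j. fps_nth (\<Phi> z) i * fps_nth (?E q) (j - i)) = fps_nth (\<Phi> z) j * ev q"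
        by (simp only: add_diff_cancel_right')
      hence "fps_nth (\<Phi> z) j =
          (fps_nth (?E p) j - (\<Sum>i<j. fps_nth (\<Phi> z) i * fps_nth (?E q) (j - i))) * inverse (ev q)"
        by (simp only: mult.assoc right_inverse[OF not_m_nonzero[OF pq(3)]] mult_1_right)
      also have "\<dots> \<in> B"
        using EB unit less
        by (intro subring_mult[OF B] subring_diff[OF B] subring_sum[OF B]) auto
      finally show ?case .
    qed
  qed
  have "hasse_schmidt (\<lambda>j z. fps_nth (\<Phi> z) j)"
    unfolding hasse_schmidt_def using \<Phi>0 \<Phi>_add_mult \<Phi>\<iota> \<Phi>B
    by (auto simp: fps_mult_nth atLeast0AtMost)
  thus ?thesis using \<Phi>_ev by (intro exI[of _ "\<lambda>j z. fps_nth (\<Phi> z) j"]) auto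
qed

text \<open>The Jacobian rows of the equations f and of the parameters X are independent modulo m,
  so unit rows, the rows of variables, complete them to an invertible square matrix. The X and the
  added variables are the coordinates. Moving one of them by a formal parameter while the others and
  the equations stay fixed is a Hensel problem, whose solution yields the Hasse-Schmidt derivation
  in that direction.\<close>

lemma coordinates_exist:
  fixes f :: "nat \<Rightarrow> 'k mpoly" and c :: nat and X :: "nat \<Rightarrow> 'k mpoly" and r :: nat
  assumes f: "\<And>j. j < c \<Longrightarrow> f j \<in> polys_in n" "\<And>j. j < c \<Longrightarrow> ev (f j) = 0"
    and ker: "\<And>h. h \<in> polys_in n \<Longrightarrow> ev h = 0 \<Longrightarrow>
      \<exists>s q. ev s \<noteq> 0 \<and> s * h = (\<Sum>j<c. q j * f j)"
    and jac: "\<And>u. (\<And>j. j < c \<Longrightarrow> u j \<in> B) \<Longrightarrow>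
      (\<And>i. i < n \<Longrightarrow> (\<Sum>j<c. u j * ev (mpoly_deriv i (f j))) \<in> m) \<Longrightarrow> (\<forall>j<c. u j \<in> m)"
    and derivB: "\<And>p i. p \<in> polys_in n \<Longrightarrow> ev (mpoly_deriv i p) \<in> B"
    and X: "\<And>i. i < r \<Longrightarrow> X i \<in> polys_in n"
    and tangent: "\<And>i. i < r \<Longrightarrow> \<exists>e. (\<forall>l<n. e l \<in> B) \<and>
      (\<forall>j<c. (\<Sum>l<n. ev (mpoly_deriv l (f j)) * e l) \<in> m) \<and>
      (\<forall>j<r. (\<Sum>l<n. ev (mpoly_deriv l (X j)) * e l) \<in> m \<longleftrightarrow> j \<noteq> i)"
  shows "\<exists>M x D F N. r \<le> M \<and> (\<forall>i<r. x i = ev (X i)) \<and> (\<forall>i<M. x i \<in> ev ` polys_in n) \<and>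
    (\<forall>l<M. hasse_schmidt (D l)) \<and>
    (\<forall>l<M. \<forall>i<M. \<forall>j>0. D l j (x i) = (if i = l \<and> j = 1 then 1 else 0)) \<and>
    (\<forall>j<n. F j \<in> polys_in n \<and> (ev (F j) = 0 \<or> (\<exists>i<M. ev (F j) = x i))) \<and>
    (\<forall>l<n. \<forall>i<n. (\<Sum>j<n. N l j * ev (mpoly_deriv i (F j))) = (if l = i then 1 else 0))"
proof -
  define V where "V j i = ev (mpoly_deriv i (if j < c then f j else X (j - c)))" for j i
  have VB: "V j i \<in> B" if "j < c + r" for j i
    using that f(1) X derivB unfolding V_def by auto
  have ind: "\<forall>j<c + r. u j \<in> m" if uB: "\<And>j. j < c + r \<Longrightarrow> u j \<in> B"
    and um: "\<And>i. i < n \<Longrightarrow> (\<Sum>j<c + r. u j * V j i) \<in> m" for u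
  proof -
    have sum_split: "(\<Sum>j<c + r'. g j) = (\<Sum>j<c. g j) + (\<Sum>j<r'. g (c + j))" for g :: "nat \<Rightarrow> 'f" and r'
      by (induction r') (simp_all add: add.assoc)
    have split: "(\<Sum>j<c + r. u j * V j i) =
        (\<Sum>j<c. u j * ev (mpoly_deriv i (f j))) + (\<Sum>j<r. u (c + j) * ev (mpoly_deriv i (X j)))" for i
      unfolding sum_split by (simp add: V_def)
    \<comment> \<open>Pairing with the tangent vector for \<open>X i\<close> kills, modulo m, the
      equations and the other parameters, which isolates the coefficient of
      \<open>X i\<close>.\<close>
    have ux: "u (c + i) \<in> m" if i: "i < r" for i
    proof -
      obtain e where e: "\<forall>l<n. e l \<in> B" "\<forall>j<c. (\<Sum>l<n. ev (mpoly_deriv l (f j)) * e l) \<in> m"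
        "\<forall>j<r. (\<Sum>l<n. ev (mpoly_deriv l (X j)) * e l) \<in> m \<longleftrightarrow> j \<noteq> i" using tangent[OF i] by blast
      have "(\<Sum>l<n. (\<Sum>j<c + r. u j * V j l) * e l) \<in> m"
        using um e(1) by (intro m_sum[of "{..<n}"] m_mult2) auto
      also have "(\<Sum>l<n. (\<Sum>j<c + r. u j * V j l) * e l) =
          (\<Sum>j<c. u j * (\<Sum>l<n. ev (mpoly_deriv l (f j)) * e l)) +
          (\<Sum>j<r. u (c + j) * (\<Sum>l<n. ev (mpoly_deriv l (X j)) * e l))"
        unfolding split distrib_right sum.distrib sum_distrib_right sum_distrib_left
        by (subst (1 2) sum.swap) (simp add: mult.assoc)
      finally have "(\<Sum>j<r. u (c + j) * (\<Sum>l<n. ev (mpoly_deriv l (X j)) * e l)) +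
          (\<Sum>j<c. u j * (\<Sum>l<n. ev (mpoly_deriv l (f j)) * e l)) \<in> m" by (simp add: add.commute)
      moreover have "(\<Sum>j<c. u j * (\<Sum>l<n. ev (mpoly_deriv l (f j)) * e l)) \<in> m"
        using uB e(2) by (intro m_sum[of "{..<c}"] m_mult) auto
      ultimately have "(\<Sum>j<r. u (c + j) * (\<Sum>l<n. ev (mpoly_deriv l (X j)) * e l)) \<in> m"
        using m_diff by fastforce
      moreover have "(\<Sum>j\<in>{..<r} - {i}. u (c + j) * (\<Sum>l<n. ev (mpoly_deriv l (X j)) * e l)) \<in> m"
        using uB e(3) by (intro m_sum[of "{..<r} - {i}"] m_mult) auto
      ultimately have "u (c + i) * (\<Sum>l<n. ev (mpoly_deriv l (X i)) * e l) \<in> m"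
        using i m_diff by (fastforce simp: sum.remove[of "{..<r}" i])
      moreover have "(\<Sum>l<n. ev (mpoly_deriv l (X i)) * e l) \<in> B"
        using derivB[OF X[OF i]] e(1) by (intro subring_sum[OF B] subring_mult[OF B]) auto
      moreover have "(\<Sum>l<n. ev (mpoly_deriv l (X i)) * e l) \<notin> m" using e(3) i by blast
      ultimately show ?thesis using m_prime[of _ "u (c + i)"] uB[of "c + i"] i by (simp add: mult.commute)
    qed
    have "\<forall>j<c. u j \<in> m"
    proof (rule jac)
      fix i assume "i < n"
      have "(\<Sum>j<r. u (c + j) * ev (mpoly_deriv i (X j))) \<in> m"
        using ux derivB[OF X] by (intro m_sum m_mult2) auto
      thus "(\<Sum>j<c. u j * ev (mpoly_deriv i (f j))) \<in> m"
        using um[OF \<open>i < n\<close>] m_diff unfolding split by fastforce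
    qed (use uB in auto)
    thus ?thesis using ux by (metis add_less_cancel_left le_add_diff_inverse not_less)
  qed
  have "\<exists>\<sigma> W N. inj_on \<sigma> {..<c + r} \<and> \<sigma> ` {..<c + r} \<subseteq> {..<n} \<and>
    (\<forall>j<c + r. \<forall>i<n. W (\<sigma> j) i = V j i) \<and>
    (\<forall>l<n. l \<notin> \<sigma> ` {..<c + r} \<longrightarrow> (\<exists>s<n. \<forall>i<n. W l i = (if i = s then 1 else 0))) \<and>
    (\<forall>j<n. \<forall>i<n. W j i \<in> B \<and> N i j \<in> B) \<and>
    (\<forall>j<n. \<forall>l<n. (\<Sum>i<n. W j i * N i l) = (if j = l then 1 else 0)) \<and>
    (\<forall>i<n. \<forall>l<n. (\<Sum>j<n. N i j * W j l) = (if i = l then 1 else 0))"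
  proof (rule exchange)
    show "V j i \<in> B" if "j < c + r" for j i using that by (rule VB)
    show "\<forall>j<c + r. u j \<in> m" if u: "\<And>j. j < c + r \<Longrightarrow> u j \<in> B"
      "\<And>i. i < n \<Longrightarrow> (\<Sum>j<c + r. u j * V j i) \<in> m" for u
      by (rule ind[OF u])
  qed
  then obtain \<sigma> W N where inj: "inj_on \<sigma> {..<c + r}" and \<sigma>: "\<sigma> ` {..<c + r} \<subseteq> {..<n}"
    and H: "\<forall>j<c + r. \<forall>i<n. W (\<sigma> j) i = V j i"
      "\<forall>l<n. l \<notin> \<sigma> ` {..<c + r} \<longrightarrow> (\<exists>s<n. \<forall>i<n. W l i = (if i = s then 1 else 0))"
      "\<forall>j<n. \<forall>i<n. W j i \<in> B \<and> N i j \<in> B"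
      "\<forall>j<n. \<forall>l<n. (\<Sum>i<n. W j i * N i l) = (if j = l then 1 else 0)"
      "\<forall>i<n. \<forall>l<n. (\<Sum>j<n. N i j * W j l) = (if i = l then 1 else 0)"
    by (elim exE conjE) (rule that)
  have "\<exists>P. P \<in> polys_in n \<and> (\<forall>i<n. ev (mpoly_deriv i P) = W l i) \<and>
      (\<forall>j<c + r. l = \<sigma> j \<longrightarrow> P = (if j < c then f j else X (j - c)))" if l: "l < n" for l
  proof (cases "l \<in> \<sigma> ` {..<c + r}")
    case True
    then obtain j where j: "j < c + r" "l = \<sigma> j" by blast
    have "j' = j" if "j' < c + r" "l = \<sigma> j'" for j' using inj_onD[OF inj, of j' j] that j by auto
    moreover have "(if j < c then f j else X (j - c)) \<in> polys_in n" using j f(1) X by auto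
    moreover have "ev (mpoly_deriv i (if j < c then f j else X (j - c))) = W l i" if "i < n" for i
      using H(1) j that by (simp only: V_def)
    ultimately show ?thesis by blast
  next
    case False
    then obtain s where "s < n" "\<forall>i<n. W l i = (if i = s then 1 else 0)" using H(2) l by blast
    moreover have "ev 1 = 1" "ev 0 = 0"
      using mpoly_eval_const[OF hom, of a 1] ring_homD(1)[OF hom] mpoly_eval_0[OF hom] by simp_all
    ultimately show ?thesis using False
      by (intro exI[of _ "mpoly_var s"]) (auto simp: polys_in_var mpoly_deriv_var)
  qed
  hence "\<forall>l. \<exists>P. l < n \<longrightarrow> P \<in> polys_in n \<and> (\<forall>i<n. ev (mpoly_deriv i P) = W l i) \<and>
      (\<forall>j<c + r. l = \<sigma> j \<longrightarrow> P = (if j < c then f j else X (j - c)))" by blast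
  from choice[OF this] obtain F where FF: "\<forall>l<n. F l \<in> polys_in n \<and> (\<forall>i<n. ev (mpoly_deriv i (F l)) = W l i) \<and>
      (\<forall>j<c + r. l = \<sigma> j \<longrightarrow> F l = (if j < c then f j else X (j - c)))" by blast
  have F: "\<And>l. l < n \<Longrightarrow> F l \<in> polys_in n" "\<And>l i. l < n \<Longrightarrow> i < n \<Longrightarrow> ev (mpoly_deriv i (F l)) = W l i"
    and F\<sigma>: "\<And>j. j < c + r \<Longrightarrow> \<sigma> j < n \<Longrightarrow> F (\<sigma> j) = (if j < c then f j else X (j - c))"
    using FF by blast+
  have \<sigma>n: "\<sigma> j < n" if "j < c + r" for j using \<sigma> that by auto
  define R where "R = {..<n} - \<sigma> ` {..<c + r}"
  obtain g where g: "bij_betw g {0..<card R} R" using ex_bij_betw_nat_finite[of R] by (auto simp: R_def)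
  define M where "M = r + card R"
  \<comment> \<open>Positions of the coordinates among the rows: the r divisor parameters first,
    then the rows filled up with variables.\<close>
  define h where "h i = (if i < r then \<sigma> (c + i) else g (i - r))" for i
  have gR: "g i \<in> R" if "i < card R" for i using g that by (auto simp: bij_betw_def)
  have hn: "h i < n \<and> h i \<notin> \<sigma> ` {..<c}" if "i < M" for i
  proof (cases "i < r")
    case True
    have "\<sigma> (c + i) \<noteq> \<sigma> j" if "j < c" for j
      using inj True that by (auto dest: inj_onD[of _ _ "c + i" j])
    thus ?thesis using True \<sigma>n by (auto simp: h_def)
  next
    case False
    hence "i - r < card R" using \<open>i < M\<close> by (simp add: M_def)
    thus ?thesis using gR[of "i - r"] False by (auto simp: h_def R_def)
  qed
  have h_inj: "i = i'" if ii: "i < M" "i' < M" "h i = h i'" for i i'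
  proof -
    have mix: False if "i < r" "\<not> i' < r" "i' < M" "h i = h i'" for i i'
    proof -
      have "i' - r < card R" using that by (simp add: M_def)
      hence "g (i' - r) \<notin> \<sigma> ` {..<c + r}" using gR by (auto simp: R_def)
      moreover have "\<sigma> (c + i) \<in> \<sigma> ` {..<c + r}" using that by (intro imageI) simp
      moreover have "\<sigma> (c + i) = g (i' - r)" using that by (simp add: h_def)
      ultimately show False by metis
    qed
    consider "i < r" "i' < r" | "\<not> i < r" "\<not> i' < r" | "i < r" "\<not> i' < r" | "\<not> i < r" "i' < r" by blast
    thus ?thesis
    proof cases
      case 1
      have "\<sigma> (c + i) = \<sigma> (c + i')" using ii(3) 1 by (simp add: h_def)
      hence "c + i = c + i'" by (rule inj_onD[OF inj]) (use 1 in auto)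
      thus ?thesis by simp
    next
      case 2
      have "g (i - r) = g (i' - r)" using ii(3) 2 by (simp add: h_def)
      moreover have "inj_on g {0..<card R}" using g by (simp add: bij_betw_def)
      moreover have "i - r \<in> {0..<card R}" "i' - r \<in> {0..<card R}" using ii 2 by (auto simp: M_def)
      ultimately have "i - r = i' - r" by (metis inj_onD)
      thus ?thesis using 2 by simp
    next
      case 3
      show ?thesis using mix[OF 3 ii(2,3)] by (rule FalseE)
    next
      case 4
      show ?thesis using mix[OF 4(2,1) ii(1) ii(3)[symmetric]] by (rule FalseE)
    qed
  qed
  have h_surj: "\<exists>i<M. l = h i" if l: "l < n" "l \<notin> \<sigma> ` {..<c}" for l
  proof (cases "l \<in> R")
    case True
    hence "l \<in> g ` {0..<card R}" using g by (simp add: bij_betw_def)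
    then obtain i where "i < card R" "l = g i" by auto
    thus ?thesis by (intro exI[of _ "r + i"]) (simp add: h_def M_def)
  next
    case False
    then obtain j where j: "j < c + r" "l = \<sigma> j" using l by (auto simp: R_def)
    moreover have "\<not> j < c" using j l by auto
    ultimately show ?thesis by (intro exI[of _ "j - c"]) (auto simp: h_def M_def)
  qed
  define x where "x i = ev (F (h i))" for i
  have xr: "x i = ev (X i)" if "i < r" for i
    using F\<sigma>[of "c + i"] \<sigma>n[of "c + i"] that by (simp add: x_def h_def)
  have F0: "ev (F (\<sigma> j)) = 0" if "j < c" for j using F\<sigma>[of j] \<sigma>n[of j] f(2) that by simp
  have "\<exists>D. hasse_schmidt D \<and> (\<forall>i<M. \<forall>j>0. D j (x i) = (if i = l \<and> j = 1 then 1 else 0))" if l: "l < M" for l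
  proof -
    \<comment> \<open>Target values: coordinate l moves by the formal parameter, every other F j
      keeps its value, which for an equation is 0.\<close>
    define T where "T j = fps_const (ev (F j)) + (if j = h l then fps_X else 0)" for j
    have TB: "T j \<in> fps_over B" if "j < n" for j
    proof -
      have "fps_X \<in> fps_over B" "0 \<in> fps_over B"
        using B_intros(1,2) by (auto simp: fps_over_def fps_X_def)
      thus ?thesis unfolding T_def using fps_const_over[OF B ev_in_B[OF F(1)[OF that]]]
        by (auto intro: subring_add[OF is_subring_fps_over[OF B]])
    qed
    have inv: "(\<Sum>i<n. ev (mpoly_deriv i (F j)) * N i l') = (if j = l' then 1 else 0)" if "j < n" "l' < n" for j l'
      using H(4) that F(2) by simp
    have NB: "N i j \<in> B" if "i < n" "j < n" for i j using H(3) that by blast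
    have T0: "fps_nth (T j) 0 = ev (F j)" for j by (simp add: T_def)
    obtain A where A: "\<And>i. i < n \<Longrightarrow> A i \<in> fps_over B" "\<And>i. fps_nth (A i) 0 = a i"
      "\<And>j. j < n \<Longrightarrow> ev_fps A (F j) = T j"
      using hensel[OF F(1) NB inv TB T0] by blast
    have Af: "ev_fps A (f j) = 0" if "j < c" for j
    proof -
      have "\<sigma> j \<in> \<sigma> ` {..<c}" using that by (intro imageI) simp
      hence "\<sigma> j \<noteq> h l" using hn[OF l] by metis
      thus ?thesis using A(3)[of "\<sigma> j"] \<sigma>n[of j] F0[OF that] F\<sigma>[of j] that by (simp add: T_def)
    qed
    \<comment> \<open>After multiplication by s the relation p is a combination of the f j, and the
      value of s at A cancels since its constant term is nonzero.\<close>
    have "ev_fps A p = 0" if p: "p \<in> polys_in n" "ev p = 0" for p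
    proof -
      obtain s q where sq: "ev s \<noteq> 0" "s * p = (\<Sum>j<c. q j * f j)" using ker[OF p] by blast
      have "ev_fps A s * ev_fps A p = (\<Sum>j<c. ev_fps A (q j) * ev_fps A (f j))"
        using arg_cong[OF sq(2), of "ev_fps A"] by (simp add: mpoly_eval_mult[OF hom_fps] mpoly_eval_sum[OF hom_fps])
      hence "ev_fps A s * ev_fps A p = 0" using Af by simp
      moreover have "ev_fps A s \<noteq> 0" using sq(1) ev_fps_nth_0[OF A(2), of s] by auto
      ultimately show ?thesis by simp
    qed
    from hasse_schmidt_exists[OF A(1,2) this] obtain D where D: "hasse_schmidt D"
      "\<And>h j. h \<in> polys_in n \<Longrightarrow> D j (ev h) = fps_nth (ev_fps A h) j" by blast
    have "D j (x i) = (if i = l \<and> j = 1 then 1 else 0)" if "i < M" "j > 0" for i j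
    proof -
      have "D j (x i) = fps_nth (T (h i)) j"
        using D(2)[OF F(1)] A(3) hn[OF that(1)] by (simp add: x_def)
      also have "\<dots> = (if i = l \<and> j = 1 then 1 else 0)"
        using that h_inj[OF that(1) l] by (auto simp: T_def fps_X_def)
      finally show ?thesis .
    qed
    thus ?thesis using D(1) by blast
  qed
  then obtain D where D: "\<And>l. l < M \<Longrightarrow> hasse_schmidt (D l)"
    "\<And>l i j. l < M \<Longrightarrow> i < M \<Longrightarrow> j > 0 \<Longrightarrow> D l j (x i) = (if i = l \<and> j = 1 then 1 else 0)" by metis
  have F_cases: "ev (F j) = 0 \<or> (\<exists>i<M. ev (F j) = x i)" if "j < n" for j
  proof (cases "j \<in> \<sigma> ` {..<c}")
    case True
    thus ?thesis using F0 by auto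
  next
    case False
    thus ?thesis using h_surj[OF that] by (auto simp: x_def)
  qed
  show ?thesis
  proof (intro exI conjI)
    show "r \<le> M" by (simp add: M_def)
    show "\<forall>i<r. x i = ev (X i)" using xr by blast
    show "\<forall>i<M. x i \<in> ev ` polys_in n" using F(1) hn unfolding x_def by blast
    show "\<forall>l<M. hasse_schmidt (D l)" using D(1) by blast
    show "\<forall>l<M. \<forall>i<M. \<forall>j>0. D l j (x i) = (if i = l \<and> j = 1 then 1 else 0)" using D(2) by blast
    show "\<forall>j<n. F j \<in> polys_in n \<and> (ev (F j) = 0 \<or> (\<exists>i<M. ev (F j) = x i))" using F(1) F_cases by blast
    show "\<forall>l<n. \<forall>i<n. (\<Sum>j<n. N l j * ev (mpoly_deriv i (F j))) = (if l = i then 1 else 0)"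
      using H(5) F(2) by simp
  qed
qed

end

section \<open>Localization at a prime inside the fraction field\<close>

lemma ring_hom_to_fract: "is_ring_hom (to_fract :: 'r::idom \<Rightarrow> 'r fract)"
  by (simp add: is_ring_hom_def)

lemma prime_idealD:
  assumes "prime_ideal P"
  shows "ideal P" "1 \<notin> P" "0 \<in> P" "s \<notin> P \<Longrightarrow> s \<noteq> 0"
    "s \<notin> P \<Longrightarrow> s' \<notin> P \<Longrightarrow> s * s' \<notin> P" "s \<notin> P \<Longrightarrow> s ^ k \<notin> P"
proof -
  show P: "ideal P" "1 \<notin> P" using assms by (auto simp: prime_ideal_def)
  show 0: "0 \<in> P" using ideal_0[OF P(1)] .
  show "s \<notin> P \<Longrightarrow> s \<noteq> 0" using 0 by auto
  show mult: "s \<notin> P \<Longrightarrow> s' \<notin> P \<Longrightarrow> s * s' \<notin> P" for s s' using assms by (auto simp: prime_ideal_def)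
  show "s \<notin> P \<Longrightarrow> s ^ k \<notin> P" by (induction k) (use P(2) mult in auto)
qed

lemma prime_ideal_prod:
  assumes "prime_ideal P" "\<And>i. i \<in> S \<Longrightarrow> s i \<notin> P" shows "prod s S \<notin> P"
  using assms(2)
  by (induction S rule: infinite_finite_induct) (auto simp: prime_idealD[OF assms(1)])

lemma loc_ideal_iff:
  assumes P: "prime_ideal P"
  shows "z \<in> loc_ideal P J \<longleftrightarrow> (\<exists>x\<in>J. \<exists>s. s \<notin> P \<and> z * to_fract s = to_fract x)"
proof -
  have "z = Fract x s \<longleftrightarrow> z * to_fract s = to_fract x" if "s \<noteq> 0" for x s
    using that by (cases z) (auto simp: to_fract_def eq_fract)
  hence *: "(z = Fract x s) = (z * to_fract s = to_fract x)" if "s \<notin> P" for x s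
    using that prime_idealD(4)[OF P] by blast
  have "z \<in> loc_ideal P J \<longleftrightarrow> (\<exists>x s. x \<in> J \<and> s \<notin> P \<and> z = Fract x s)"
    unfolding loc_ideal_def by blast
  also have "\<dots> \<longleftrightarrow> (\<exists>x s. x \<in> J \<and> s \<notin> P \<and> z * to_fract s = to_fract x)"
    using * by (intro ex_cong1 conj_cong refl)
  finally show ?thesis by blast
qed

lemma loc_ideal_ideal:
  assumes P: "prime_ideal P" and J: "ideal J"
  shows "0 \<in> loc_ideal P J" "z \<in> loc_ideal P J \<Longrightarrow> w \<in> loc_ideal P J \<Longrightarrow> z + w \<in> loc_ideal P J"
    "z \<in> loc_ideal P UNIV \<Longrightarrow> w \<in> loc_ideal P J \<Longrightarrow> z * w \<in> loc_ideal P J"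
    "x \<in> J \<Longrightarrow> to_fract x \<in> loc_ideal P J"
proof -
  note i = loc_ideal_iff[OF P]
  show *: "x \<in> J \<Longrightarrow> to_fract x \<in> loc_ideal P J" for x
    unfolding i using prime_idealD(2)[OF P] by (intro bexI[of _ x] exI[of _ 1]) auto
  show "0 \<in> loc_ideal P J" using *[OF ideal_0[OF J]] by simp
  show "z + w \<in> loc_ideal P J" if zw: "z \<in> loc_ideal P J" "w \<in> loc_ideal P J"
  proof -
    obtain x s y t where xs: "x \<in> J" "s \<notin> P" "z * to_fract s = to_fract x"
      and yt: "y \<in> J" "t \<notin> P" "w * to_fract t = to_fract y" using zw unfolding i by blast
    have "(z + w) * to_fract (s * t) = to_fract (x * t + y * s)"
      by (simp add: xs(3)[symmetric] yt(3)[symmetric] algebra_simps)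
    moreover have "x * t + y * s \<in> J" using xs yt by (intro ideal_add[OF J] ideal_mult2[OF J])
    moreover have "s * t \<notin> P" using xs yt prime_idealD(5)[OF P] by blast
    ultimately show ?thesis unfolding i by blast
  qed
  show "z * w \<in> loc_ideal P J" if zw: "z \<in> loc_ideal P UNIV" "w \<in> loc_ideal P J"
  proof -
    obtain x s y t where xs: "s \<notin> P" "z * to_fract s = to_fract x"
      and yt: "y \<in> J" "t \<notin> P" "w * to_fract t = to_fract y" using zw unfolding i by blast
    have "(z * w) * to_fract (s * t) = to_fract (x * y)"
      by (simp add: xs(2)[symmetric] yt(3)[symmetric] algebra_simps)
    moreover have "x * y \<in> J" using yt by (intro ideal_mult[OF J])
    moreover have "s * t \<notin> P" using xs yt prime_idealD(5)[OF P] by blast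
    ultimately show ?thesis unfolding i by blast
  qed
qed

lemma to_fract_in_maximal:
  assumes P: "prime_ideal P" shows "to_fract x \<in> loc_ideal P P \<longleftrightarrow> x \<in> P"
proof
  assume "to_fract x \<in> loc_ideal P P"
  then obtain y s where ys: "y \<in> P" "s \<notin> P" "to_fract x * to_fract s = to_fract y"
    unfolding loc_ideal_iff[OF P] by blast
  hence "x * s = y" by (simp flip: to_fract_mult)
  thus "x \<in> P" using ys P by (auto simp: prime_ideal_def)
qed (rule loc_ideal_ideal(4)[OF P prime_idealD(1)[OF P]])

lemma local_subring_loc_ideal:
  assumes P: "prime_ideal P" shows "local_subring (loc_ideal P UNIV) (loc_ideal P P)"
proof
  note i = loc_ideal_iff[OF P]
  note U = loc_ideal_ideal[OF P ideal_UNIV] and PP = loc_ideal_ideal[OF P prime_idealD(1)[OF P]]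
  show "is_subring (loc_ideal P UNIV)"
    unfolding is_subring_def
  proof (intro conjI ballI)
    show one: "1 \<in> loc_ideal P UNIV" using U(4)[of 1] by simp
    fix z w assume zw: "z \<in> loc_ideal P UNIV" "w \<in> loc_ideal P UNIV"
    show "z * w \<in> loc_ideal P UNIV" using U(3) zw .
    have "to_fract (- 1) * w \<in> loc_ideal P UNIV" using U(3)[OF U(4)] zw(2) by blast
    thus "z - w \<in> loc_ideal P UNIV" using U(2)[OF zw(1), of "- w"] by simp
  qed
  show "loc_ideal P P \<subseteq> loc_ideal P UNIV" by (auto simp: loc_ideal_def)
  show "1 \<notin> loc_ideal P P" using to_fract_in_maximal[OF P, of 1] prime_idealD(2)[OF P] by simp
  show "inverse z \<in> loc_ideal P UNIV" if z: "z \<in> loc_ideal P UNIV" "z \<notin> loc_ideal P P" for z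
  proof -
    obtain x s where xs: "s \<notin> P" "z * to_fract s = to_fract x" using z(1) unfolding i by blast
    hence "x \<notin> P" using z(2) unfolding i by blast
    moreover have "z \<noteq> 0" using z(2) PP(1) by auto
    hence "inverse z * to_fract x = to_fract s" using xs(2) by (simp flip: xs(2))
    ultimately show ?thesis unfolding i by blast
  qed
qed (use loc_ideal_ideal[OF P prime_idealD(1)[OF P]] in auto)

section \<open>Operators on localized algebras of finite type\<close>

locale finite_type =
  fixes \<kappa> :: "'k::field \<Rightarrow> 'a::idom" and n :: nat and a :: "nat \<Rightarrow> 'a"
    and \<phi> :: "'a \<Rightarrow> 'r::idom" and S :: "'a set"
  assumes \<kappa>: "is_ring_hom \<kappa>" and gen: "alg_generators \<kappa> n a" and loc: "is_localization \<phi> S"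
begin

abbreviation \<iota> :: "'k \<Rightarrow> 'r" where "\<iota> \<equiv> \<phi> \<circ> \<kappa>"
abbreviation evA :: "'k mpoly \<Rightarrow> 'a" where "evA \<equiv> mpoly_eval \<kappa> a"
abbreviation evK :: "'k mpoly \<Rightarrow> 'r fract" where "evK \<equiv> mpoly_eval (to_fract \<circ> \<iota>) (to_fract \<circ> (\<phi> \<circ> a))"

lemma \<phi>: "is_ring_hom \<phi>" and \<phi>_unit: "s \<in> S \<Longrightarrow> \<phi> s dvd 1"
  and \<phi>_frac: "\<exists>x. \<exists>s\<in>S. r * \<phi> s = \<phi> x"
  using loc by (auto simp: is_localization_def)

lemma \<iota>: "is_ring_hom \<iota>"
  using \<phi> \<kappa> by (rule ring_hom_comp)

lemma \<phi>_inj: assumes "\<phi> x = 0" shows "x = 0"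
proof -
  obtain s where s: "s \<in> S" "s * x = 0" using loc assms unfolding is_localization_def by blast
  have "s \<noteq> 0" using \<phi>_unit[OF s(1)] ring_hom_0[OF \<phi>] by auto
  thus ?thesis using s by simp
qed

lemma evK: "evK p = to_fract (\<phi> (evA p))"
  by (simp add: mpoly_eval_hom[OF \<phi>] mpoly_eval_hom[OF ring_hom_to_fract] comp_assoc)

lemma evA_surj: "\<exists>p\<in>polys_in n. x = evA p"
  using gen unfolding alg_generators_def by blast

lemma algebra_induct:
  assumes "1 \<in> V" "\<And>x y. x \<in> V \<Longrightarrow> y \<in> V \<Longrightarrow> x + y \<in> V" "\<And>c x. x \<in> V \<Longrightarrow> \<kappa> c * x \<in> V"
    "\<And>i x. i < n \<Longrightarrow> x \<in> V \<Longrightarrow> a i * x \<in> V"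
  shows "x \<in> V"
proof -
  have "evA p \<in> V" if "p \<in> polys_in n" for p
    using that
  proof (induction p rule: polys_in_induct)
    case (const c)
    show ?case using assms(3)[OF assms(1), of c] by (simp add: mpoly_eval_const[OF \<kappa>])
  qed (use assms in \<open>simp_all add: mpoly_eval_add[OF \<kappa>] mpoly_eval_mult[OF \<kappa>] mpoly_eval_var[OF \<kappa>]\<close>)
  thus ?thesis using evA_surj[of x] by auto
qed

abbreviation K_diffop :: "nat \<Rightarrow> ('r \<Rightarrow> 'r fract) \<Rightarrow> bool" where "K_diffop \<equiv> diffop to_fract \<iota>"

text \<open>An operator on A is determined by its value at 1 and its commutators with the finitely
  many generators, which have smaller order. Finitely many denominators therefore suffice on the
  image of A, and their product also works on R.\<close>

lemma bounded_denominators: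
  assumes P: "prime_ideal P"
  shows "K_diffop t e \<Longrightarrow> (\<And>g. e g \<in> loc_ideal P UNIV) \<Longrightarrow>
    \<exists>s. s \<notin> P \<and> (\<forall>g. to_fract s * e g \<in> range to_fract)"
proof -
  interpret L: local_subring "loc_ideal P UNIV" "loc_ideal P P" by (rule local_subring_loc_ideal[OF P])
  let ?R = "range (to_fract :: 'r \<Rightarrow> 'r fract)"
  have R: "is_subring ?R" by (rule subring_range[OF ring_hom_to_fract])
  have on_A: "K_diffop t e \<Longrightarrow> (\<And>g. e g \<in> loc_ideal P UNIV) \<Longrightarrow>
      \<exists>s. s \<notin> P \<and> (\<forall>x. to_fract s * e (\<phi> x) \<in> ?R)" for t e
  proof (induction t arbitrary: e)
    case 0
    hence "to_fract 1 * e (\<phi> x) = to_fract 0" for x by simp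
    hence "\<forall>x. to_fract 1 * e (\<phi> x) \<in> ?R" by blast
    thus ?case using prime_idealD(2)[OF P] by blast
  next
    case (Suc t)
    let ?e = "\<lambda>i. commutator to_fract (\<phi> (a i)) e"
    have "\<exists>s. s \<notin> P \<and> (\<forall>x. to_fract s * ?e i (\<phi> x) \<in> ?R)" for i
    proof (rule Suc.IH)
      show "K_diffop t (?e i)" using Suc.prems(1) by (rule diffop_commutator)
      show "?e i g \<in> loc_ideal P UNIV" for g
        unfolding commutator_def
        by (intro L.B_intros Suc.prems(2) loc_ideal_ideal(4)[OF P ideal_UNIV]) auto
    qed
    hence "\<forall>i. \<exists>s. s \<notin> P \<and> (\<forall>x. to_fract s * ?e i (\<phi> x) \<in> ?R)" ..
    from choice[OF this] obtain s where ss: "\<forall>i. s i \<notin> P \<and> (\<forall>x. to_fract (s i) * ?e i (\<phi> x) \<in> ?R)" ..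
    have s: "s i \<notin> P" "to_fract (s i) * ?e i (\<phi> x) \<in> ?R" for i x using ss by blast+
    obtain s0 y where s0: "s0 \<notin> P" "e 1 * to_fract s0 = to_fract y"
      using Suc.prems(2)[of 1] unfolding loc_ideal_iff[OF P] by blast
    define q where "q = s0 * prod s {..<n}"
    have q: "q \<notin> P" unfolding q_def by (rule prime_idealD(5)[OF P s0(1) prime_ideal_prod[OF P s(1)]])
    note lin = diffop_klinear[OF Suc.prems(1)]
    have "x \<in> {x. to_fract q * e (\<phi> x) \<in> ?R}" for x
    proof (rule algebra_induct, unfold mem_Collect_eq)
      have "to_fract q * e (\<phi> 1) = to_fract (prod s {..<n} * y)"
        by (simp add: q_def ring_homD(1)[OF \<phi>] s0(2)[symmetric] algebra_simps)
      thus "to_fract q * e (\<phi> 1) \<in> ?R" by blast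
    next
      fix x y assume "to_fract q * e (\<phi> x) \<in> ?R" "to_fract q * e (\<phi> y) \<in> ?R"
      thus "to_fract q * e (\<phi> (x + y)) \<in> ?R"
        using subring_add[OF R] by (simp add: ring_homD(2)[OF \<phi>] klinearD(1)[OF lin] distrib_left)
    next
      fix c x assume "to_fract q * e (\<phi> x) \<in> ?R"
      hence "to_fract (\<iota> c) * (to_fract q * e (\<phi> x)) \<in> ?R" using subring_mult[OF R] by blast
      moreover have "e (\<phi> (\<kappa> c * x)) = to_fract (\<iota> c) * e (\<phi> x)"
        using klinearD(2)[OF lin, of c "\<phi> x"] by (simp add: ring_homD(3)[OF \<phi>])
      ultimately show "to_fract q * e (\<phi> (\<kappa> c * x)) \<in> ?R" by (simp add: mult.left_commute)
    next
      fix i x assume i: "i < n" and x: "to_fract q * e (\<phi> x) \<in> ?R"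
      have "q = s0 * prod s ({..<n} - {i}) * s i"
        unfolding q_def using i by (simp add: prod.remove[of "{..<n}" i] ac_simps)
      hence "to_fract q * ?e i (\<phi> x) = to_fract (s0 * prod s ({..<n} - {i})) * (to_fract (s i) * ?e i (\<phi> x))"
        by (simp add: mult.assoc)
      also have "\<dots> \<in> ?R" by (rule subring_mult[OF R rangeI s(2)])
      finally have 1: "to_fract q * ?e i (\<phi> x) \<in> ?R" .
      have 2: "to_fract (\<phi> (a i)) * (to_fract q * e (\<phi> x)) \<in> ?R" by (rule subring_mult[OF R rangeI x])
      have "to_fract q * e (\<phi> (a i * x)) = to_fract q * ?e i (\<phi> x) + to_fract (\<phi> (a i)) * (to_fract q * e (\<phi> x))"
        by (simp add: commutator_def ring_homD(3)[OF \<phi>] algebra_simps)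
      thus "to_fract q * e (\<phi> (a i * x)) \<in> ?R" using subring_add[OF R 1 2] by simp
    qed
    thus ?case using q by auto
  qed
  \<comment> \<open>A unit \<phi> u is moved out of e at the cost of a commutator, which has smaller
    order and inherits the denominator s.\<close>
  have extend: "K_diffop t e \<Longrightarrow> (\<And>x. to_fract s * e (\<phi> x) \<in> ?R) \<Longrightarrow> to_fract s * e g \<in> ?R" for t e g s
  proof (induction t arbitrary: e g)
    case 0
    hence "to_fract s * e g = to_fract 0" by simp
    thus ?case by blast
  next
    case (Suc t)
    obtain x u where xu: "u \<in> S" "g * \<phi> u = \<phi> x" using \<phi>_frac by blast
    obtain v where v: "\<phi> u * v = 1" using \<phi>_unit[OF xu(1)] by (auto elim: dvdE)
    have c: "to_fract s * commutator to_fract (\<phi> u) e g \<in> ?R"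
    proof (rule Suc.IH)
      show "K_diffop t (commutator to_fract (\<phi> u) e)" using Suc.prems(1) by (rule diffop_commutator)
      fix y
      have "to_fract s * commutator to_fract (\<phi> u) e (\<phi> y) =
          to_fract s * e (\<phi> (u * y)) - to_fract (\<phi> u) * (to_fract s * e (\<phi> y))"
        by (simp add: commutator_def ring_homD(3)[OF \<phi>] algebra_simps)
      thus "to_fract s * commutator to_fract (\<phi> u) e (\<phi> y) \<in> ?R"
        using subring_diff[OF R Suc.prems(2) subring_mult[OF R rangeI Suc.prems(2)]] by simp
    qed
    have "to_fract v * (to_fract s * e (\<phi> x) - to_fract s * commutator to_fract (\<phi> u) e g) \<in> ?R"
      by (rule subring_mult[OF R rangeI subring_diff[OF R Suc.prems(2) c]])
    also have "to_fract s * e (\<phi> x) - to_fract s * commutator to_fract (\<phi> u) e g = to_fract s * (to_fract (\<phi> u) * e g)"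
      by (simp add: commutator_def xu(2)[symmetric] mult.commute algebra_simps)
    also have "to_fract v * (to_fract s * (to_fract (\<phi> u) * e g)) = to_fract (\<phi> u * v) * (to_fract s * e g)"
      by simp
    finally show ?case by (simp add: v)
  qed
  show "K_diffop t e \<Longrightarrow> (\<And>g. e g \<in> loc_ideal P UNIV) \<Longrightarrow>
    \<exists>s. s \<notin> P \<and> (\<forall>g. to_fract s * e g \<in> range to_fract)"
    using on_A[of t e] extend[of t e] by blast
qed

text \<open>
  Modulo operators of order two less, \<open>y \<mapsto> [d, y]\<close> is a derivation, so it vanishes once it
  vanishes on polynomials \<open>F\<close> with invertible Jacobian matrix.
\<close>

lemma order_drop:
  assumes d: "K_diffop (Suc (Suc t)) d"
    and F: "\<And>j. j < n \<Longrightarrow> F j \<in> polys_in n"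
    and N: "\<And>l i. l < n \<Longrightarrow> i < n \<Longrightarrow> (\<Sum>j<n. N l j * evK (mpoly_deriv i (F j))) = (if l = i then 1 else 0)"
    and dF: "\<And>j. j < n \<Longrightarrow> K_diffop t (commutator to_fract (\<phi> (evA (F j))) d)"
  shows "K_diffop (Suc t) d"
proof -
  note lin = diffop_klinear[OF d]
  define A where "A y = commutator to_fract y d" for y
  have A: "K_diffop (Suc t) (A y)" for y unfolding A_def using d by (rule diffop_commutator)
  have A_mult: "A (y * z) g = to_fract y * A z g + to_fract z * A y g + commutator to_fract y (A z) g" for y z g
    by (simp add: A_def commutator_def algebra_simps)
  have der: "K_diffop t (\<lambda>g. A (\<phi> (evA p)) g - (\<Sum>i<n. evK (mpoly_deriv i p) * A (\<phi> (a i)) g))"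
    if "p \<in> polys_in n" for p
    using that
  proof (induction p rule: polys_in_induct)
    case (const c)
    have "A (\<phi> (\<kappa> c)) g = 0" for g using klinearD(2)[OF lin, of c g] by (simp add: A_def commutator_def)
    hence "(\<lambda>g. A (\<phi> (evA (Poly_Mapping.single 0 c))) g -
        (\<Sum>i<n. evK (mpoly_deriv i (Poly_Mapping.single 0 c)) * A (\<phi> (a i)) g)) = (\<lambda>g. 0)"
      by (simp add: mpoly_eval_const[OF \<kappa>] mpoly_deriv_const evK mpoly_eval_0[OF \<kappa>] ring_hom_0[OF \<phi>])
    thus ?case using diffop_zero by metis
  next
    case (add p q)
    have "A (\<phi> (evA (p + q))) g = A (\<phi> (evA p)) g + A (\<phi> (evA q)) g" for g
      by (simp add: A_def commutator_def mpoly_eval_add[OF \<kappa>] ring_homD(2)[OF \<phi>] distrib_right klinearD(1)[OF lin])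
    moreover have "(\<Sum>i<n. evK (mpoly_deriv i (p + q)) * A (\<phi> (a i)) g) =
        (\<Sum>i<n. evK (mpoly_deriv i p) * A (\<phi> (a i)) g) + (\<Sum>i<n. evK (mpoly_deriv i q) * A (\<phi> (a i)) g)" for g
      by (simp add: mpoly_deriv_add evK mpoly_eval_add[OF \<kappa>] ring_homD(2)[OF \<phi>] distrib_right sum.distrib)
    ultimately have "(\<lambda>g. A (\<phi> (evA (p + q))) g - (\<Sum>i<n. evK (mpoly_deriv i (p + q)) * A (\<phi> (a i)) g)) =
       (\<lambda>g. (A (\<phi> (evA p)) g - (\<Sum>i<n. evK (mpoly_deriv i p) * A (\<phi> (a i)) g)) +
         (A (\<phi> (evA q)) g - (\<Sum>i<n. evK (mpoly_deriv i q) * A (\<phi> (a i)) g)))"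
      by (simp only: add_diff_add)
    thus ?case using diffop_add[OF add(3,4)] by (simp only:)
  next
    case (var j p)
    let ?y = "\<phi> (a j)" and ?z = "\<phi> (evA p)"
    have "evK (mpoly_deriv i (mpoly_var j * p)) * A (\<phi> (a i)) g =
        (if i = j then to_fract ?z * A (\<phi> (a i)) g else 0) + to_fract ?y * (evK (mpoly_deriv i p) * A (\<phi> (a i)) g)" for i g
      by (simp add: mpoly_deriv_var_mult evK mpoly_eval_add[OF \<kappa>] mpoly_eval_mult[OF \<kappa>]
          mpoly_eval_var[OF \<kappa>] mpoly_eval_0[OF \<kappa>] ring_homD[OF \<phi>] ring_hom_0[OF \<phi>] distrib_right mult.assoc)
    hence s1: "(\<Sum>i<n. evK (mpoly_deriv i (mpoly_var j * p)) * A (\<phi> (a i)) g) =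
        to_fract ?z * A ?y g + to_fract ?y * (\<Sum>i<n. evK (mpoly_deriv i p) * A (\<phi> (a i)) g)" for g
      using var(1) by (simp add: sum.distrib sum_distrib_left)
    have s2: "A (\<phi> (evA (mpoly_var j * p))) g =
        to_fract ?y * A ?z g + to_fract ?z * A ?y g + commutator to_fract ?y (A ?z) g" for g
      by (simp add: mpoly_eval_mult[OF \<kappa>] mpoly_eval_var[OF \<kappa>] ring_homD[OF \<phi>] A_mult)
    have "(\<lambda>g. A (\<phi> (evA (mpoly_var j * p))) g -
        (\<Sum>i<n. evK (mpoly_deriv i (mpoly_var j * p)) * A (\<phi> (a i)) g)) =
        (\<lambda>g. to_fract ?y * (A ?z g - (\<Sum>i<n. evK (mpoly_deriv i p) * A (\<phi> (a i)) g)) + commutator to_fract ?y (A ?z) g)"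
      by (intro ext) (simp only: s1 s2 right_diff_distrib, simp add: algebra_simps)
    thus ?case using diffop_add[OF diffop_scale[OF var(3)] diffop_commutator[OF A]] by (simp only:)
  qed
  \<comment> \<open>Inverting the Jacobian matrix expresses the commutators with the generators by
    those with the F j, up to operators of smaller order.\<close>
  have Aa: "K_diffop t (A (\<phi> (a l)))" if l: "l < n" for l
  proof -
    let ?D = "\<lambda>j g. \<Sum>i<n. evK (mpoly_deriv i (F j)) * A (\<phi> (a i)) g"
    have D: "K_diffop t (?D j)" if j: "j < n" for j
      using diffop_diff[OF dF[OF j] der[OF F[OF j]]] by (simp add: A_def)
    have "A (\<phi> (a l)) g = (\<Sum>j<n. N l j * ?D j g)" for g
    proof -
      have "(\<Sum>j<n. N l j * ?D j g) = (\<Sum>i<n. (\<Sum>j<n. N l j * evK (mpoly_deriv i (F j))) * A (\<phi> (a i)) g)"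
        unfolding sum_distrib_left sum_distrib_right by (subst sum.swap) (simp add: mult.assoc)
      also have "\<dots> = (\<Sum>i<n. if i = l then A (\<phi> (a i)) g else 0)" using N[OF l] by (intro sum.cong) auto
      finally show ?thesis using l by simp
    qed
    hence "A (\<phi> (a l)) = (\<lambda>g. \<Sum>j<n. N l j * ?D j g)" by blast
    moreover have "K_diffop t (\<lambda>g. \<Sum>j<n. N l j * ?D j g)"
      by (rule diffop_sum, rule diffop_scale, rule D) simp
    ultimately show ?thesis by (simp only:)
  qed
  have A\<phi>: "K_diffop t (A (\<phi> x))" for x
  proof -
    obtain p where p: "p \<in> polys_in n" "x = evA p" using evA_surj by blast
    have "K_diffop t (\<lambda>g. \<Sum>i<n. evK (mpoly_deriv i p) * A (\<phi> (a i)) g)"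
      using Aa by (intro diffop_sum diffop_scale) auto
    from diffop_add[OF der[OF p(1)] this] show ?thesis by (simp add: p(2))
  qed
  \<comment> \<open>The quotient rule for g as the fraction \<phi> x over \<phi> u.\<close>
  have "K_diffop t (A g)" for g
  proof -
    obtain x u where xu: "u \<in> S" "g * \<phi> u = \<phi> x" using \<phi>_frac by blast
    have nz: "to_fract (\<phi> u) \<noteq> 0" using \<phi>_unit[OF xu(1)] by auto
    have "K_diffop t (\<lambda>h. inverse (to_fract (\<phi> u)) *
        (A (\<phi> x) h - (to_fract g * A (\<phi> u) h + commutator to_fract (\<phi> u) (A g) h)))"
      by (intro diffop_scale diffop_diff diffop_add A\<phi> diffop_commutator[OF A])
    moreover have "A (\<phi> x) h - (to_fract g * A (\<phi> u) h + commutator to_fract (\<phi> u) (A g) h) = to_fract (\<phi> u) * A g h" for h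
      using A_mult[of "\<phi> u" g h] xu(2) by (simp add: mult.commute)
    moreover have "inverse (to_fract (\<phi> u)) * (to_fract (\<phi> u) * A g h) = A g h" for h
      by (simp only: mult.assoc[symmetric] left_inverse[OF nz] mult_1_left)
    ultimately show ?thesis by (simp only:)
  qed
  thus ?thesis using lin unfolding A_def by simp
qed

end

section \<open>Logarithmic operators\<close>

text \<open>Commuting with an element of E lowers the order and raises the shift c by one, which is
  why a general shift is carried along. Beyond l = t, a product x y with x in E is handled as x d(y)
  plus the commutator. A condition on all powers of E is thus reduced to finitely many of
  them.\<close>

lemma diffop_ideal_powers:
  fixes E :: "'r::comm_ring_1 set"
  shows "diffop (\<lambda>x. x) \<iota> (Suc t) d \<Longrightarrow>
    (\<And>l g. l \<le> t \<Longrightarrow> g \<in> ideal_power E l \<Longrightarrow> d g \<in> ideal_power E (l + c)) \<Longrightarrow>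
    g \<in> ideal_power E l \<Longrightarrow> d g \<in> ideal_power E (l + c)"
proof (induction t arbitrary: d c g l)
  case (0 d c g l)
  have lin: "klinear (\<lambda>x. x) \<iota> d" using 0 by simp
  have "commutator (\<lambda>x. x) g d 1 = 0" using 0(1) by simp
  hence "d (g * 1) = g * d 1" by (simp add: commutator_def)
  moreover have "g * d 1 \<in> ideal_power E (l + c)" if "g \<in> ideal_power E l" "d 1 \<in> ideal_power E c" for g l
    using that
  proof (induction l arbitrary: g)
    case 0
    thus ?case by (simp add: ideal_mult[OF ideal_ideal_power])
  next
    case (Suc l)
    let ?N = "{g. g * d 1 \<in> ideal_power E (Suc l + c)}"
    have "ideal ?N"
      using ideal_0[OF ideal_ideal_power] ideal_add[OF ideal_ideal_power] ideal_mult[OF ideal_ideal_power]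
      by (intro idealI) (auto simp: distrib_right mult.assoc simp del: ideal_power.simps)
    moreover have "x * y \<in> ?N" if "x \<in> E" "y \<in> ideal_power E l" for x y
      using ideal_power_Suc_mult[OF that(1) Suc.IH[OF that(2) Suc.prems(2)]]
      by (simp add: mult.assoc del: ideal_power.simps)
    ultimately have "ideal_power E (Suc l) \<subseteq> ?N"
      unfolding ideal_power.simps(2) ideal_prod_def by (intro ideal_gen_minimal) blast
    thus ?case using Suc.prems(1) by blast
  qed
  moreover have "d 1 \<in> ideal_power E c" using 0(2)[of 0 1] by simp
  ultimately show ?case using 0(3) by simp
next
  case (Suc t)
  note lin = diffop_klinear[OF Suc.prems(1)]
  have "d g \<in> ideal_power E (l + c)" if "g \<in> ideal_power E l" for l g
    using that
  proof (induction l arbitrary: g rule: less_induct)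
    case (less l)
    show ?case
    proof (cases "l \<le> Suc t")
      case True
      thus ?thesis using Suc.prems(2) less.prems by blast
    next
      case False
      then obtain k where l: "l = Suc k" by (cases l) auto
      let ?N = "{g. \<forall>u. d (g * u) \<in> ideal_power E (l + c)}"
      have N: "ideal ?N"
      proof (rule idealI)
        show "0 \<in> ?N" by (simp add: klinear_0[OF lin] ideal_0[OF ideal_ideal_power])
        show "x + y \<in> ?N" if "x \<in> ?N" "y \<in> ?N" for x y
          using that by (simp add: distrib_right klinearD(1)[OF lin] ideal_add[OF ideal_ideal_power])
        show "z * x \<in> ?N" if "x \<in> ?N" for z x
        proof -
          have "d (x * (z * u)) \<in> ideal_power E (l + c)" for u using that by blast
          thus ?thesis by (simp add: ac_simps)
        qed
      qed
      have "x * y \<in> ?N" if x: "x \<in> E" and y: "y \<in> ideal_power E k" for x y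
      proof (intro CollectI allI)
        fix u
        have yu: "y * u \<in> ideal_power E k" using y by (rule ideal_mult2[OF ideal_ideal_power])
        have 1: "x * d (y * u) \<in> ideal_power E (Suc (k + c))"
          using less.IH[of k "y * u"] yu l by (intro ideal_power_Suc_mult[OF x]) auto
        have 2: "commutator (\<lambda>x. x) x d (y * u) \<in> ideal_power E (k + Suc c)"
        proof (rule Suc.IH[where d = "commutator (\<lambda>x. x) x d" and c = "Suc c"])
          show "diffop (\<lambda>x. x) \<iota> (Suc t) (commutator (\<lambda>x. x) x d)" using Suc.prems(1) by (rule diffop_commutator)
          show "commutator (\<lambda>x. x) x d g \<in> ideal_power E (l + Suc c)" if "l \<le> t" "g \<in> ideal_power E l" for l g
            unfolding commutator_def
          proof (rule ideal_diff[OF ideal_ideal_power])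
            have "d (x * g) \<in> ideal_power E (Suc l + c)"
              using that by (intro Suc.prems(2) ideal_power_Suc_mult[OF x]) auto
            thus "d (x * g) \<in> ideal_power E (l + Suc c)" by (simp del: ideal_power.simps)
            have "x * d g \<in> ideal_power E (Suc (l + c))"
              using that by (intro ideal_power_Suc_mult[OF x] Suc.prems(2)) auto
            thus "x * d g \<in> ideal_power E (l + Suc c)" by (simp del: ideal_power.simps)
          qed
        qed (rule yu)
        have "x * d (y * u) + commutator (\<lambda>x. x) x d (y * u) \<in> ideal_power E (l + c)"
          using 1 2 l by (intro ideal_add[OF ideal_ideal_power]) (auto simp del: ideal_power.simps)
        thus "d (x * y * u) \<in> ideal_power E (l + c)" by (simp add: commutator_def mult.assoc)
      qed
      hence "ideal_power E l \<subseteq> ?N" unfolding l ideal_power.simps(2) ideal_prod_def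
        by (intro ideal_gen_minimal N[unfolded l]) blast
      hence "g \<in> ?N" using less.prems by blast
      hence "d (g * 1) \<in> ideal_power E (l + c)" by blast
      thus ?thesis by simp
    qed
  qed
  thus ?case using Suc.prems(3) by blast
qed

lemma Diff_logI:
  assumes "is_ring_hom \<iota>" "diffop (\<lambda>x. x) \<iota> (Suc t) d"
    "\<And>l g. l \<le> t \<Longrightarrow> g \<in> ideal_power E l \<Longrightarrow> d g \<in> ideal_power E l"
  shows "d \<in> Diff_log \<iota> E t"
  using diffop_ideal_powers[OF assms(2), of E 0] assms Diff_iff[OF assms(1)]
  unfolding Diff_log_def by auto

lemma Diff_log_commutator:
  assumes "\<And>s g. g \<in> ideal_power E s \<Longrightarrow> d g \<in> ideal_power E s" "g \<in> ideal_power E s"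
  shows "commutator (\<lambda>x. x) y d g \<in> ideal_power E s"
  unfolding commutator_def
  by (rule ideal_diff[OF ideal_ideal_power assms(1)[OF ideal_mult[OF ideal_ideal_power assms(2)]]
    ideal_mult[OF ideal_ideal_power assms(1)[OF assms(2)]]])

section \<open>Logarithmic coordinates\<close>

text \<open>
  Coordinates \<open>X\<^sub>0, \<dots>, X\<^sub>M\<^sub>-\<^sub>1\<close> at the prime \<open>P\<close> with their Hasse derivatives \<open>D l j\<close>, such that \<open>E\<close>
  is generated by \<open>X\<^sub>0 \<cdots> X\<^sub>r\<^sub>-\<^sub>1\<close> at \<open>P\<close>.
\<close>

locale log_coordinates =
  fixes \<iota> :: "'k::field \<Rightarrow> 'r::idom" and P E :: "'r set" and M r :: nat and X :: "nat \<Rightarrow> 'r"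
    and D :: "nat \<Rightarrow> nat \<Rightarrow> 'r fract \<Rightarrow> 'r fract"
  assumes hom: "is_ring_hom \<iota>" and P: "prime_ideal P" and E: "ideal E"
    and noeth: "noetherian (UNIV :: 'r set)" and rM: "r \<le> M"
    and D_0: "\<And>l z. l < M \<Longrightarrow> D l 0 z = z"
    and D_add: "\<And>l j z w. l < M \<Longrightarrow> D l j (z + w) = D l j z + D l j w"
    and D_mult: "\<And>l j z w. l < M \<Longrightarrow> D l j (z * w) = (\<Sum>i\<le>j. D l i z * D l (j - i) w)"
    and D_const: "\<And>l j c. l < M \<Longrightarrow> j > 0 \<Longrightarrow> D l j (to_fract (\<iota> c)) = 0"
    and D_B: "\<And>l j z. l < M \<Longrightarrow> z \<in> loc_ideal P UNIV \<Longrightarrow> D l j z \<in> loc_ideal P UNIV"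
    and D_X: "\<And>l i j. l < M \<Longrightarrow> i < M \<Longrightarrow> j > 0 \<Longrightarrow>
      D l j (to_fract (X i)) = (if i = l \<and> j = 1 then 1 else 0)"
    and complete: "\<And>t d. diffop to_fract \<iota> (Suc (Suc t)) d \<Longrightarrow>
      (\<And>l. l < M \<Longrightarrow> diffop to_fract \<iota> t (commutator to_fract (X l) d)) \<Longrightarrow> diffop to_fract \<iota> (Suc t) d"
    and bounded: "\<And>t e. diffop to_fract \<iota> t e \<Longrightarrow> (\<And>g. e g \<in> loc_ideal P UNIV) \<Longrightarrow>
      \<exists>s. s \<notin> P \<and> (\<forall>g. to_fract s * e g \<in> range to_fract)"
    and E_loc: "loc_ideal P E = {z * to_fract (\<Prod>i<r. X i) | z. z \<in> loc_ideal P UNIV}"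
begin

abbreviation B :: "'r fract set" where "B \<equiv> loc_ideal P UNIV"
abbreviation x :: "nat \<Rightarrow> 'r fract" where "x i \<equiv> to_fract (X i)"
abbreviation K_diffop :: "nat \<Rightarrow> ('r \<Rightarrow> 'r fract) \<Rightarrow> bool" where "K_diffop \<equiv> diffop to_fract \<iota>"

sublocale local_subring "loc_ideal P UNIV" "loc_ideal P P"
  by (rule local_subring_loc_ideal[OF P])

lemma to_fract_B: "to_fract g \<in> B"
  by (rule loc_ideal_ideal(4)[OF P ideal_UNIV]) simp

lemma D_zero: "l < M \<Longrightarrow> D l j 0 = 0"
  using D_add[of l j 0 0] by (metis add_0 add_cancel_right_left)

lemma X_nonzero: "i < M \<Longrightarrow> x i \<noteq> 0"
  using D_X[of i i 1] D_zero[of i 1] by auto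

lemma D_X_mult:
  assumes "l < M" "i < M"
  shows "D l b (x i * z) = x i * D l b z + (if i = l \<and> b > 0 then D l (b - 1) z else 0)"
proof -
  have "D l b (x i * z) = (\<Sum>j\<in>{..b}. D l j (x i) * D l (b - j) z)" by (rule D_mult[OF assms(1)])
  also have "\<dots> = (\<Sum>j\<in>{..b}. (if j = 0 then x i * D l b z else 0) + (if j = 1 then (if i = l then D l (b - 1) z else 0) else 0))"
    using assms by (intro sum.cong) (auto simp: D_0 D_X)
  also have "\<dots> = x i * D l b z + (if i = l \<and> b > 0 then D l (b - 1) z else 0)"
    by (auto simp: sum.distrib)
  finally show ?thesis .
qed

subsection \<open>Divisibility\<close>

definition dvB :: "'r fract \<Rightarrow> 'r fract \<Rightarrow> bool" where
  "dvB z w \<longleftrightarrow> (\<exists>b\<in>B. w = z * b)"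

lemma dvB_add: "dvB z w \<Longrightarrow> dvB z w' \<Longrightarrow> dvB z (w + w')"
  unfolding dvB_def using B_intros(3) by (metis distrib_left)

lemma dvB_mult: "b \<in> B \<Longrightarrow> dvB z w \<Longrightarrow> dvB z (b * w)"
  unfolding dvB_def using B_intros(4) by (metis mult.left_commute)

lemma dvB_uminus: "dvB z w \<Longrightarrow> dvB z (- w)"
  unfolding dvB_def using B_intros(6) by (metis mult_minus_right)

lemma dvB_diff: "dvB z w \<Longrightarrow> dvB z w' \<Longrightarrow> dvB z (w - w')"
  using dvB_add[of z w "- w'"] dvB_uminus by simp

lemma dvB_sum: "(\<And>i. i \<in> S \<Longrightarrow> dvB z (f i)) \<Longrightarrow> dvB z (sum f S)"
proof (induction S rule: infinite_finite_induct)
  case (insert i S)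
  thus ?case using dvB_add by simp
qed (auto simp: dvB_def intro!: bexI[of _ 0] B_intros)

lemma dvB_mult_mono: "dvB z w \<Longrightarrow> dvB (u * z) (u * w)"
  unfolding dvB_def by (auto simp: mult.assoc)

lemma dvB_cancel: "u \<noteq> 0 \<Longrightarrow> dvB (u * z) (u * w) \<Longrightarrow> dvB z w"
  unfolding dvB_def by (auto simp: mult.assoc)

lemma dvB_trans: "dvB z w \<Longrightarrow> dvB w u \<Longrightarrow> dvB z u"
  unfolding dvB_def using B_intros(4) by (metis mult.assoc)

lemma dvB_1: "w \<in> B \<Longrightarrow> dvB 1 w"
  unfolding dvB_def by simp

text \<open>
  Applying the Hasse derivatives along \<open>x\<close> to \<open>x a = v b\<close> shows that \<open>v\<close> times
  \<open>h = \<Sum>\<^sub>j (-x)\<^sup>j D\<^sub>j b \<equiv> b\<close> (mod \<open>x\<close>) is divisible by high powers of \<open>x\<close>, whence \<open>h\<close> is divisible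
  by \<open>x\<close> since the chain of ideals \<open>{g. v | x\<^sup>k g}\<close> stabilizes.
\<close>

lemma X_dvB_cancel:
  assumes il: "i < M" "l < M" "i \<noteq> l" and b: "b \<in> B" and dv: "dvB (x i) (x l * b)"
  shows "dvB (x i) b"
proof -
  let ?x = "x i" and ?v = "x l"
  define J where "J k = {g :: 'r. dvB ?v (?x ^ k * to_fract g)}" for k
  have "ideal (J k)" for k
  proof (rule idealI)
    show "0 \<in> J k" by (auto simp: J_def dvB_def intro!: bexI[of _ 0] B_intros)
    show "g + h \<in> J k" if "g \<in> J k" "h \<in> J k" for g h
      using that dvB_add by (simp add: J_def distrib_left)
    show "c * g \<in> J k" if "g \<in> J k" for c g
      using dvB_mult[OF to_fract_B[of c]] that by (simp add: J_def mult.left_commute)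
  qed
  moreover have "incseq J"
  proof (rule incseq_SucI, rule subsetI)
    fix k g assume "g \<in> J k"
    thus "g \<in> J (Suc k)" using dvB_mult[OF to_fract_B[of "X i"]] by (simp add: J_def mult.assoc)
  qed
  ultimately have "\<exists>N. \<forall>k\<ge>N. J k = J N"
    by (intro noetherianD[OF noeth]) (auto simp: ideal_in_UNIV)
  then obtain N where N: "\<forall>k\<ge>N. J k = J N" by (elim exE)
  have JN: "J (Suc N) = J N" by (rule N[rule_format]) simp
  \<comment> \<open>The chain stabilizes in R; clearing a denominator of g that is a unit of B
    carries the conclusion over to B.\<close>
  have Q: "dvB ?v (?x ^ N * g)" if g: "g \<in> B" "dvB ?v (?x ^ Suc N * g)" for g
  proof -
    obtain p s where ps: "s \<notin> P" "g * to_fract s = to_fract p"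
      using g(1) unfolding loc_ideal_iff[OF P] by blast
    have "dvB ?v (to_fract s * (?x ^ Suc N * g))" by (rule dvB_mult[OF to_fract_B g(2)])
    also have "to_fract s * (?x ^ Suc N * g) = ?x ^ Suc N * to_fract p" by (simp only: ps(2)[symmetric] ac_simps)
    finally have "p \<in> J (Suc N)" unfolding J_def by blast
    hence "p \<in> J N" unfolding JN .
    hence dp: "dvB ?v (?x ^ N * to_fract p)" unfolding J_def by blast
    have "to_fract s \<notin> loc_ideal P P" using ps(1) to_fract_in_maximal[OF P] by blast
    hence "inverse (to_fract s) \<in> B" using B_inverse[OF to_fract_B] by blast
    from dvB_mult[OF this dp] have "dvB ?v (inverse (to_fract s) * (?x ^ N * to_fract p))" .
    also have "inverse (to_fract s) * (?x ^ N * to_fract p) = ?x ^ N * g"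
      using prime_idealD(4)[OF P ps(1)] by (simp add: ps(2)[symmetric])
    finally show ?thesis .
  qed
  obtain a where a: "a \<in> B" "?v * b = ?x * a" using dv unfolding dvB_def by blast
  define h where "h k = (\<Sum>j\<le>k. (- ?x) ^ j * D i j b)" for k
  have rel: "?v * D i j b = ?x * D i j a + (if j > 0 then D i (j - 1) a else 0)" for j
    using D_X_mult[OF il(1) il(2), of j b] D_X_mult[OF il(1) il(1), of j a] a(2) il(3) by simp
  \<comment> \<open>By \<open>rel\<close> the sum telescopes, and only the term with the highest
    derivative of a survives.\<close>
  have tel: "?v * h k = (- 1) ^ k * ?x ^ Suc k * D i k a" for k
  proof (induction k)
    case 0
    show ?case using rel[of 0] by (simp add: h_def)
  next
    case (Suc k)
    have "?v * h (Suc k) = ?v * h k + (- ?x) ^ Suc k * (?v * D i (Suc k) b)"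
      by (simp add: h_def algebra_simps)
    also have "\<dots> = (- 1) ^ Suc k * ?x ^ Suc (Suc k) * D i (Suc k) a"
      unfolding Suc.IH rel[of "Suc k"] by (simp add: power_minus[of ?x] algebra_simps)
    finally show ?case .
  qed
  have hb: "dvB ?x (h k - b)" for k
  proof -
    have "h k = b + (\<Sum>j\<in>{1..k}. (- ?x) ^ j * D i j b)"
    proof -
      have "{..k} = insert 0 {1..k}" by auto
      thus ?thesis by (simp add: h_def D_0[OF il(1)])
    qed
    moreover have "dvB ?x ((- ?x) ^ j * D i j b)" if jk: "j \<in> {1..k}" for j
    proof -
      obtain j' where j: "j = Suc j'" using jk by (cases j) auto
      have "(- ?x) ^ j * D i j b = ?x * (- ((- ?x) ^ j' * D i j b))" by (simp add: j)
      moreover have "- ((- ?x) ^ j' * D i j b) \<in> B"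
        using D_B[OF il(1) b] to_fract_B by (intro B_intros) auto
      ultimately show ?thesis unfolding dvB_def by blast
    qed
    ultimately show ?thesis using dvB_sum[of "{1..k}" ?x "\<lambda>j. (- ?x) ^ j * D i j b"] by simp
  qed
  define g where "g = (- 1) ^ N * D i N a"
  have gB: "g \<in> B" unfolding g_def using D_B[OF il(1) a(1)] by (intro B_intros)
  have vh: "?v * h N = ?x ^ Suc N * g" unfolding tel g_def by (simp add: ac_simps)
  have hB: "h N \<in> B" unfolding h_def using D_B[OF il(1) b] to_fract_B by (intro B_intros) auto
  have "dvB ?v (?x ^ Suc N * g)" unfolding vh[symmetric] dvB_def using hB by blast
  from Q[OF gB this] obtain g' where g': "g' \<in> B" "?x ^ N * g = ?v * g'" unfolding dvB_def by blast
  have "?v * h N = ?v * (?x * g')"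
    unfolding vh power_Suc mult.assoc g'(2) by (simp only: mult.left_commute)
  hence "h N = ?x * g'" using X_nonzero[OF il(2)] by simp
  hence "dvB ?x (h N)" unfolding dvB_def using g'(1) by blast
  from dvB_diff[OF this hb[of N]] show ?thesis by simp
qed

lemma X_power_dvB_cancel:
  assumes il: "i < M" "l < M" "i \<noteq> l"
  shows "b \<in> B \<Longrightarrow> dvB (x i ^ s) (x l * b) \<Longrightarrow> dvB (x i ^ s) b"
proof (induction s arbitrary: b)
  case 0
  thus ?case by (simp add: dvB_1)
next
  case (Suc s)
  have "dvB (x i) (x i ^ Suc s)" unfolding dvB_def using to_fract_B by (intro bexI[of _ "x i ^ s"] B_intros) auto
  hence "dvB (x i) (x l * b)" using dvB_trans Suc.prems(2) by blast
  hence "dvB (x i) b" by (rule X_dvB_cancel[OF il Suc.prems(1)])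
  then obtain b' where b': "b' \<in> B" "b = x i * b'" unfolding dvB_def by blast
  have "dvB (x i * x i ^ s) (x i * (x l * b'))" using Suc.prems(2) by (simp add: b' mult.left_commute)
  hence "dvB (x i ^ s) (x l * b')" by (rule dvB_cancel[OF X_nonzero[OF il(1)]])
  hence "dvB (x i ^ s) b'" by (rule Suc.IH[OF b'(1)])
  thus ?case unfolding b' power_Suc by (rule dvB_mult_mono)
qed

lemma X_power_power_dvB_cancel:
  assumes il: "i < M" "l < M" "i \<noteq> l"
  shows "b \<in> B \<Longrightarrow> dvB (x i ^ s) (x l ^ k * b) \<Longrightarrow> dvB (x i ^ s) b"
proof (induction k)
  case (Suc k)
  have "x l ^ k * b \<in> B" using Suc.prems(1) to_fract_B by (intro B_intros)
  thus ?case using Suc X_power_dvB_cancel[OF il, of "x l ^ k * b" s] by (simp add: mult.assoc)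
qed simp

lemma X_prod_dvB_cancel:
  assumes i: "i < M" and b: "b \<in> B"
  shows "finite L \<Longrightarrow> L \<subseteq> {..<M} - {i} \<Longrightarrow> dvB (x i ^ s) ((\<Prod>l\<in>L. x l ^ k l) * b) \<Longrightarrow> dvB (x i ^ s) b"
proof (induction L rule: finite_induct)
  case (insert l L)
  have "(\<Prod>l\<in>L. x l ^ k l) * b \<in> B" using b to_fract_B by (intro B_intros)
  hence "dvB (x i ^ s) ((\<Prod>l\<in>L. x l ^ k l) * b)"
    using insert.prems insert.hyps X_power_power_dvB_cancel[OF i, of l _ s "k l"] by (simp add: mult.assoc)
  thus ?case using insert by simp
qed simp

text \<open>By \<open>X_prod_dvB_cancel\<close>, powers of distinct coordinates are coprime, so the
  divisibilities can be combined one factor at a time.\<close>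

lemma prod_dvB:
  assumes b: "b \<in> B"
  shows "finite L \<Longrightarrow> L \<subseteq> {..<M} \<Longrightarrow> (\<And>l. l \<in> L \<Longrightarrow> dvB (x l ^ k l) b) \<Longrightarrow> dvB (\<Prod>l\<in>L. x l ^ k l) b"
proof (induction L rule: finite_induct)
  case empty
  thus ?case using b by (simp add: dvB_1)
next
  case (insert l L)
  have "dvB (\<Prod>l\<in>L. x l ^ k l) b" using insert.prems by (intro insert.IH) auto
  then obtain c where c: "c \<in> B" "b = (\<Prod>l\<in>L. x l ^ k l) * c" unfolding dvB_def by blast
  have "dvB (x l ^ k l) ((\<Prod>l\<in>L. x l ^ k l) * c)"
    unfolding c(2)[symmetric] by (rule insert.prems(2)) simp
  moreover have "l < M" "L \<subseteq> {..<M} - {l}" using insert.prems(1) insert.hyps(2) by auto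
  ultimately have "dvB (x l ^ k l) c"
    using X_prod_dvB_cancel[where i = l and L = L and k = k, OF _ c(1) insert.hyps(1)] by blast
  hence "dvB ((\<Prod>l\<in>L. x l ^ k l) * x l ^ k l) ((\<Prod>l\<in>L. x l ^ k l) * c)" by (rule dvB_mult_mono)
  thus ?case using insert.hyps by (simp add: c(2) mult.commute)
qed

subsection \<open>Logarithmic Hasse derivatives\<close>

text \<open>With this weight, the Hasse derivative along a branch preserves divisibility by the
  powers of the branch; transversal directions have weight 1.\<close>

definition w :: "nat \<Rightarrow> 'r fract" where "w l = (if l < r then x l else 1)"
definition Th :: "nat \<Rightarrow> nat \<Rightarrow> 'r fract \<Rightarrow> 'r fract" where "Th l b z = w l ^ b * D l b z"

primrec \<Theta> :: "nat \<Rightarrow> (nat \<Rightarrow> nat) \<Rightarrow> 'r fract \<Rightarrow> 'r fract" where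
  "\<Theta> 0 \<beta> z = z"
| "\<Theta> (Suc k) \<beta> z = Th k (\<beta> k) (\<Theta> k \<beta> z)"

lemma w_B: "w l \<in> B"
  by (auto simp: w_def to_fract_B B_intros)

lemma Th_add: "l < M \<Longrightarrow> Th l b (z + z') = Th l b z + Th l b z'"
  by (simp add: Th_def D_add distrib_left)

lemma Th_zero: "l < M \<Longrightarrow> Th l b 0 = 0"
  by (simp add: Th_def D_zero)

lemma Th_B: "l < M \<Longrightarrow> z \<in> B \<Longrightarrow> Th l b z \<in> B"
  unfolding Th_def using w_B by (intro B_intros D_B)

lemma Th_0: "l < M \<Longrightarrow> Th l 0 z = z"
  by (simp add: Th_def D_0)

lemma Th_mult: "l < M \<Longrightarrow> Th l b (z * z') = (\<Sum>i\<le>b. Th l i z * Th l (b - i) z')"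
  unfolding Th_def D_mult sum_distrib_left
  by (intro sum.cong refl) (simp add: ac_simps flip: power_add)

lemma Th_X_mult:
  assumes "l < M" "i < M"
  shows "Th l b (x i * z) = x i * Th l b z + (if i = l \<and> b > 0 then w i * Th l (b - 1) z else 0)"
  using D_X_mult[OF assms, of b z] by (cases b) (simp_all add: Th_def algebra_simps)

lemma Th_w_mult: "l < M \<Longrightarrow> i < M \<Longrightarrow> i \<noteq> l \<Longrightarrow> Th l b (w i * z) = w i * Th l b z"
  using Th_X_mult[of l i b z] by (auto simp: w_def)

lemma Th_linear: "l < M \<Longrightarrow> Th l b (to_fract (\<iota> c) * z) = to_fract (\<iota> c) * Th l b z"
proof -
  assume l: "l < M"
  have "D l b (to_fract (\<iota> c) * z) = (\<Sum>j\<in>{..b}. if j = 0 then to_fract (\<iota> c) * D l b z else 0)"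
    unfolding D_mult[OF l] using l by (intro sum.cong) (auto simp: D_0 D_const)
  thus ?thesis by (simp add: Th_def mult.left_commute)
qed

lemma Th_diffop: assumes l: "l < M" shows "diffop (\<lambda>x. x) (to_fract \<circ> \<iota>) (Suc b) (Th l b)"
proof (induction b rule: less_induct)
  case (less b)
  have "klinear (\<lambda>x. x) (to_fract \<circ> \<iota>) (Th l b)"
    using l by (simp add: klinear_def Th_add Th_linear)
  moreover have "diffop (\<lambda>x. x) (to_fract \<circ> \<iota>) b (commutator (\<lambda>x. x) y (Th l b))" for y
  proof -
    have "commutator (\<lambda>x. x) y (Th l b) = (\<lambda>z. \<Sum>i\<in>{1..b}. Th l i y * Th l (b - i) z)"
    proof
      fix z
      have "{..b} = insert 0 {1..b}" by auto
      thus "commutator (\<lambda>x. x) y (Th l b) z = (\<Sum>i\<in>{1..b}. Th l i y * Th l (b - i) z)"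
        using l by (simp add: commutator_def Th_mult Th_0)
    qed
    moreover have "diffop (\<lambda>x. x) (to_fract \<circ> \<iota>) b (\<lambda>z. \<Sum>i\<in>{1..b}. Th l i y * Th l (b - i) z)"
    proof (rule diffop_sum, rule diffop_scale)
      fix i assume i: "i \<in> {1..b}"
      have "diffop (\<lambda>x. x) (to_fract \<circ> \<iota>) (Suc (b - i)) (Th l (b - i))" using i by (intro less.IH) auto
      thus "diffop (\<lambda>x. x) (to_fract \<circ> \<iota>) b (Th l (b - i))"
        by (rule diffop_mono[rotated]) (use i in auto)
    qed
    ultimately show ?thesis by (simp only:)
  qed
  ultimately show ?case unfolding diffop.simps by blast
qed

lemma \<Theta>_B: "k \<le> M \<Longrightarrow> z \<in> B \<Longrightarrow> \<Theta> k \<beta> z \<in> B"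
  by (induction k) (auto intro: Th_B)

lemma \<Theta>_cong: "(\<And>i. i < k \<Longrightarrow> \<beta> i = \<gamma> i) \<Longrightarrow> \<Theta> k \<beta> z = \<Theta> k \<gamma> z"
  by (induction k) auto

lemma \<Theta>_zero: "k \<le> M \<Longrightarrow> (\<And>i. i < k \<Longrightarrow> \<beta> i = 0) \<Longrightarrow> \<Theta> k \<beta> z = z"
  by (induction k) (auto simp: Th_0)

lemma \<Theta>_diffop: "k \<le> M \<Longrightarrow> diffop (\<lambda>x. x) (to_fract \<circ> \<iota>) (Suc (\<Sum>i<k. \<beta> i)) (\<Theta> k \<beta>)"
proof (induction k)
  case 0
  have "\<Theta> 0 \<beta> = (\<lambda>x. x)" by auto
  thus ?case using diffop_ident[OF ring_hom_id] by simp
next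
  case (Suc k)
  have "diffop ((\<lambda>x. x) \<circ> (\<lambda>x. x)) (to_fract \<circ> \<iota>) (Suc (\<beta> k + (\<Sum>i<k. \<beta> i))) (Th k (\<beta> k) \<circ> \<Theta> k \<beta>)"
    using Suc Th_diffop[of k "\<beta> k"]
    by (intro diffop_comp ring_hom_id) (simp_all add: comp_def del: diffop.simps)
  moreover have "Th k (\<beta> k) \<circ> \<Theta> k \<beta> = \<Theta> (Suc k) \<beta>" by auto
  ultimately show ?case by (simp add: comp_def add.commute del: diffop.simps \<Theta>.simps)
qed

definition op :: "(nat \<Rightarrow> nat) \<Rightarrow> 'r \<Rightarrow> 'r fract" where "op \<beta> g = \<Theta> M \<beta> (to_fract g)"

lemma op_diffop: "K_diffop (Suc (\<Sum>i<M. \<beta> i)) (op \<beta>)"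
proof -
  have "diffop ((\<lambda>x. x) \<circ> to_fract) \<iota> (Suc ((\<Sum>i<M. \<beta> i) + 0)) (\<Theta> M \<beta> \<circ> to_fract)"
    by (intro diffop_comp ring_hom_id ring_hom_to_fract \<Theta>_diffop diffop_ident) simp
  moreover have "\<Theta> M \<beta> \<circ> to_fract = op \<beta>" by (auto simp: op_def)
  ultimately show ?thesis by (simp add: comp_def del: diffop.simps)
qed

lemma \<Theta>_X_mult:
  assumes "i < M"
  shows "k \<le> M \<Longrightarrow> \<Theta> k \<beta> (x i * z) = x i * \<Theta> k \<beta> z +
    (if i < k \<and> \<beta> i > 0 then w i * \<Theta> k (\<beta>(i := \<beta> i - 1)) z else 0)"
proof (induction k)
  case (Suc k)
  have k: "k < M" using Suc.prems by simp
  let ?u = "if i < k \<and> \<beta> i > 0 then w i * \<Theta> k (\<beta>(i := \<beta> i - 1)) z else 0"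
  note Th0 = Th_zero[OF k]
  have "\<Theta> (Suc k) \<beta> (x i * z) = Th k (\<beta> k) (x i * \<Theta> k \<beta> z) + Th k (\<beta> k) ?u"
    using Suc by (simp add: Th_add)
  also have "Th k (\<beta> k) ?u = (if i < k \<and> \<beta> i > 0 then w i * \<Theta> (Suc k) (\<beta>(i := \<beta> i - 1)) z else 0)"
    using Th_w_mult[OF k assms] Th0 by auto
  also have "Th k (\<beta> k) (x i * \<Theta> k \<beta> z) = x i * \<Theta> (Suc k) \<beta> z +
      (if i = k \<and> \<beta> k > 0 then w i * Th k (\<beta> k - 1) (\<Theta> k \<beta> z) else 0)"
    using Th_X_mult[OF k assms, of "\<beta> k" "\<Theta> k \<beta> z"] by simp
  also have "Th k (\<beta> k - 1) (\<Theta> k \<beta> z) = \<Theta> (Suc k) (\<beta>(k := \<beta> k - 1)) z"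
    using \<Theta>_cong[of k \<beta> "\<beta>(k := \<beta> k - 1)" z] by simp
  finally show ?case by (auto simp: less_Suc_eq simp del: \<Theta>.simps)
qed simp

text \<open>Commuting with a coordinate lowers one exponent, as differentiation does with divided
  powers. This makes iterated commutators dual to the operators \<open>op \<beta>\<close>.\<close>

lemma commutator_op:
  assumes "i < M"
  shows "commutator to_fract (X i) (op \<beta>) = (\<lambda>g. if \<beta> i > 0 then w i * op (\<beta>(i := \<beta> i - 1)) g else 0)"
  using \<Theta>_X_mult[OF assms, of M \<beta>] assms by (auto simp: commutator_def op_def)

text \<open>An additively closed N replaces the explicit sum over the decompositions of \<beta>; in
  the induction the outermost factor is absorbed by passing to the preimage of N under it.\<close>

lemma \<Theta>_leibniz:
  assumes N0: "0 \<in> N" and N_add: "\<And>z z'. z \<in> N \<Longrightarrow> z' \<in> N \<Longrightarrow> z + z' \<in> N"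
  shows "k \<le> M \<Longrightarrow> (\<And>\<gamma> \<gamma>'. (\<forall>i<k. \<gamma> i + \<gamma>' i = \<beta> i) \<Longrightarrow> \<Theta> k \<gamma> z * \<Theta> k \<gamma>' z' \<in> N) \<Longrightarrow>
    \<Theta> k \<beta> (z * z') \<in> N"
  using assms
proof (induction k arbitrary: N)
  case 0
  thus ?case by (metis \<Theta>.simps(1) less_nat_zero_code)
next
  case (Suc k)
  have k: "k < M" using Suc.prems(1) by simp
  let ?N = "{u. Th k (\<beta> k) u \<in> N}"
  have "\<Theta> k \<beta> (z * z') \<in> ?N"
  proof (rule Suc.IH)
    show "k \<le> M" using k by simp
    show "0 \<in> ?N" using Suc.prems(3) Th_zero[OF k] by simp
    show "u + u' \<in> ?N" if "u \<in> ?N" "u' \<in> ?N" for u u' using that Suc.prems(4) k by (simp add: Th_add)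
    show "\<Theta> k \<gamma> z * \<Theta> k \<gamma>' z' \<in> ?N" if g: "\<forall>i<k. \<gamma> i + \<gamma>' i = \<beta> i" for \<gamma> \<gamma>'
    proof -
      have t: "Th k i (\<Theta> k \<gamma> z) * Th k (\<beta> k - i) (\<Theta> k \<gamma>' z') \<in> N" if i: "i \<le> \<beta> k" for i
      proof -
        have "\<Theta> (Suc k) (\<gamma>(k := i)) z * \<Theta> (Suc k) (\<gamma>'(k := \<beta> k - i)) z' \<in> N"
          using g i by (intro Suc.prems(2)) (auto simp: less_Suc_eq)
        thus ?thesis
          using \<Theta>_cong[of k "\<gamma>(k := i)" \<gamma> z] \<Theta>_cong[of k "\<gamma>'(k := \<beta> k - i)" \<gamma>' z'] by simp
      qed
      have s: "(\<Sum>i\<in>S. f i) \<in> N" if "\<And>i. i \<in> S \<Longrightarrow> f i \<in> N" for f :: "nat \<Rightarrow> _" and S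
        using that by (induction S rule: infinite_finite_induct) (auto intro: Suc.prems(3,4))
      show ?thesis unfolding mem_Collect_eq Th_mult[OF k] by (rule s, rule t) simp
    qed
  qed
  thus ?case by simp
qed

subsection \<open>Expansion of logarithmic operators\<close>

text \<open>\<open>c i\<close> counts the extra powers of the i-th branch gained by commutators with
  it; c = 0 is the condition expected of a logarithmic operator.\<close>

definition log_op :: "(nat \<Rightarrow> nat) \<Rightarrow> ('r \<Rightarrow> 'r fract) \<Rightarrow> bool" where
  "log_op c d \<longleftrightarrow> (\<forall>g. d g \<in> B) \<and> (\<forall>i<r. \<forall>s g. dvB (x i ^ (s + c i)) (d (X i ^ s * g)))"

lemma log_op_commutator:
  assumes d: "log_op c d" shows "log_op (c(l := c l + 1)) (commutator to_fract (X l) d)"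
  unfolding log_op_def
proof (intro conjI allI impI)
  show "commutator to_fract (X l) d g \<in> B" for g
    using d to_fract_B unfolding commutator_def log_op_def by (auto intro!: B_intros)
next
  fix i s g assume i: "i < r"
  have dv: "dvB (x i ^ (s + c i)) (d (X i ^ s * g))" for s g using d i unfolding log_op_def by blast
  show "dvB (x i ^ (s + (c(l := c l + 1)) i)) (commutator to_fract (X l) d (X i ^ s * g))"
  proof (cases "i = l")
    case True
    have "dvB (x i ^ (Suc s + c i)) (d (X i ^ Suc s * g))" by (rule dv)
    moreover have "dvB (x i * x i ^ (s + c i)) (x i * d (X i ^ s * g))" by (rule dvB_mult_mono[OF dv])
    ultimately have "dvB (x i ^ Suc (s + c i)) (d (X i * (X i ^ s * g)) - x i * d (X i ^ s * g))"
      by (intro dvB_diff) (simp_all add: mult.assoc)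
    thus ?thesis using True by (simp add: commutator_def)
  next
    case False
    have "dvB (x i ^ (s + c i)) (d (X i ^ s * (X l * g)) - x l * d (X i ^ s * g))"
      by (intro dvB_diff dv dvB_mult to_fract_B)
    thus ?thesis using False by (simp add: commutator_def mult.left_commute)
  qed
qed

lemma \<Theta>_dvB:
  assumes i: "i < r" and z: "z \<in> B"
  shows "k \<le> M \<Longrightarrow> dvB (x i ^ s) z \<Longrightarrow> dvB (x i ^ s) (\<Theta> k \<beta> z)"
proof (induction k)
  case (Suc k)
  have k: "k < M" and iM: "i < M" using Suc.prems i rM by auto
  have Th: "dvB (x i ^ s) (Th k b (x i ^ s * u))" if u: "u \<in> B" for b s u
  proof (induction s arbitrary: b)
    case 0
    thus ?case using Th_B[OF k u] by (simp add: dvB_1)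
  next
    case (Suc s)
    have 1: "dvB (x i ^ Suc s) (x i * Th k b (x i ^ s * u))" unfolding power_Suc by (rule dvB_mult_mono[OF Suc.IH])
    have 2: "dvB (x i ^ Suc s) (w i * Th k (b - 1) (x i ^ s * u))"
      using i unfolding power_Suc w_def by (simp add: dvB_mult_mono[OF Suc.IH])
    have eq: "Th k b (x i ^ Suc s * u) = x i * Th k b (x i ^ s * u) +
        (if i = k \<and> b > 0 then w i * Th k (b - 1) (x i ^ s * u) else 0)"
      unfolding power_Suc mult.assoc by (rule Th_X_mult[OF k iM])
    show ?case
    proof (cases "i = k \<and> b > 0")
      case True
      show ?thesis unfolding eq if_P[OF True] by (rule dvB_add[OF 1 2])
    next
      case False
      show ?thesis unfolding eq if_not_P[OF False] add_0_right by (rule 1)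
    qed
  qed
  have "dvB (x i ^ s) (\<Theta> k \<beta> z)" using Suc by simp
  then obtain u where "u \<in> B" "\<Theta> k \<beta> z = x i ^ s * u" unfolding dvB_def by blast
  thus ?case using Th by simp
qed simp

lemma op_log: "log_op (\<lambda>_. 0) (op \<beta>)"
  unfolding log_op_def op_def
proof (intro conjI allI impI)
  show "\<Theta> M \<beta> (to_fract g) \<in> B" for g by (rule \<Theta>_B[OF order_refl to_fract_B])
  fix i s g assume "i < r"
  moreover have "dvB (x i ^ s) (to_fract (X i ^ s * g))"
    unfolding dvB_def using to_fract_B by (intro bexI[of _ "to_fract g"]) (auto simp: ring_hom_power[OF ring_hom_to_fract])
  ultimately have "dvB (x i ^ s) (\<Theta> M \<beta> (to_fract (X i ^ s * g)))"
    by (rule \<Theta>_dvB[OF _ to_fract_B order_refl])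
  thus "dvB (x i ^ (s + 0)) (\<Theta> M \<beta> (to_fract (X i ^ s * g)))" by (simp only: add_0_right)
qed

text \<open>For an operator of order at most |\<beta>| the result has order 0, so it is
  multiplication by an element: the symbol of the operator at \<beta>.\<close>

primrec ads :: "nat \<Rightarrow> (nat \<Rightarrow> nat) \<Rightarrow> ('r \<Rightarrow> 'r fract) \<Rightarrow> 'r \<Rightarrow> 'r fract" where
  "ads 0 \<beta> d = d"
| "ads (Suc k) \<beta> d = (commutator to_fract (X k) ^^ \<beta> k) (ads k \<beta> d)"

lemma ads_cong: "(\<And>i. i < k \<Longrightarrow> \<beta> i = \<gamma> i) \<Longrightarrow> ads k \<beta> d = ads k \<gamma> d"
  by (induction k) auto

lemma commutator_funpow:
  "commutator to_fract y ((commutator to_fract z ^^ b) d) = (commutator to_fract z ^^ b) (commutator to_fract y d)"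
  for y z :: 'r
proof (induction b)
  case (Suc b)
  thus ?case using commutator_commute[OF ring_hom_to_fract, of y z "(commutator to_fract z ^^ b) d"] by simp
qed simp

lemma ads_commutator: "ads k \<beta> (commutator to_fract y d) = commutator to_fract y (ads k \<beta> d)"
  by (induction k) (simp_all add: commutator_funpow)

lemma ads_Suc: "i < k \<Longrightarrow> ads k (\<beta>(i := Suc (\<beta> i))) d = commutator to_fract (X i) (ads k \<beta> d)"
proof (induction k)
  case (Suc k)
  show ?case
  proof (cases "i = k")
    case True
    have "ads k (\<beta>(k := Suc (\<beta> k))) d = ads k \<beta> d" by (rule ads_cong) simp
    thus ?thesis by (simp only: True ads.simps fun_upd_same funpow.simps comp_apply)
  next
    case False
    thus ?thesis using Suc by (simp add: commutator_funpow)
  qed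
qed simp

lemma ads_linear:
  "ads k \<beta> (\<lambda>g. d g - (\<Sum>\<gamma>\<in>S. c \<gamma> * e \<gamma> g)) = (\<lambda>g. ads k \<beta> d g - (\<Sum>\<gamma>\<in>S. c \<gamma> * ads k \<beta> (e \<gamma>) g))"
proof (induction k)
  case (Suc k)
  have "(commutator to_fract y ^^ b) (\<lambda>g. d g - (\<Sum>\<gamma>\<in>S. c \<gamma> * e \<gamma> g)) =
      (\<lambda>g. (commutator to_fract y ^^ b) d g - (\<Sum>\<gamma>\<in>S. c \<gamma> * (commutator to_fract y ^^ b) (e \<gamma>) g))"
    for y :: 'r and b d e
  proof (induction b)
    case (Suc b)
    have "commutator to_fract y (\<lambda>g. d g - (\<Sum>\<gamma>\<in>S. c \<gamma> * e \<gamma> g)) =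
        (\<lambda>g. commutator to_fract y d g - (\<Sum>\<gamma>\<in>S. c \<gamma> * commutator to_fract y (e \<gamma>) g))" for d e
      by (auto simp: commutator_def fun_eq_iff right_diff_distrib sum_subtractf sum_distrib_left algebra_simps)
    thus ?case by (simp add: Suc.IH)
  qed simp
  thus ?case using Suc by simp
qed simp

lemma ads_diffop: "K_diffop (n + (\<Sum>i<k. \<beta> i)) d \<Longrightarrow> K_diffop n (ads k \<beta> d)"
proof (induction k arbitrary: n)
  case (Suc k)
  have "K_diffop (n + b) e \<Longrightarrow> K_diffop n ((commutator to_fract y ^^ b) e)" for y b e
    by (induction b arbitrary: n) (auto intro!: diffop_commutator simp del: diffop.simps)
  moreover have "K_diffop (n + \<beta> k) (ads k \<beta> d)" using Suc by (simp add: ac_simps del: diffop.simps)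
  ultimately show ?case by simp
qed simp

lemma ads_log: "log_op (\<lambda>_. 0) d \<Longrightarrow> log_op (\<lambda>i. if i < k then \<beta> i else 0) (ads k \<beta> d)"
proof (induction k)
  case (Suc k)
  have *: "log_op c e \<Longrightarrow> log_op (c(k := c k + b)) ((commutator to_fract (X k) ^^ b) e)" for c e b
  proof (induction b)
    case (Suc b)
    from log_op_commutator[OF Suc.IH[OF Suc.prems], of k]
    show ?case by (simp only: fun_upd_upd fun_upd_same Suc_eq_plus1[symmetric] add_Suc_right funpow.simps comp_apply)
  qed simp
  have "(\<lambda>i. if i < k then \<beta> i else 0)(k := (if k < k then \<beta> k else 0) + \<beta> k) = (\<lambda>i. if i < Suc k then \<beta> i else 0)"
    by auto
  thus ?case using *[OF Suc.IH[OF Suc.prems], of "\<beta> k"] by simp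
qed simp

lemma commutator_funpow_op:
  assumes "i < M"
  shows "(commutator to_fract (X i) ^^ b) (\<lambda>g. c * op \<beta> g) =
    (\<lambda>g. if b \<le> \<beta> i then c * w i ^ b * op (\<beta>(i := \<beta> i - b)) g else 0)"
proof (induction b)
  case (Suc b)
  have comm: "commutator to_fract y (\<lambda>g. c * e g) = (\<lambda>g. c * commutator to_fract y e g)" for y :: 'r and c e
    by (auto simp: commutator_def algebra_simps)
  show ?case
  proof (cases "b \<le> \<beta> i")
    case True
    hence "(commutator to_fract (X i) ^^ Suc b) (\<lambda>g. c * op \<beta> g) =
        (\<lambda>g. c * w i ^ b * commutator to_fract (X i) (op (\<beta>(i := \<beta> i - b))) g)"
      using Suc by (simp add: comm)
    also have "\<dots> = (\<lambda>g. if Suc b \<le> \<beta> i then c * w i ^ Suc b * op (\<beta>(i := \<beta> i - Suc b)) g else 0)"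
      using True by (auto simp: commutator_op[OF assms] mult.assoc mult.commute)
    finally show ?thesis .
  next
    case False
    thus ?thesis using Suc by (auto simp: commutator_def)
  qed
qed simp

lemma ads_op:
  "k \<le> M \<Longrightarrow> ads k \<gamma> (op \<beta>) = (\<lambda>g. if \<forall>i<k. \<gamma> i \<le> \<beta> i
    then (\<Prod>i<k. w i ^ \<gamma> i) * op (\<lambda>i. if i < k then \<beta> i - \<gamma> i else \<beta> i) g else 0)"
proof (induction k)
  case (Suc k)
  have k: "k < M" using Suc.prems by simp
  show ?case
  proof (cases "\<forall>i<k. \<gamma> i \<le> \<beta> i")
    case True
    let ?b = "\<lambda>i. if i < k then \<beta> i - \<gamma> i else \<beta> i"
    have all: "(\<forall>i<Suc k. \<gamma> i \<le> \<beta> i) \<longleftrightarrow> \<gamma> k \<le> ?b k" using True by (auto simp: less_Suc_eq)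
    have upd: "?b(k := ?b k - \<gamma> k) = (\<lambda>i. if i < Suc k then \<beta> i - \<gamma> i else \<beta> i)" by auto
    have "ads (Suc k) \<gamma> (op \<beta>) = (commutator to_fract (X k) ^^ \<gamma> k) (\<lambda>g. (\<Prod>i<k. w i ^ \<gamma> i) * op ?b g)"
      using Suc True by simp
    also have "\<dots> = (\<lambda>g. if \<gamma> k \<le> ?b k then (\<Prod>i<k. w i ^ \<gamma> i) * w k ^ \<gamma> k * op (?b(k := ?b k - \<gamma> k)) g else 0)"
      by (rule commutator_funpow_op[OF k])
    finally show ?thesis unfolding all upd by (simp only: prod.lessThan_Suc)
  next
    case False
    have "(commutator to_fract (X k) ^^ b) (\<lambda>g. 0) = (\<lambda>g. 0)" for b
      by (induction b) (auto simp: commutator_def)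
    hence "ads (Suc k) \<gamma> (op \<beta>) = (\<lambda>g. 0)" using Suc False by simp
    moreover have "\<not> (\<forall>i<Suc k. \<gamma> i \<le> \<beta> i)" using False by (auto simp: less_Suc_eq)
    ultimately show ?thesis by (simp only: if_False)
  qed
qed (simp add: fun_eq_iff)

text \<open>Multi-indices are functions on all natural numbers; setting them to 0 from M on makes
  them unique and the set finite.\<close>

definition Ix :: "nat \<Rightarrow> (nat \<Rightarrow> nat) set" where
  "Ix t = {\<beta>. (\<forall>i. i \<ge> M \<longrightarrow> \<beta> i = 0) \<and> (\<Sum>i<M. \<beta> i) = t}"

lemma finite_Ix: "finite (Ix t)"
proof (rule finite_subset)
  show "Ix t \<subseteq> {\<beta>. \<forall>i. (i \<in> {..<M} \<longrightarrow> \<beta> i \<in> {..t}) \<and> (i \<notin> {..<M} \<longrightarrow> \<beta> i = 0)}"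
  proof
    fix \<beta> assume b: "\<beta> \<in> Ix t"
    have "\<beta> i \<le> t" if "i < M" for i
      using b member_le_sum[of i "{..<M}" \<beta>] that by (simp add: Ix_def)
    thus "\<beta> \<in> {\<beta>. \<forall>i. (i \<in> {..<M} \<longrightarrow> \<beta> i \<in> {..t}) \<and> (i \<notin> {..<M} \<longrightarrow> \<beta> i = 0)}"
      using b by (auto simp: Ix_def)
  qed
  show "finite {\<beta>. \<forall>i. (i \<in> {..<M} \<longrightarrow> \<beta> i \<in> {..t}) \<and> (i \<notin> {..<M} \<longrightarrow> \<beta> i = (0::nat))}"
    by (rule finite_set_of_finite_funs) auto
qed

text \<open>Two different indices of the same total degree cannot satisfy \<gamma> \<le> \<beta>, so
  the commutators kill the operator; for equal indices only the weight is left.\<close>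

lemma ads_op_same_order:
  assumes "\<beta> \<in> Ix t" "\<gamma> \<in> Ix t"
  shows "ads M \<gamma> (op \<beta>) g = (if \<gamma> = \<beta> then (\<Prod>i<M. w i ^ \<beta> i) * to_fract g else 0)"
proof (cases "\<gamma> = \<beta>")
  case True
  have "op (\<lambda>i. if i < M then \<beta> i - \<gamma> i else \<beta> i) g = to_fract g"
    unfolding op_def by (rule \<Theta>_zero) (auto simp: True)
  moreover have "ads M \<gamma> (op \<beta>) g = (\<Prod>i<M. w i ^ \<gamma> i) * op (\<lambda>i. if i < M then \<beta> i - \<gamma> i else \<beta> i) g"
    unfolding ads_op[OF order_refl] True by (simp only: order_refl) simp
  ultimately show ?thesis using True by (simp only: if_True simp_thms)
next
  case False
  have "\<not> (\<forall>i<M. \<gamma> i \<le> \<beta> i)"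
  proof
    assume le: "\<forall>i<M. \<gamma> i \<le> \<beta> i"
    have "\<gamma> i = \<beta> i" if "i < M" for i
    proof (rule ccontr)
      assume "\<gamma> i \<noteq> \<beta> i"
      hence "sum \<gamma> {..<M} < sum \<beta> {..<M}" using le that
        by (intro sum_strict_mono_ex1) (auto intro!: bexI[of _ i] simp: le_neq_implies_less)
      thus False using assms by (simp add: Ix_def)
    qed
    hence "\<gamma> i = \<beta> i" for i using assms by (cases "i < M") (auto simp: Ix_def)
    thus False using False by blast
  qed
  thus ?thesis using False by (simp only: ads_op[OF order_refl] if_False)
qed

text \<open>An operator whose symbol vanishes has smaller order: by induction this holds for its
  commutators with the coordinates, and \<open>complete\<close> transfers it to the
  operator.\<close>

lemma order_drop_ads:
  "K_diffop (Suc t) d \<Longrightarrow> (\<And>\<beta> g. \<beta> \<in> Ix t \<Longrightarrow> ads M \<beta> d g = 0) \<Longrightarrow> K_diffop t d"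
proof (induction t arbitrary: d)
  case 0
  have "ads k (\<lambda>_. 0) d = d" for k by (induction k) auto
  moreover have "(\<lambda>_. 0) \<in> Ix 0" by (simp add: Ix_def)
  ultimately show ?case using 0(2)[of "\<lambda>_. 0"] by simp
next
  case (Suc t)
  show ?case
  proof (rule complete[OF Suc.prems(1)])
    fix l assume l: "l < M"
    show "K_diffop t (commutator to_fract (X l) d)"
    proof (rule Suc.IH)
      show "K_diffop (Suc t) (commutator to_fract (X l) d)" using Suc.prems(1) by (rule diffop_commutator)
      fix \<beta> g assume b: "\<beta> \<in> Ix t"
      have "(\<Sum>i<M. (\<beta>(l := Suc (\<beta> l))) i) = (\<Sum>i<M. \<beta> i + (if i = l then 1 else 0))"
        by (intro sum.cong) auto
      hence "\<beta>(l := Suc (\<beta> l)) \<in> Ix (Suc t)" using b l by (auto simp: Ix_def sum.distrib)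
      from Suc.prems(2)[OF this, of g] show "ads M \<beta> (commutator to_fract (X l) d) g = 0"
        unfolding ads_commutator ads_Suc[OF l] .
    qed
  qed
qed

text \<open>
  Every logarithmic operator is a combination of the operators \<open>op \<beta>\<close> with coefficients in \<open>B\<close>;
  membership in a \<open>B\<close>-submodule \<open>N\<close> stands in for the expansion itself.
\<close>

lemma log_op_expansion:
  assumes N: "0 \<in> N" "\<And>z z'. z \<in> N \<Longrightarrow> z' \<in> N \<Longrightarrow> z + z' \<in> N" "\<And>b z. b \<in> B \<Longrightarrow> z \<in> N \<Longrightarrow> b * z \<in> N"
  shows "K_diffop t d \<Longrightarrow> log_op (\<lambda>_. 0) d \<Longrightarrow> (\<And>\<beta>. (\<Sum>i<M. \<beta> i) < t \<Longrightarrow> op \<beta> h \<in> N) \<Longrightarrow> d h \<in> N"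
proof (induction t arbitrary: d)
  case 0
  thus ?case using N(1) by simp
next
  case (Suc t)
  let ?W = "\<lambda>\<beta>. \<Prod>i<M. w i ^ \<beta> i"
  \<comment> \<open>The coefficient of \<open>op \<beta>\<close> must be the symbol divided by the
    weight. Each commutator with a branch gains one power of it, and these powers are coprime, so
    the quotient lies in B.\<close>
  have "dvB (?W \<beta>) (ads M \<beta> d 1)" for \<beta>
  proof -
    have lg: "log_op (\<lambda>i. if i < M then \<beta> i else 0) (ads M \<beta> d)" by (rule ads_log[OF Suc.prems(2)])
    have "dvB (x i ^ \<beta> i) (ads M \<beta> d 1)" if "i < r" for i
    proof -
      have "dvB (x i ^ (0 + (if i < M then \<beta> i else 0))) (ads M \<beta> d (X i ^ 0 * 1))"
        using lg that unfolding log_op_def by blast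
      thus ?thesis using that rM by simp
    qed
    hence "dvB (\<Prod>i<r. x i ^ \<beta> i) (ads M \<beta> d 1)"
      using rM lg unfolding log_op_def by (intro prod_dvB) auto
    moreover have "(\<Prod>i<r. x i ^ \<beta> i) = ?W \<beta>"
      using rM by (intro prod.mono_neutral_cong_left) (auto simp: w_def)
    ultimately show ?thesis by simp
  qed
  hence "\<forall>\<beta>. \<exists>b. b \<in> B \<and> ads M \<beta> d 1 = ?W \<beta> * b" unfolding dvB_def by blast
  from choice[OF this] obtain c where c: "\<And>\<beta>. c \<beta> \<in> B" "\<And>\<beta>. ads M \<beta> d 1 = ?W \<beta> * c \<beta>" by blast
  \<comment> \<open>Subtracting the part of order t cancels the symbols, so d' drops in order; it
    stays logarithmic because every \<open>op \<beta>\<close> is.\<close>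
  define d' where "d' g = d g - (\<Sum>\<beta>\<in>Ix t. c \<beta> * op \<beta> g)" for g
  have op_order: "K_diffop (Suc t) (op \<beta>)" if "\<beta> \<in> Ix t" for \<beta>
    using op_diffop[of \<beta>] that by (simp add: Ix_def del: diffop.simps)
  have "K_diffop (Suc t) (\<lambda>g. \<Sum>\<beta>\<in>Ix t. c \<beta> * op \<beta> g)"
    by (rule diffop_sum, rule diffop_scale, rule op_order)
  from diffop_diff[OF Suc.prems(1) this] have d'_order: "K_diffop (Suc t) d'" unfolding d'_def .
  have "ads M \<gamma> d' g = 0" if g: "\<gamma> \<in> Ix t" for \<gamma> g
  proof -
    have "K_diffop (Suc 0) (ads M \<gamma> d)"
      using Suc.prems(1) g by (intro ads_diffop) (simp add: Ix_def)
    hence "commutator to_fract g (ads M \<gamma> d) 1 = 0" by simp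
    hence ad: "ads M \<gamma> d g = to_fract g * ads M \<gamma> d 1" by (simp add: commutator_def)
    have "ads M \<gamma> d' g = ads M \<gamma> d g - (\<Sum>\<beta>\<in>Ix t. c \<beta> * ads M \<gamma> (op \<beta>) g)"
      unfolding d'_def[abs_def] ads_linear ..
    also have "(\<Sum>\<beta>\<in>Ix t. c \<beta> * ads M \<gamma> (op \<beta>) g) = (\<Sum>\<beta>\<in>Ix t. if \<beta> = \<gamma> then c \<gamma> * (?W \<gamma> * to_fract g) else 0)"
      using g by (intro sum.cong) (auto simp: ads_op_same_order)
    also have "\<dots> = c \<gamma> * (?W \<gamma> * to_fract g)" using g by (simp add: finite_Ix)
    finally show ?thesis by (simp add: ad c(2) ac_simps)
  qed
  with d'_order have d'_drop: "K_diffop t d'" by (rule order_drop_ads)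
  have lgd: "d g \<in> B" "i < r \<Longrightarrow> dvB (x i ^ s) (d (X i ^ s * g))" for i s g
    using Suc.prems(2) unfolding log_op_def by auto
  have lgo: "op \<beta> g \<in> B" "i < r \<Longrightarrow> dvB (x i ^ s) (op \<beta> (X i ^ s * g))" for i s g \<beta>
    using op_log[of \<beta>] unfolding log_op_def by auto
  have lg': "log_op (\<lambda>_. 0) d'"
    unfolding log_op_def
  proof (intro conjI allI impI)
    show "d' g \<in> B" for g unfolding d'_def
      by (rule subring_diff[OF B lgd(1) subring_sum[OF B subring_mult[OF B c(1) lgo(1)]]])
    show "dvB (x i ^ (s + 0)) (d' (X i ^ s * g))" if "i < r" for i s g
      unfolding d'_def add_0_right
      by (rule dvB_diff[OF lgd(2)[OF that] dvB_sum], rule dvB_mult[OF c(1) lgo(2)[OF that]])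
  qed
  have d'N: "d' h \<in> N" by (rule Suc.IH[OF d'_drop lg' Suc.prems(3)[OF less_SucI]])
  have "(\<Sum>\<beta>\<in>S. c \<beta> * op \<beta> h) \<in> N" if "S \<subseteq> Ix t" for S
    using finite_subset[OF that finite_Ix] that
  proof (induction S rule: finite_induct)
    case (insert \<beta> S)
    have "op \<beta> h \<in> N" using insert.prems by (intro Suc.prems(3)) (auto simp: Ix_def)
    from N(2)[OF N(3)[OF c(1) this] insert.IH] insert.prems insert.hyps show ?case by simp
  qed (simp add: N(1))
  from N(2)[OF d'N this[OF order_refl]] show ?case by (simp add: d'_def)
qed

end

section \<open>Passage between local and global logarithmic operators\<close>

lemma diffop_to_fract_iff:
  "diffop to_fract \<iota> t (\<lambda>g. to_fract (e g)) \<longleftrightarrow> diffop (\<lambda>x. x) \<iota> t (e :: 'r::idom \<Rightarrow> 'r)"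
proof (induction t arbitrary: e)
  case (Suc t)
  have "klinear to_fract \<iota> (\<lambda>g. to_fract (e g)) \<longleftrightarrow> klinear (\<lambda>x. x) \<iota> e"
    unfolding klinear_def by (simp flip: to_fract_add to_fract_mult)
  moreover have "commutator to_fract y (\<lambda>g. to_fract (e g)) = (\<lambda>g. to_fract (commutator (\<lambda>x. x) y e g))" for y
    by (simp add: commutator_def)
  ultimately show ?case using Suc by simp
qed simp

lemma Diff_log_iff:
  "is_ring_hom \<iota> \<Longrightarrow> d \<in> Diff_log \<iota> E t \<longleftrightarrow>
    diffop (\<lambda>x. x) \<iota> (Suc t) d \<and> (\<forall>s. \<forall>g\<in>ideal_power E s. d g \<in> ideal_power E s)"
  unfolding Diff_log_def using Diff_iff[of \<iota> d t] by (auto simp del: diffop.simps)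

context log_coordinates
begin

abbreviation Y :: 'r where "Y \<equiv> \<Prod>i<r. X i"

lemma dvB_times: "dvB z v \<Longrightarrow> dvB z' v' \<Longrightarrow> dvB (z * z') (v * v')"
  unfolding dvB_def using B_intros(4) by (metis mult.assoc mult.left_commute)

lemma dvB_zero: "dvB z 0"
  unfolding dvB_def using B_intros(1) by (metis mult_zero_right)

lemma dvB_unit_cancel: "s \<notin> P \<Longrightarrow> dvB z (to_fract s * v) \<Longrightarrow> dvB z v"
proof -
  assume s: "s \<notin> P" and dv: "dvB z (to_fract s * v)"
  have "to_fract s \<notin> loc_ideal P P" using s to_fract_in_maximal[OF P] by blast
  hence "inverse (to_fract s) \<in> B" using B_inverse[OF to_fract_B] by blast
  from dvB_mult[OF this dv] show ?thesis using prime_idealD(4)[OF P s] by (simp add: mult.assoc[symmetric])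
qed

lemma E_power_dvB: "g \<in> ideal_power E s \<Longrightarrow> dvB (to_fract Y ^ s) (to_fract g)"
proof (induction s arbitrary: g)
  case 0
  thus ?case by (simp add: dvB_1 to_fract_B)
next
  case (Suc s)
  let ?N = "{g. dvB (to_fract Y ^ Suc s) (to_fract g)}"
  have N: "ideal ?N"
  proof (rule idealI)
    show "0 \<in> ?N" using dvB_zero by simp
    show "g + h \<in> ?N" if "g \<in> ?N" "h \<in> ?N" for g h using that dvB_add by (simp del: power_Suc)
    show "c * g \<in> ?N" if "g \<in> ?N" for c g using that dvB_mult[OF to_fract_B[of c]] by (simp del: power_Suc)
  qed
  have "e * h \<in> ?N" if e: "e \<in> E" and h: "h \<in> ideal_power E s" for e h
  proof -
    have "to_fract e \<in> loc_ideal P E" by (rule loc_ideal_ideal(4)[OF P E e])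
    then obtain z where "z \<in> B" "to_fract e = z * to_fract Y" unfolding E_loc by blast
    hence "dvB (to_fract Y) (to_fract e)" unfolding dvB_def by (auto simp: mult.commute)
    from dvB_times[OF this Suc.IH[OF h]] show ?thesis by simp
  qed
  hence "ideal_power E (Suc s) \<subseteq> ?N"
    unfolding ideal_power.simps(2) ideal_prod_def by (intro ideal_gen_minimal N) blast
  thus ?case using Suc.prems by blast
qed

lemma E_generator: "\<exists>s. s \<notin> P \<and> s * Y \<in> E"
proof -
  have "1 * to_fract Y \<in> loc_ideal P E" unfolding E_loc using B_intros(2) by blast
  then obtain e s where "e \<in> E" "s \<notin> P" "to_fract Y * to_fract s = to_fract e"
    unfolding loc_ideal_iff[OF P] by auto
  moreover from this have "s * Y = e" by (simp flip: to_fract_mult add: mult.commute)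
  ultimately show ?thesis by blast
qed

lemma to_fract_Y: "to_fract Y = (\<Prod>i<r. x i)"
  by (rule ring_hom_prod[OF ring_hom_to_fract])

lemma Y_power_dvB: "i < r \<Longrightarrow> dvB (to_fract Y ^ s) v \<Longrightarrow> dvB (x i ^ s) v"
proof -
  assume i: "i < r" and dv: "dvB (to_fract Y ^ s) v"
  have "to_fract Y ^ s = x i ^ s * (\<Prod>j\<in>{..<r} - {i}. x j) ^ s"
    unfolding to_fract_Y using i by (simp add: prod.remove[of "{..<r}" i] power_mult_distrib)
  hence "dvB (x i ^ s) (to_fract Y ^ s)"
    unfolding dvB_def using to_fract_B by (intro bexI[of _ "(\<Prod>j\<in>{..<r} - {i}. x j) ^ s"] B_intros) auto
  thus ?thesis using dv dvB_trans by blast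
qed

text \<open>The hypothesis concerns powers of the product of all branches. To isolate one branch, X
  i ^ s g is multiplied by powers of the others so that it lands in E^s; the multiplier is pulled
  out at the cost of a commutator of smaller order and then cancelled by coprimality.\<close>

lemma log_operator_dvB:
  assumes i: "i < r"
  shows "diffop (\<lambda>x. x) \<iota> t e \<Longrightarrow> (\<And>s g. g \<in> ideal_power E s \<Longrightarrow> e g \<in> ideal_power E s) \<Longrightarrow>
    dvB (x i ^ s) (to_fract (e (X i ^ s * g)))"
proof (induction t arbitrary: e g)
  case 0
  thus ?case by (simp add: dvB_zero)
next
  case (Suc t)
  obtain s0 where s0: "s0 \<notin> P" "s0 * Y \<in> E" using E_generator by blast
  define W where "W = (\<Prod>j\<in>{..<r} - {i}. X j)"
  define u where "u = (s0 * W) ^ s"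
  let ?z = "X i ^ s * g"
  have "Y = X i * W" unfolding W_def using i by (simp add: prod.remove[of "{..<r}" i])
  hence "u * ?z = (s0 * Y) ^ s * g" by (simp add: u_def power_mult_distrib ac_simps)
  hence "u * ?z \<in> ideal_power E s"
    using ideal_mult2[OF ideal_ideal_power power_in_ideal_power[OF s0(2)]] by (simp only:)
  hence 1: "dvB (x i ^ s) (to_fract (e (u * ?z)))"
    by (intro Y_power_dvB[OF i] E_power_dvB Suc.prems(2))
  have 2: "dvB (x i ^ s) (to_fract (commutator (\<lambda>x. x) u e ?z))"
  proof (rule Suc.IH)
    show "diffop (\<lambda>x. x) \<iota> t (commutator (\<lambda>x. x) u e)" using Suc.prems(1) by (rule diffop_commutator)
    show "commutator (\<lambda>x. x) u e g \<in> ideal_power E s" if "g \<in> ideal_power E s" for s g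
      using Suc.prems(2) that by (rule Diff_log_commutator)
  qed
  have "dvB (x i ^ s) (to_fract (e (u * ?z)) - to_fract (commutator (\<lambda>x. x) u e ?z))"
    by (rule dvB_diff[OF 1 2])
  hence "dvB (x i ^ s) (to_fract (s0 ^ s) * (to_fract (W ^ s) * to_fract (e ?z)))"
    by (simp add: commutator_def u_def power_mult_distrib mult.assoc)
  hence "dvB (x i ^ s) (to_fract (W ^ s) * to_fract (e ?z))"
    by (rule dvB_unit_cancel[OF prime_idealD(6)[OF P s0(1)]])
  moreover have "to_fract (W ^ s) = (\<Prod>j\<in>{..<r} - {i}. x j ^ s)"
    by (simp add: W_def ring_hom_power[OF ring_hom_to_fract] ring_hom_prod[OF ring_hom_to_fract] prod_power_distrib)
  ultimately have "dvB (x i ^ s) ((\<Prod>j\<in>{..<r} - {i}. x j ^ s) * to_fract (e ?z))" by simp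
  thus ?case
    using i rM by (intro X_prod_dvB_cancel[where i = i and L = "{..<r} - {i}" and k = "\<lambda>_. s", OF _ to_fract_B]) auto
qed

lemma Diff_log_log_op: "d \<in> Diff_log \<iota> E t \<Longrightarrow> log_op (\<lambda>_. 0) (\<lambda>g. to_fract (d g))"
  unfolding log_op_def using log_operator_dvB[of _ "Suc t" d] to_fract_B
  by (auto simp: Diff_log_iff[OF hom] simp del: diffop.simps)

text \<open>Locally the operator sends E^l into multiples of Y^l, but the denominator must be
  uniform in the argument. For each of finitely many generators g of E^l, the operator u \<mapsto>
  Y^(-l) op(g u) has values in B and hence bounded denominators; the factor \<open>s0 ^ l\<close>
  brings Y^l into E^l.\<close>

lemma op_preserves_E:
  "\<exists>q. q \<notin> P \<and> (\<forall>g\<in>ideal_power E l. \<forall>e. to_fract e = op \<beta> g * to_fract s1 \<longrightarrow> q * e \<in> ideal_power E l)"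
proof -
  let ?El = "ideal_power E l"
  obtain s0 where s0: "s0 \<notin> P" "s0 * Y \<in> E" using E_generator by blast
  obtain G where G: "finite G" "G \<subseteq> ?El" "?El = ideal_gen G"
    using noetherian_finitely_generated[OF noeth ideal_ideal_power] by blast
  have ynz: "to_fract Y ^ l \<noteq> 0" unfolding to_fract_Y using X_nonzero rM by auto
  have "\<exists>s. s \<notin> P \<and> (\<forall>u. to_fract s * (inverse (to_fract Y ^ l) * op \<beta> (g * u)) \<in> range to_fract)" if g: "g \<in> G" for g
  proof (rule bounded)
    show "K_diffop (Suc (\<Sum>i<M. \<beta> i)) (\<lambda>u. inverse (to_fract Y ^ l) * op \<beta> (g * u))"
      by (rule diffop_scale[OF diffop_premult[OF ring_hom_to_fract op_diffop]])
    fix u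
    have "g * u \<in> ?El" using g G(2) by (intro ideal_mult2[OF ideal_ideal_power]) auto
    hence "dvB (to_fract Y ^ l) (to_fract (g * u))" by (rule E_power_dvB)
    hence "dvB (x i ^ l) (op \<beta> (g * u))" if "i < r" for i
      unfolding op_def using that by (intro \<Theta>_dvB[OF that to_fract_B order_refl] Y_power_dvB[OF that])
    hence "dvB (\<Prod>i<r. x i ^ l) (op \<beta> (g * u))"
      using rM op_log[of \<beta>] unfolding log_op_def by (intro prod_dvB) auto
    hence "dvB (to_fract Y ^ l) (op \<beta> (g * u))" unfolding to_fract_Y by (simp add: prod_power_distrib)
    then obtain b where b: "b \<in> B" "op \<beta> (g * u) = to_fract Y ^ l * b" unfolding dvB_def by blast
    have "inverse (to_fract Y ^ l) * op \<beta> (g * u) = b"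
      unfolding b(2) by (simp only: mult.assoc[symmetric] left_inverse[OF ynz] mult_1_left)
    thus "inverse (to_fract Y ^ l) * op \<beta> (g * u) \<in> B" using b(1) by simp
  qed
  hence "\<forall>g. \<exists>s. g \<in> G \<longrightarrow> s \<notin> P \<and> (\<forall>u. to_fract s * (inverse (to_fract Y ^ l) * op \<beta> (g * u)) \<in> range to_fract)"
    by blast
  from choice[OF this] obtain \<sigma> where \<sigma>: "\<And>g. g \<in> G \<Longrightarrow> \<sigma> g \<notin> P"
    "\<And>g u. g \<in> G \<Longrightarrow> to_fract (\<sigma> g) * (inverse (to_fract Y ^ l) * op \<beta> (g * u)) \<in> range to_fract" by blast
  define q where "q = (\<Prod>g\<in>G. \<sigma> g) * s0 ^ l"
  have q: "q \<notin> P" unfolding q_def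
    by (intro prime_idealD(5)[OF P] prime_ideal_prod[OF P] prime_idealD(6)[OF P] \<sigma>(1) s0(1))
  let ?V = "{g. \<exists>v\<in>?El. to_fract v = to_fract q * (op \<beta> g * to_fract s1)}"
  let ?V' = "{g. \<forall>u. g * u \<in> ?V}"
  note lin = diffop_klinear[OF op_diffop[of \<beta>]]
  have V': "ideal ?V'"
  proof (rule idealI)
    have "op \<beta> 0 = 0" by (rule klinear_0[OF lin])
    thus "0 \<in> ?V'" by (auto intro!: bexI[of _ 0] ideal_0[OF ideal_ideal_power])
    show "g + h \<in> ?V'" if gh: "g \<in> ?V'" "h \<in> ?V'" for g h
    proof (intro CollectI allI)
      fix u
      obtain v v' where v: "v \<in> ?El" "to_fract v = to_fract q * (op \<beta> (g * u) * to_fract s1)"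
        "v' \<in> ?El" "to_fract v' = to_fract q * (op \<beta> (h * u) * to_fract s1)" using gh by blast
      have "to_fract (v + v') = to_fract q * (op \<beta> ((g + h) * u) * to_fract s1)"
        by (simp add: v distrib_right klinearD(1)[OF lin] distrib_left)
      thus "\<exists>v\<in>?El. to_fract v = to_fract q * (op \<beta> ((g + h) * u) * to_fract s1)"
        using ideal_add[OF ideal_ideal_power v(1,3)] by blast
    qed
    show "c * g \<in> ?V'" if g: "g \<in> ?V'" for c g
    proof (intro CollectI allI)
      fix u
      have "g * (c * u) \<in> ?V" using g by blast
      thus "\<exists>v\<in>?El. to_fract v = to_fract q * (op \<beta> (c * g * u) * to_fract s1)" by (simp add: ac_simps)
    qed
  qed
  have "G \<subseteq> ?V'"
  proof (intro subsetI CollectI allI)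
    fix g u assume g: "g \<in> G"
    obtain w where w: "to_fract (\<sigma> g) * (inverse (to_fract Y ^ l) * op \<beta> (g * u)) = to_fract w"
      using \<sigma>(2)[OF g, of u] by blast
    have "to_fract Y ^ l * (inverse (to_fract Y ^ l) * op \<beta> (g * u)) = op \<beta> (g * u)"
      by (simp only: mult.assoc[symmetric] right_inverse[OF ynz] mult_1_left)
    hence ow: "to_fract (\<sigma> g) * op \<beta> (g * u) = to_fract Y ^ l * to_fract w"
      unfolding w[symmetric] by (simp only: mult.left_commute)
    define \<rho> where "\<rho> = prod \<sigma> (G - {g})"
    have q': "q = \<sigma> g * \<rho> * s0 ^ l" unfolding q_def \<rho>_def using g G(1) by (simp add: prod.remove)
    have "to_fract q * (op \<beta> (g * u) * to_fract s1) =
        to_fract \<rho> * to_fract (s0 ^ l) * (to_fract (\<sigma> g) * op \<beta> (g * u)) * to_fract s1"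
      unfolding q' to_fract_mult by (simp only: ac_simps)
    also have "\<dots> = to_fract (\<rho> * ((s0 * Y) ^ l * (w * s1)))"
      unfolding ow to_fract_mult power_mult_distrib ring_hom_power[OF ring_hom_to_fract] by (simp only: ac_simps)
    finally have eq: "to_fract (\<rho> * ((s0 * Y) ^ l * (w * s1))) = to_fract q * (op \<beta> (g * u) * to_fract s1)" ..
    have "\<rho> * ((s0 * Y) ^ l * (w * s1)) \<in> ?El"
      by (intro ideal_mult[OF ideal_ideal_power] ideal_mult2[OF ideal_ideal_power] power_in_ideal_power s0(2))
    thus "\<exists>v\<in>?El. to_fract v = to_fract q * (op \<beta> (g * u) * to_fract s1)" using eq by blast
  qed
  hence "?El \<subseteq> ?V'" unfolding G(3) by (rule ideal_gen_minimal[OF _ V'[unfolded G(3)]])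
  have "q * e \<in> ?El" if g: "g \<in> ?El" and e: "to_fract e = op \<beta> g * to_fract s1" for g e
  proof -
    have "g * 1 \<in> ?V" using \<open>?El \<subseteq> ?V'\<close> g by blast
    then obtain v where "v \<in> ?El" "to_fract v = to_fract q * to_fract e" unfolding e by auto
    thus ?thesis by (simp flip: to_fract_mult)
  qed
  thus ?thesis using q by blast
qed

text \<open>The factor found for E^l depends on l, but by \<open>Diff_logI\<close> only the powers
  up to the order have to be checked, and the product of those factors serves them all.\<close>

lemma op_realized:
  "\<exists>s e. s \<notin> P \<and> e \<in> Diff_log \<iota> E (\<Sum>i<M. \<beta> i) \<and> (\<forall>g. to_fract (e g) = op \<beta> g * to_fract s)"
proof -
  let ?t = "\<Sum>i<M. \<beta> i"
  have opB: "op \<beta> g \<in> B" for g using op_log[of \<beta>] unfolding log_op_def by blast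
  obtain s1 where s1: "s1 \<notin> P" "\<And>g. to_fract s1 * op \<beta> g \<in> range to_fract"
    using bounded[OF op_diffop opB] by blast
  have "\<forall>g. \<exists>e. to_fract e = op \<beta> g * to_fract s1" using s1(2) by (metis imageE mult.commute)
  from choice[OF this] obtain e1 where e1: "\<And>g. to_fract (e1 g) = op \<beta> g * to_fract s1" by blast
  have "\<forall>l. \<exists>q. q \<notin> P \<and> (\<forall>g\<in>ideal_power E l. q * e1 g \<in> ideal_power E l)"
    using op_preserves_E[of _ \<beta> s1] e1 by blast
  from choice[OF this] obtain q where q: "\<And>l. q l \<notin> P" "\<And>l g. g \<in> ideal_power E l \<Longrightarrow> q l * e1 g \<in> ideal_power E l" by blast
  define Q where "Q = prod q {..?t}"
  have Q: "Q \<notin> P" unfolding Q_def by (intro prime_ideal_prod[OF P] q(1))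
  have eq: "to_fract (Q * e1 g) = op \<beta> g * to_fract (Q * s1)" for g by (simp add: e1 ac_simps)
  have "K_diffop (Suc ?t) (\<lambda>g. to_fract (Q * s1) * op \<beta> g)" by (rule diffop_scale[OF op_diffop])
  hence "K_diffop (Suc ?t) (\<lambda>g. to_fract (Q * e1 g))" by (simp only: eq mult.commute)
  hence "diffop (\<lambda>x. x) \<iota> (Suc ?t) (\<lambda>g. Q * e1 g)" by (simp only: diffop_to_fract_iff)
  hence "(\<lambda>g. Q * e1 g) \<in> Diff_log \<iota> E ?t"
  proof (rule Diff_logI[OF hom])
    fix l g assume l: "l \<le> ?t" and g: "g \<in> ideal_power E l"
    have "Q = prod q ({..?t} - {l}) * q l" unfolding Q_def using l by (simp add: prod.remove[of "{..?t}" l] mult.commute)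
    hence "Q * e1 g = prod q ({..?t} - {l}) * (q l * e1 g)" by (simp add: mult.assoc)
    thus "Q * e1 g \<in> ideal_power E l" using ideal_mult[OF ideal_ideal_power q(2)[OF g]] by (simp only:)
  qed
  thus ?thesis using prime_idealD(5)[OF P Q s1(1)] eq by blast
qed

text \<open>At P the operator d is a combination of the \<open>op \<beta>\<close>, which obey a
  Leibniz rule. Their factors are realized by global logarithmic operators up to denominators
  outside P, and the localized ideal absorbs these.\<close>

lemma local_leibniz:
  assumes d: "d \<in> Diff_log \<iota> E t" and Q: "ideal Q"
    and prod: "\<And>i j d1 d2. i + j \<le> t \<Longrightarrow> d1 \<in> Diff_log \<iota> E i \<Longrightarrow> d2 \<in> Diff_log \<iota> E j \<Longrightarrow> d1 f * d2 g \<in> Q"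
  shows "\<exists>s. s \<notin> P \<and> d (f * g) * s \<in> Q"
proof -
  note L = loc_ideal_ideal[OF P Q]
  have "op \<beta> (f * g) \<in> loc_ideal P Q" if b: "(\<Sum>i<M. \<beta> i) < Suc t" for \<beta>
    unfolding op_def to_fract_mult
  proof (rule \<Theta>_leibniz[OF L(1) L(2) order_refl])
    fix \<gamma> \<gamma>' assume gg: "\<forall>i<M. \<gamma> i + \<gamma>' i = \<beta> i"
    have "(\<Sum>i<M. \<gamma> i) + (\<Sum>i<M. \<gamma>' i) = (\<Sum>i<M. \<beta> i)" unfolding sum.distrib[symmetric] using gg by (intro sum.cong) auto
    hence le: "(\<Sum>i<M. \<gamma> i) + (\<Sum>i<M. \<gamma>' i) \<le> t" using b by simp
    obtain s e where e: "s \<notin> P" "e \<in> Diff_log \<iota> E (\<Sum>i<M. \<gamma> i)" "\<And>g. to_fract (e g) = op \<gamma> g * to_fract s"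
      using op_realized[of \<gamma>] by blast
    obtain s' e' where e': "s' \<notin> P" "e' \<in> Diff_log \<iota> E (\<Sum>i<M. \<gamma>' i)" "\<And>g. to_fract (e' g) = op \<gamma>' g * to_fract s'"
      using op_realized[of \<gamma>'] by blast
    have "op \<gamma> f * op \<gamma>' g * to_fract (s * s') = to_fract (e f * e' g)"
      unfolding to_fract_mult e(3) e'(3) by (simp only: ac_simps)
    moreover have "e f * e' g \<in> Q" using prod[OF le e(2) e'(2)] .
    moreover have "s * s' \<notin> P" using prime_idealD(5)[OF P e(1) e'(1)] .
    ultimately show "\<Theta> M \<gamma> (to_fract f) * \<Theta> M \<gamma>' (to_fract g) \<in> loc_ideal P Q"
      unfolding loc_ideal_iff[OF P] op_def by blast
  qed
  moreover have "K_diffop (Suc t) (\<lambda>g. to_fract (d g))"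
    using d unfolding diffop_to_fract_iff Diff_log_iff[OF hom] by blast
  ultimately have "to_fract (d (f * g)) \<in> loc_ideal P Q"
    using log_op_expansion[OF L(1) L(2) L(3), of "Suc t" "\<lambda>g. to_fract (d g)" "f * g"] Diff_log_log_op[OF d] by blast
  then obtain q s where "q \<in> Q" "s \<notin> P" "to_fract (d (f * g)) * to_fract s = to_fract q"
    unfolding loc_ideal_iff[OF P] by blast
  moreover from this have "d (f * g) * s = q" by (simp flip: to_fract_mult)
  ultimately show ?thesis by blast
qed

end

section \<open>Coordinates adapted to a normal crossing divisor\<close>

context finite_type
begin

lemma \<phi>_unit_notin: "prime_ideal P \<Longrightarrow> u \<in> S \<Longrightarrow> \<phi> u \<notin> P"
proof
  assume P: "prime_ideal P" and "u \<in> S" "\<phi> u \<in> P"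
  obtain v where "1 = \<phi> u * v" using \<phi>_unit[OF \<open>u \<in> S\<close>] by (elim dvdE)
  hence "1 \<in> P" using ideal_mult2[OF prime_idealD(1)[OF P] \<open>\<phi> u \<in> P\<close>, of v] by (simp only:)
  thus False using prime_idealD(2)[OF P] by simp
qed

lemma fraction_of_algebra:
  assumes z: "z * to_fract s = to_fract g" and s: "s \<noteq> 0"
  shows "\<exists>p\<in>polys_in n. \<exists>q\<in>polys_in n. evK q \<noteq> 0 \<and> z * evK q = evK p \<and>
    (\<forall>P. prime_ideal P \<longrightarrow> s \<notin> P \<longrightarrow> \<phi> (evA q) \<notin> P)"
proof -
  obtain y u where yu: "u \<in> S" "g * \<phi> u = \<phi> y" using \<phi>_frac by blast
  obtain y' u' where yu': "u' \<in> S" "s * \<phi> u' = \<phi> y'" using \<phi>_frac by blast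
  obtain p where p: "p \<in> polys_in n" "y * u' = evA p" using evA_surj by blast
  obtain q where q: "q \<in> polys_in n" "y' * u = evA q" using evA_surj by blast
  have eq: "\<phi> (evA q) = s * (\<phi> u' * \<phi> u)"
    unfolding q(2)[symmetric] by (simp add: ring_homD(3)[OF \<phi>] yu'(2)[symmetric] mult.assoc)
  have ep: "\<phi> (evA p) = g * (\<phi> u' * \<phi> u)"
    unfolding p(2)[symmetric] by (simp add: ring_homD(3)[OF \<phi>] yu(2)[symmetric] ac_simps)
  have "\<phi> u \<noteq> 0" "\<phi> u' \<noteq> 0" using \<phi>_unit[OF yu(1)] \<phi>_unit[OF yu'(1)] by auto
  hence "evK q \<noteq> 0" unfolding evK eq using s by simp
  moreover have "z * evK q = evK p"
    unfolding evK eq ep to_fract_mult z[symmetric] by (simp only: mult.assoc)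
  moreover have "\<phi> (evA q) \<notin> P" if "prime_ideal P" "s \<notin> P" for P
    unfolding eq using that yu(1) yu'(1) by (intro prime_idealD(5) \<phi>_unit_notin)
  ultimately show ?thesis using p(1) q(1) by blast
qed

lemma algebra_point_prime:
  assumes P: "prime_ideal P"
  shows "algebra_point (loc_ideal P UNIV) (loc_ideal P P) (to_fract \<circ> \<iota>) n (to_fract \<circ> (\<phi> \<circ> a))"
proof (intro algebra_point.intro local_subring_loc_ideal[OF P] algebra_point_axioms.intro)
  show "is_ring_hom (to_fract \<circ> \<iota>)" by (rule ring_hom_comp[OF ring_hom_to_fract \<iota>])
  show "range (to_fract \<circ> \<iota>) \<subseteq> loc_ideal P UNIV" "(to_fract \<circ> (\<phi> \<circ> a)) i \<in> loc_ideal P UNIV" for i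
    using loc_ideal_ideal(4)[OF P ideal_UNIV] by auto
  show "\<exists>p\<in>polys_in n. \<exists>q\<in>polys_in n. evK q \<noteq> 0 \<and> z * evK q = evK p" for z
  proof -
    obtain g s where gs: "z = Fract g s" "s \<noteq> 0" by (cases z)
    hence "z * to_fract s = to_fract g" by (simp add: to_fract_def eq_fract)
    from fraction_of_algebra[OF this gs(2)] show ?thesis by blast
  qed
  show "\<exists>p\<in>polys_in n. \<exists>q\<in>polys_in n. evK q \<notin> loc_ideal P P \<and> z * evK q = evK p" if "z \<in> loc_ideal P UNIV" for z
  proof -
    obtain g s where gs: "s \<notin> P" "z * to_fract s = to_fract g"
      using \<open>z \<in> loc_ideal P UNIV\<close> unfolding loc_ideal_iff[OF P] by blast
    from fraction_of_algebra[OF gs(2) prime_idealD(4)[OF P gs(1)]] P gs(1)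
    show ?thesis unfolding evK to_fract_in_maximal[OF P] by blast
  qed
qed

text \<open>The coordinate of index i0 in the basis of m/m^2 given by the parameters. Coefficients
  are unique only modulo m, so \<open>lam\<close> uses one chosen representation of each
  element.\<close>

lemma residue_functional_exists:
  fixes d :: nat
  assumes P: "prime_ideal P" and reg: "regular_parameters P d x" and i0: "i0 < d"
  shows "\<exists>lam. residue_functional (loc_ideal P UNIV) (loc_ideal P P) lam \<and>
    (\<forall>j<d. \<forall>v\<in>loc_ideal P UNIV. lam (v * x j) - (if j = i0 then v else 0) \<in> loc_ideal P P)"
proof -
  let ?B = "loc_ideal P UNIV" and ?m = "loc_ideal P P"
  interpret L: local_subring ?B ?m by (rule local_subring_loc_ideal[OF P])
  have gen: "?m = {\<Sum>i<d. c i * x i | c. \<forall>i<d. c i \<in> ?B}"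
    and ind: "\<And>c. (\<forall>i<d. c i \<in> ?B) \<Longrightarrow> (\<Sum>i<d. c i * x i) \<in> loc_ideal P (ideal_power P 2) \<Longrightarrow> (\<forall>i<d. c i \<in> ?m)"
    using reg unfolding regular_parameters_def by blast+
  define rep where "rep z c \<longleftrightarrow> (\<forall>i<d. c i \<in> ?B) \<and> z = (\<Sum>i<d. c i * x i)" for z c
  have rep_ex: "\<exists>c. rep z c" if "z \<in> ?m" for z using that unfolding gen rep_def by blast
  have rep_zero: "c i \<in> ?m" if "rep 0 c" "i < d" for c i
    using ind[of c] that loc_ideal_ideal(1)[OF P ideal_ideal_power, of P 2] unfolding rep_def by auto
  have rep_add: "rep (z + z') (\<lambda>i. c i + c' i)" if "rep z c" "rep z' c'" for z z' c c'
    using that unfolding rep_def by (auto simp: distrib_right sum.distrib intro: L.B_intros)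
  have rep_mult: "rep (b * z) (\<lambda>i. b * c i)" if "rep z c" "b \<in> ?B" for z b c
    using that unfolding rep_def by (auto simp: sum_distrib_left mult.assoc intro: L.B_intros)
  have rep_unique: "c i - c' i \<in> ?m" if "rep z c" "rep z c'" "i < d" for z c c' i
  proof -
    have "rep (z + - 1 * z) (\<lambda>i. c i + - 1 * c' i)" by (intro rep_add rep_mult that L.minus_1_in_B)
    thus ?thesis using rep_zero[of "\<lambda>i. c i + - 1 * c' i" i] that(3) by simp
  qed
  define lam where "lam z = (SOME c. rep z c) i0" for z
  have lam: "lam z - c i0 \<in> ?m" if c: "rep z c" for z c
    unfolding lam_def by (rule rep_unique[OF someI[of "rep z", OF c] c i0])
  have lam_some: "\<exists>c. rep z c \<and> lam z = c i0" if "z \<in> ?m" for z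
    unfolding lam_def by (rule exI[of _ "SOME c. rep z c"]) (intro conjI refl someI_ex[OF rep_ex[OF that]])
  have "residue_functional ?B ?m lam"
  proof (intro residue_functional.intro L.local_subring_axioms residue_functional_axioms.intro)
    show "lam z \<in> ?B" if z: "z \<in> ?m" for z
    proof -
      obtain c where c: "rep z c" "lam z = c i0" using lam_some[OF z] by (elim exE conjE)
      thus ?thesis using i0 by (simp add: rep_def)
    qed
    show "lam (z + z') - (lam z + lam z') \<in> ?m" if z: "z \<in> ?m" "z' \<in> ?m" for z z'
    proof -
      obtain c c' where c: "rep z c" "lam z = c i0" "rep z' c'" "lam z' = c' i0"
        using lam_some[OF z(1)] lam_some[OF z(2)] by (elim exE conjE)
      show ?thesis using lam[OF rep_add[OF c(1,3)]] by (simp add: c)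
    qed
    show "lam (b * z) - b * lam z \<in> ?m" if z: "b \<in> ?B" "z \<in> ?m" for b z
    proof -
      obtain c where c: "rep z c" "lam z = c i0" using lam_some[OF z(2)] by (elim exE conjE)
      show ?thesis using lam[OF rep_mult[OF c(1) z(1)]] by (simp add: c)
    qed
  qed
  moreover have "lam (v * x j) - (if j = i0 then v else 0) \<in> ?m" if "j < d" "v \<in> ?B" for j v
  proof -
    have "(\<Sum>i<d. (if i = j then v else 0) * x i) = (\<Sum>i<d. if i = j then v * x i else 0)"
      by (intro sum.cong) auto
    hence "rep (v * x j) (\<lambda>i. if i = j then v else 0)"
      unfolding rep_def using that L.B_intros(1) by simp
    from lam[OF this] show ?thesis by (simp add: eq_commute)
  qed
  ultimately show ?thesis by blast
qed

text \<open>Brings coefficients from the local ring into the image of A, where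
  \<open>smooth_at\<close> states its rank condition.\<close>

lemma common_denominator:
  fixes u :: "nat \<Rightarrow> 'r fract" and c :: nat
  assumes P: "prime_ideal P" and u: "\<And>j. j < c \<Longrightarrow> u j \<in> loc_ideal P UNIV"
  shows "\<exists>w b. \<phi> w \<notin> P \<and> (\<forall>j<c. u j * to_fract (\<phi> w) = to_fract (\<phi> (b j)))"
proof -
  have "\<exists>q p. \<phi> q \<notin> P \<and> (j < c \<longrightarrow> u j * to_fract (\<phi> q) = to_fract (\<phi> p))" for j
  proof (cases "j < c")
    case True
    obtain g s where gs: "s \<notin> P" "u j * to_fract s = to_fract g"
      using u[OF True] unfolding loc_ideal_iff[OF P] by blast
    from fraction_of_algebra[OF gs(2) prime_idealD(4)[OF P gs(1)]] P gs(1)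
    show ?thesis unfolding evK by blast
  next
    case False
    have "\<phi> 1 \<notin> P" using prime_idealD(2)[OF P] by (simp add: ring_homD(1)[OF \<phi>])
    thus ?thesis using False by blast
  qed
  then obtain q p where qp: "\<And>j. \<phi> (q j) \<notin> P" "\<And>j. j < c \<Longrightarrow> u j * to_fract (\<phi> (q j)) = to_fract (\<phi> (p j))" by metis
  define w where "w = prod q {..<c}"
  have "\<phi> w \<notin> P" unfolding w_def ring_hom_prod[OF \<phi>] by (intro prime_ideal_prod[OF P] qp(1))
  moreover have "u j * to_fract (\<phi> w) = to_fract (\<phi> (p j * prod q ({..<c} - {j})))" if "j < c" for j
  proof -
    have "w = q j * prod q ({..<c} - {j})" unfolding w_def using that by (simp add: prod.remove)
    thus ?thesis by (simp add: ring_homD(3)[OF \<phi>] qp(2)[OF that, symmetric] mult.assoc)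
  qed
  ultimately show ?thesis by (intro exI[of _ w] exI[of _ "\<lambda>j. p j * prod q ({..<c} - {j})"]) blast
qed

end

lemma smooth_log_coordinates:
  fixes \<kappa> :: "'k::alg_closed_field \<Rightarrow> 'a::idom" and \<phi> :: "'a \<Rightarrow> 'r::idom"
  assumes ft: "finite_type \<kappa> n a \<phi> S"
    and smooth: "\<And>P. prime_ideal P \<Longrightarrow> smooth_at \<kappa> n a P"
    and noeth: "noetherian (UNIV :: 'r set)"
    and snc: "snc_divisor_ideal E" and P: "prime_ideal P"
  shows "\<exists>M r X D. log_coordinates (\<phi> \<circ> \<kappa>) P E M r X D"
proof -
  interpret finite_type \<kappa> n a \<phi> S by (rule ft)
  interpret AP: algebra_point "loc_ideal P UNIV" "loc_ideal P P" "to_fract \<circ> \<iota>" n "to_fract \<circ> (\<phi> \<circ> a)"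
    by (rule algebra_point_prime[OF P])
  let ?B = "loc_ideal P UNIV" and ?m = "loc_ideal P P"
  have E: "ideal E" using snc by (simp add: snc_divisor_ideal_def)
  have toB: "to_fract g \<in> ?B" for g by (rule loc_ideal_ideal(4)[OF P ideal_UNIV]) simp
  define PA where "PA = \<phi> -` P"
  have "prime_ideal PA"
    unfolding prime_ideal_def PA_def
  proof (intro conjI allI impI)
    show "ideal (\<phi> -` P)"
      using prime_idealD(1,3)[OF P] by (intro idealI) (auto simp: ring_homD[OF \<phi>] ring_hom_0[OF \<phi>] ideal_add ideal_mult)
    show "1 \<notin> \<phi> -` P" using prime_idealD(2)[OF P] by (simp add: ring_homD[OF \<phi>])
    show "x * y \<in> \<phi> -` P \<Longrightarrow> x \<in> \<phi> -` P \<or> y \<in> \<phi> -` P" for x y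
      using P by (simp add: ring_homD[OF \<phi>] prime_ideal_def)
  qed
  from smooth[OF this] obtain c :: nat and f where f: "\<forall>j<c. f j \<in> polys_in n \<and> evA (f j) = 0"
    and ker: "\<forall>h\<in>polys_in n. evA h = 0 \<longrightarrow> (\<exists>s\<in>polys_in n. evA s \<notin> PA \<and>
      (\<exists>q. (\<forall>j<c. q j \<in> polys_in n) \<and> s * h = (\<Sum>j<c. q j * f j)))"
    and jac: "\<forall>u. (\<forall>i<n. (\<Sum>j<c. u j * evA (mpoly_deriv i (f j))) \<in> PA) \<longrightarrow> (\<forall>j<c. u j \<in> PA)"
    unfolding smooth_at_def by blast
  have f1: "f j \<in> polys_in n" "evK (f j) = 0" if "j < c" for j
    using f that by (simp_all add: evK ring_hom_0[OF \<phi>])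
  have ker': "\<exists>s q. evK s \<noteq> 0 \<and> s * h = (\<Sum>j<c. q j * f j)" if h: "h \<in> polys_in n" "evK h = 0" for h
  proof -
    have "evA h = 0" using h(2) \<phi>_inj by (simp add: evK)
    then obtain s q where "evA s \<notin> PA" "s * h = (\<Sum>j<c. q j * f j)" using ker h(1) by blast
    moreover from this have "evK s \<noteq> 0" using prime_idealD(3)[OF P] by (auto simp: evK PA_def)
    ultimately show ?thesis by blast
  qed
  have derivB: "evK (mpoly_deriv i p) \<in> ?B" for i p by (simp add: evK toB)
  have jac': "\<forall>j<c. u j \<in> ?m" if uB: "\<And>j. j < c \<Longrightarrow> u j \<in> ?B"
    and um: "\<And>i. i < n \<Longrightarrow> (\<Sum>j<c. u j * evK (mpoly_deriv i (f j))) \<in> ?m" for u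
  proof -
    obtain w b where w: "\<phi> w \<notin> P" and b: "\<And>j. j < c \<Longrightarrow> u j * to_fract (\<phi> w) = to_fract (\<phi> (b j))"
      using common_denominator[where u = u and c = c, OF P uB] by blast
    have "(\<Sum>j<c. b j * evA (mpoly_deriv i (f j))) \<in> PA" if "i < n" for i
    proof -
      have "(\<Sum>j<c. u j * evK (mpoly_deriv i (f j))) * to_fract (\<phi> w) \<in> ?m"
        by (rule AP.m_mult2[OF um[OF that] toB])
      also have "(\<Sum>j<c. u j * evK (mpoly_deriv i (f j))) * to_fract (\<phi> w) =
          (\<Sum>j<c. to_fract (\<phi> (b j)) * evK (mpoly_deriv i (f j)))"
        unfolding sum_distrib_right by (intro sum.cong) (auto simp: b[symmetric])
      also have "\<dots> = to_fract (\<phi> (\<Sum>j<c. b j * evA (mpoly_deriv i (f j))))"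
        by (simp add: evK ring_hom_sum[OF \<phi>] ring_hom_sum[OF ring_hom_to_fract] ring_homD(3)[OF \<phi>])
      finally show ?thesis unfolding to_fract_in_maximal[OF P] PA_def by simp
    qed
    hence bP: "\<forall>j<c. b j \<in> PA" using jac by blast
    have wm: "to_fract (\<phi> w) \<notin> ?m" using w by (simp add: to_fract_in_maximal[OF P])
    show ?thesis
    proof (intro allI impI)
      fix j assume j: "j < c"
      have "to_fract (\<phi> w) * u j \<in> ?m"
        using b[OF j] bP j by (simp add: mult.commute to_fract_in_maximal[OF P] PA_def)
      from AP.m_prime[OF toB uB[OF j] this wm] show "u j \<in> ?m" .
    qed
  qed
  \<comment> \<open>The x are local equations of the branches, the Xp polynomials that represent
    them up to units v of the local ring, and the functionals are dual to the x modulo m.\<close>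
  define adapted where "adapted r x Xp \<longleftrightarrow> (\<forall>i<r. Xp i \<in> polys_in n) \<and> loc_ideal P E = {y * (\<Prod>i<r. x i) | y. y \<in> ?B} \<and>
      (\<forall>i<r. x i \<in> ?m \<and> (\<exists>v\<in>?B. v \<notin> ?m \<and> evK (Xp i) = v * x i)) \<and>
      (\<forall>i<r. \<exists>lam. residue_functional ?B ?m lam \<and> (\<forall>j<r. \<forall>v\<in>?B. lam (v * x j) - (if j = i then v else 0) \<in> ?m))" for r :: nat and x Xp
  have "\<exists>r x Xp. adapted r x Xp"
  proof (cases "E \<subseteq> P")
    case True
    then obtain d x r where reg: "regular_parameters P d x" and r: "r \<le> d"
      and loc: "loc_ideal P E = {y * (\<Prod>i<r. x i) | y. y \<in> ?B}"
      using snc P unfolding snc_divisor_ideal_def by blast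
    have xm: "x i \<in> ?m" if i: "i < r" for i
    proof -
      have "(\<Sum>j<d. (if j = i then 1 else 0) * x j) = (\<Sum>j<d. if j = i then x j else 0)"
        by (intro sum.cong) auto
      hence "x i = (\<Sum>j<d. (if j = i then 1 else 0) * x j)" using i r by simp
      moreover have "\<forall>j<d. (if j = i then 1 else 0) \<in> ?B" using AP.B_intros(1,2) by simp
      ultimately have "x i \<in> {\<Sum>i<d. c i * x i | c. \<forall>i<d. c i \<in> ?B}"
        by (intro CollectI exI[of _ "\<lambda>j. if j = i then 1 else 0"] conjI)
      thus ?thesis using reg unfolding regular_parameters_def by (elim conjE) (simp only:)
    qed
    have "\<exists>p. p \<in> polys_in n \<and> (\<exists>v\<in>?B. v \<notin> ?m \<and> evK p = v * x i)" if i: "i < r" for i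
    proof -
      obtain s g where gs: "s \<notin> P" "x i * to_fract s = to_fract g"
        using xm[OF i] unfolding loc_ideal_iff[OF P] by blast
      from fraction_of_algebra[OF gs(2) prime_idealD(4)[OF P gs(1)]] P gs(1)
      obtain p q where pq: "p \<in> polys_in n" "x i * evK q = evK p" "\<phi> (evA q) \<notin> P" by blast
      have "evK q \<in> ?B" "evK q \<notin> ?m" using pq(3) toB by (simp_all add: evK to_fract_in_maximal[OF P])
      thus ?thesis using pq(1,2) by (metis mult.commute)
    qed
    hence "\<forall>i. \<exists>p. i < r \<longrightarrow> p \<in> polys_in n \<and> (\<exists>v\<in>?B. v \<notin> ?m \<and> evK p = v * x i)" by blast
    from choice[OF this] obtain Xp where Xp: "\<And>i. i < r \<Longrightarrow> Xp i \<in> polys_in n"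
      "\<And>i. i < r \<Longrightarrow> \<exists>v\<in>?B. v \<notin> ?m \<and> evK (Xp i) = v * x i" by blast
    have "\<exists>lam. residue_functional ?B ?m lam \<and> (\<forall>j<r. \<forall>v\<in>?B. lam (v * x j) - (if j = i then v else 0) \<in> ?m)"
      if "i < r" for i
    proof -
      have "i < d" using that r by (rule less_le_trans)
      from residue_functional_exists[OF P reg this] obtain lam where l1: "residue_functional ?B ?m lam"
        and l2: "\<forall>j<d. \<forall>v\<in>?B. lam (v * x j) - (if j = i then v else 0) \<in> ?m" by (elim exE conjE)
      show ?thesis
        by (intro exI[of _ lam] conjI l1 allI impI ballI l2[rule_format] less_le_trans[OF _ r])
    qed
    note lam = this
    show ?thesis
      by (rule exI[of _ r], rule exI[of _ x], rule exI[of _ Xp]) (unfold adapted_def, intro conjI allI impI loc Xp xm lam)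
  next
    case False
    then obtain s where s: "s \<in> E" "s \<notin> P" by blast
    \<comment> \<open>Off the divisor E extends to the whole local ring; with r = 0 the generator is
      the empty product.\<close>
    have "z \<in> loc_ideal P E" if z: "z \<in> ?B" for z
    proof -
      obtain g t where gt: "t \<notin> P" "z * to_fract t = to_fract g" using z unfolding loc_ideal_iff[OF P] by blast
      have "z * to_fract (t * s) = to_fract (g * s)"
        unfolding to_fract_mult gt(2)[symmetric] by (simp only: mult.assoc)
      moreover have "g * s \<in> E" by (rule ideal_mult[OF E s(1)])
      ultimately show ?thesis using prime_idealD(5)[OF P gt(1) s(2)] unfolding loc_ideal_iff[OF P] by blast
    qed
    moreover have "loc_ideal P E \<subseteq> ?B" by (auto simp: loc_ideal_def)
    ultimately have "loc_ideal P E = {y * (\<Prod>i<0. (1::'r fract)) | y. y \<in> ?B}" by auto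
    thus ?thesis by (intro exI[of _ "0::nat"] exI[of _ "\<lambda>_. 1"] exI[of _ "\<lambda>_. 0"]) (simp add: adapted_def)
  qed
  then obtain r x Xp where "adapted r x Xp" by blast
  note conj = this[unfolded adapted_def]
  note rx = conjunct1[OF conj] conjunct1[OF conjunct2[OF conj]] conjunct1[OF conjunct2[OF conjunct2[OF conj]]]
    conjunct2[OF conjunct2[OF conjunct2[OF conj]]]
  note loc = rx(2)
  have Xp: "Xp i \<in> polys_in n" and xm: "x i \<in> ?m"
    and lam: "\<exists>lam. residue_functional ?B ?m lam \<and> (\<forall>j<r. \<forall>v\<in>?B. lam (v * x j) - (if j = i then v else 0) \<in> ?m)"
    if "i < r" for i using rx that by blast+
  from rx(3) have unit: "\<forall>i<r. \<exists>v\<in>?B. v \<notin> ?m \<and> evK (Xp i) = v * x i" by blast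
  from unit have "\<forall>i. \<exists>v. i < r \<longrightarrow> v \<in> ?B \<and> v \<notin> ?m \<and> evK (Xp i) = v * x i" by blast
  from choice[OF this] obtain v where v: "\<And>i. i < r \<Longrightarrow> v i \<in> ?B" "\<And>i. i < r \<Longrightarrow> v i \<notin> ?m"
    "\<And>i. i < r \<Longrightarrow> evK (Xp i) = v i * x i" by blast
  \<comment> \<open>The tangent vector belonging to the functional dual to x i. As Xp j is v j times
    x j, its value there is the unit v i for j = i and 0 otherwise, modulo m.\<close>
  have tangent: "\<exists>e. (\<forall>l<n. e l \<in> ?B) \<and> (\<forall>j<c. (\<Sum>l<n. evK (mpoly_deriv l (f j)) * e l) \<in> ?m) \<and>
      (\<forall>j<r. (\<Sum>l<n. evK (mpoly_deriv l (Xp j)) * e l) \<in> ?m \<longleftrightarrow> j \<noteq> i)" if i: "i < r" for i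
  proof -
    obtain lam where lam1: "residue_functional ?B ?m lam"
      and lam2: "\<And>j v. j < r \<Longrightarrow> v \<in> ?B \<Longrightarrow> lam (v * x j) - (if j = i then v else 0) \<in> ?m"
      using lam[OF i] by blast
    interpret RF: residue_functional ?B ?m lam by (rule lam1)
    obtain e where eB: "\<forall>l<n. e l \<in> ?B"
      and e: "\<forall>p\<in>polys_in n. evK p \<in> ?m \<longrightarrow> (\<Sum>l<n. evK (mpoly_deriv l p) * e l) - lam (evK p) \<in> ?m"
      using RF.tangent_vector_exists[where n = n and a = "to_fract \<circ> (\<phi> \<circ> a)", OF AP.hom AP.\<iota>B AP.aB] by blast
    have "(\<Sum>l<n. evK (mpoly_deriv l (f j)) * e l) \<in> ?m" if "j < c" for j
      using e[rule_format, OF f1(1)[OF that]] f1(2)[OF that] AP.m_0 AP.m_diff_cancel[OF _ RF.lam_0] by simp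
    moreover have "(\<Sum>l<n. evK (mpoly_deriv l (Xp j)) * e l) \<in> ?m \<longleftrightarrow> j \<noteq> i" if j: "j < r" for j
    proof -
      have "evK (Xp j) \<in> ?m" unfolding v(3)[OF j] by (rule AP.m_mult[OF v(1)[OF j] xm[OF j]])
      let ?s = "\<Sum>l<n. evK (mpoly_deriv l (Xp j)) * e l" and ?t = "if j = i then v j else 0"
      have "?s - lam (evK (Xp j)) \<in> ?m" using e Xp[OF j] \<open>evK (Xp j) \<in> ?m\<close> by blast
      moreover have "lam (evK (Xp j)) - ?t \<in> ?m" unfolding v(3)[OF j] by (rule lam2[OF j v(1)[OF j]])
      ultimately have st: "?s - ?t \<in> ?m" using AP.m_add by fastforce
      show ?thesis
      proof
        assume s: "?s \<in> ?m"
        show "j \<noteq> i"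
        proof
          assume "j = i"
          hence "v j \<in> ?m" using AP.m_diff[OF s st] by simp
          thus False using v(2)[OF j] by blast
        qed
      next
        assume "j \<noteq> i"
        thus "?s \<in> ?m" using st by simp
      qed
    qed
    ultimately show ?thesis using eB by blast
  qed
  define coords where "coords M x' D F N \<longleftrightarrow>
      r \<le> M \<and> (\<forall>i<r. x' i = evK (Xp i)) \<and> (\<forall>i<M. x' i \<in> evK ` polys_in n) \<and>
      (\<forall>l<M. AP.hasse_schmidt (D l)) \<and>
      (\<forall>l<M. \<forall>i<M. \<forall>j>0. D l j (x' i) = (if i = l \<and> j = 1 then 1 else 0)) \<and>
      (\<forall>j<n. F j \<in> polys_in n \<and> (evK (F j) = 0 \<or> (\<exists>i<M. evK (F j) = x' i))) \<and>
      (\<forall>l<n. \<forall>i<n. (\<Sum>j<n. N l j * evK (mpoly_deriv i (F j))) = (if l = i then 1 else 0))" for M x' D F N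
  have "\<exists>M x' D F N. coords M x' D F N"
    unfolding coords_def
    by (rule AP.coordinates_exist[where f = f and c = c]) (fact f1 ker' jac' Xp tangent | rule derivB)+
  then obtain M x' D F N where "coords M x' D F N" by blast
  hence rM: "r \<le> M" and x': "\<forall>i<r. x' i = evK (Xp i)" "\<forall>i<M. x' i \<in> evK ` polys_in n"
    and D: "\<forall>l<M. AP.hasse_schmidt (D l)"
    and Dx: "\<forall>l<M. \<forall>i<M. \<forall>j>0. D l j (x' i) = (if i = l \<and> j = 1 then 1 else 0)"
    and F: "\<forall>j<n. F j \<in> polys_in n \<and> (evK (F j) = 0 \<or> (\<exists>i<M. evK (F j) = x' i))"
    and N: "\<forall>l<n. \<forall>i<n. (\<Sum>j<n. N l j * evK (mpoly_deriv i (F j))) = (if l = i then 1 else 0)"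
    unfolding coords_def by - (elim conjE, assumption)+
  have "\<exists>g. x' i = to_fract g" if i: "i < M" for i
  proof -
    obtain p where "x' i = evK p" using x'(2)[rule_format, OF i] by (rule imageE)
    thus ?thesis unfolding evK by (rule exI)
  qed
  hence "\<forall>i. \<exists>g. i < M \<longrightarrow> x' i = to_fract g" by blast
  from choice[OF this] obtain X where X: "\<And>i. i < M \<Longrightarrow> x' i = to_fract (X i)" by blast
  have "log_coordinates \<iota> P E M r X D"
  proof (intro log_coordinates.intro \<iota> P E noeth rM)
    fix l assume l: "l < M"
    have hs: "\<forall>z. D l 0 z = z" "\<forall>j z w. D l j (z + w) = D l j z + D l j w"
      "\<forall>j z w. D l j (z * w) = (\<Sum>i\<le>j. D l i z * D l (j - i) w)"
      "\<forall>j c. j > 0 \<longrightarrow> D l j ((to_fract \<circ> \<iota>) c) = 0" "\<forall>j. \<forall>z\<in>?B. D l j z \<in> ?B"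
      using D[rule_format, OF l] unfolding AP.hasse_schmidt_def by - (elim conjE, assumption)+
    show "D l 0 z = z" for z by (rule hs(1)[rule_format])
    show "D l j (z + w) = D l j z + D l j w" for j z w by (rule hs(2)[rule_format])
    show "D l j (z * w) = (\<Sum>i\<le>j. D l i z * D l (j - i) w)" for j z w by (rule hs(3)[rule_format])
    show "D l j (to_fract (\<iota> c)) = 0" if "j > 0" for j c
      using hs(4)[rule_format, OF that, of c] by (simp only: comp_apply)
    show "D l j z \<in> ?B" if "z \<in> ?B" for j z by (rule hs(5)[rule_format, OF that])
    show "D l j (to_fract (X i)) = (if i = l \<and> j = 1 then 1 else 0)" if "i < M" "j > 0" for i j
      using Dx[rule_format, OF l that] unfolding X[OF that(1)] .
  next
    fix t d assume d: "K_diffop (Suc (Suc t)) d"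
      and dX: "\<And>l. l < M \<Longrightarrow> K_diffop t (commutator to_fract (X l) d)"
    show "K_diffop (Suc t) d"
    proof (rule order_drop[OF d])
      show "F j \<in> polys_in n" if "j < n" for j by (rule F[rule_format, OF that, THEN conjunct1])
      show "(\<Sum>j<n. N l j * evK (mpoly_deriv i (F j))) = (if l = i then 1 else 0)" if "l < n" "i < n" for l i
        by (rule N[rule_format, OF that])
      fix j assume "j < n"
      hence "evK (F j) = 0 \<or> (\<exists>i<M. evK (F j) = x' i)" by (rule F[rule_format, THEN conjunct2])
      hence "\<phi> (evA (F j)) = 0 \<or> (\<exists>i<M. \<phi> (evA (F j)) = X i)" unfolding evK using X by auto
      thus "K_diffop t (commutator to_fract (\<phi> (evA (F j))) d)"
      proof
        assume "\<phi> (evA (F j)) = 0"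
        hence "commutator to_fract (\<phi> (evA (F j))) d = (\<lambda>x. 0)"
          using klinear_0[OF diffop_klinear[OF d]] by (auto simp: commutator_def)
        thus ?thesis using diffop_zero by (simp only:)
      qed (use dX in auto)
    qed
  next
    show "\<exists>s. s \<notin> P \<and> (\<forall>g. to_fract s * e g \<in> range to_fract)"
      if "K_diffop t e" "\<And>g. e g \<in> ?B" for t e
      using that by (rule bounded_denominators[OF P])
  next
    \<comment> \<open>Replacing the x i by the X i multiplies their product by the unit V and leaves
      the ideal generated by it unchanged.\<close>
    define V where "V = (\<Prod>i<r. v i)"
    have VB: "V \<in> ?B" and Vm: "inverse V \<in> ?B"
      unfolding V_def prod_inversef[symmetric] using v(1,2) by (auto intro!: AP.B_intros AP.B_inverse)
    have Vnz: "V \<noteq> 0" unfolding V_def using v(2) AP.not_m_nonzero by auto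
    have "to_fract (\<Prod>i<r. X i) = (\<Prod>i<r. v i * x i)"
      unfolding ring_hom_prod[OF ring_hom_to_fract]
    proof (rule prod.cong[OF refl])
      fix i assume "i \<in> {..<r}"
      thus "to_fract (X i) = v i * x i" using X[of i] x'(1) v(3)[of i] rM by simp
    qed
    hence eq: "to_fract (\<Prod>i<r. X i) = V * (\<Prod>i<r. x i)" by (simp add: V_def prod.distrib)
    have 1: "y * (\<Prod>i<r. x i) = (y * inverse V) * to_fract (\<Prod>i<r. X i)" for y
      unfolding eq using Vnz by simp
    have 2: "y * to_fract (\<Prod>i<r. X i) = (y * V) * (\<Prod>i<r. x i)" for y
      unfolding eq by (simp only: mult.assoc)
    show "loc_ideal P E = {z * to_fract (\<Prod>i<r. X i) | z. z \<in> ?B}"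
      unfolding loc
    proof (intro equalityI subsetI)
      fix z assume "z \<in> {y * (\<Prod>i<r. x i) | y. y \<in> ?B}"
      then obtain y where "z = y * (\<Prod>i<r. x i)" "y \<in> ?B" by blast
      thus "z \<in> {z * to_fract (\<Prod>i<r. X i) | z. z \<in> ?B}" unfolding 1 using AP.B_intros(4)[OF _ Vm] by blast
    next
      fix z assume "z \<in> {z * to_fract (\<Prod>i<r. X i) | z. z \<in> ?B}"
      then obtain y where "z = y * to_fract (\<Prod>i<r. X i)" "y \<in> ?B" by blast
      thus "z \<in> {y * (\<Prod>i<r. x i) | y. y \<in> ?B}" unfolding 2 using AP.B_intros(4)[OF _ VB] by blast
    qed
  qed
  thus ?thesis by blast
qed

section \<open>Saturation of filtrations\<close>

lemma idealistic_filtration_iff: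
  "idealistic_filtration I \<longleftrightarrow> (\<forall>f. (f, 0) \<in> I) \<and> (\<forall>a. ideal (level I a)) \<and>
    (\<forall>f g a b. (f, a) \<in> I \<longrightarrow> (g, b) \<in> I \<longrightarrow> (f * g, a + b) \<in> I) \<and>
    (\<forall>f a b. (f, a) \<in> I \<longrightarrow> b \<le> a \<longrightarrow> (f, b) \<in> I)"
proof -
  have "ideal_prod (level I a) (level I b) \<subseteq> level I (a + b) \<longleftrightarrow>
      (\<forall>f g. (f, a) \<in> I \<longrightarrow> (g, b) \<in> I \<longrightarrow> (f * g, a + b) \<in> I)" if "\<forall>a. ideal (level I a)" for a b
  proof
    assume "ideal_prod (level I a) (level I b) \<subseteq> level I (a + b)"
    moreover have "{f * g |f g. f \<in> level I a \<and> g \<in> level I b} \<subseteq> ideal_prod (level I a) (level I b)"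
      unfolding ideal_prod_def by (rule module.span_superset[OF module_times])
    ultimately show "\<forall>f g. (f, a) \<in> I \<longrightarrow> (g, b) \<in> I \<longrightarrow> (f * g, a + b) \<in> I" unfolding level_def by blast
  next
    assume *: "\<forall>f g. (f, a) \<in> I \<longrightarrow> (g, b) \<in> I \<longrightarrow> (f * g, a + b) \<in> I"
    show "ideal_prod (level I a) (level I b) \<subseteq> level I (a + b)"
      unfolding ideal_prod_def using that * by (intro ideal_gen_minimal) (auto simp: level_def)
  qed
  note prod = this
  have zero: "level I 0 = UNIV \<longleftrightarrow> (\<forall>f. (f, 0) \<in> I)" by (auto simp: level_def)
  have mono: "(\<forall>a b. b \<le> a \<longrightarrow> level I a \<subseteq> level I b) \<longleftrightarrow> (\<forall>f a b. (f, a) \<in> I \<longrightarrow> b \<le> a \<longrightarrow> (f, b) \<in> I)"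
    by (auto simp: level_def)
  show ?thesis
  proof (cases "\<forall>a. ideal (level I a)")
    case True
    have "(\<forall>a b. ideal_prod (level I a) (level I b) \<subseteq> level I (a + b)) \<longleftrightarrow>
        (\<forall>f g a b. (f, a) \<in> I \<longrightarrow> (g, b) \<in> I \<longrightarrow> (f * g, a + b) \<in> I)"
      unfolding prod[OF True] by blast
    thus ?thesis unfolding idealistic_filtration_def zero mono by (simp only:)
  next
    case False
    thus ?thesis unfolding idealistic_filtration_def by (simp only: simp_thms)
  qed
qed

lemma idealistic_filtrationD:
  assumes "idealistic_filtration I"
  shows "(f, 0) \<in> I" "ideal (level I a)" "(f, a) \<in> I \<Longrightarrow> (g, b) \<in> I \<Longrightarrow> (f * g, a + b) \<in> I"
    "(f, a) \<in> I \<Longrightarrow> b \<le> a \<Longrightarrow> (f, b) \<in> I" "b \<le> 0 \<Longrightarrow> (f, b) \<in> I"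
proof -
  show 0: "(f, 0) \<in> I" for f using assms unfolding idealistic_filtration_iff by blast
  show "ideal (level I a)" using assms unfolding idealistic_filtration_iff by blast
  show "(f, a) \<in> I \<Longrightarrow> (g, b) \<in> I \<Longrightarrow> (f * g, a + b) \<in> I"
    using assms unfolding idealistic_filtration_iff by blast
  show mono: "(f, a) \<in> I \<Longrightarrow> b \<le> a \<Longrightarrow> (f, b) \<in> I" for f a b
    using assms unfolding idealistic_filtration_iff by blast
  show "b \<le> 0 \<Longrightarrow> (f, b) \<in> I" using mono[OF 0] .
qed

lemma idealistic_filtration_Inter:
  assumes "\<And>I. I \<in> F \<Longrightarrow> idealistic_filtration I" shows "idealistic_filtration (\<Inter>F)"
  unfolding idealistic_filtration_iff
proof (intro conjI allI impI)
  fix a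
  have "level (\<Inter>F) a = (\<Inter>I\<in>F. level I a)" by (auto simp: level_def)
  moreover have "ideal (level I a)" if "I \<in> F" for I using idealistic_filtrationD(2)[OF assms[OF that]] .
  ultimately show "ideal (level (\<Inter>F) a)"
    by (auto intro!: idealI simp: ideal_0 ideal_add ideal_mult)
qed (use idealistic_filtrationD[OF assms] in blast)+

lemma idealistic_filtration_generated: "idealistic_filtration (generated_filtration T)"
  unfolding generated_filtration_def by (rule idealistic_filtration_Inter) blast

lemma generated_filtration_base: "T \<subseteq> generated_filtration T"
  unfolding generated_filtration_def by blast

lemma generated_filtration_minimal: "idealistic_filtration I \<Longrightarrow> T \<subseteq> I \<Longrightarrow> generated_filtration T \<subseteq> I"
  unfolding generated_filtration_def by blast

lemma saturation_eqI:
  assumes "idealistic_filtration H" "saturated_under \<D> H" "I \<subseteq> H"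
    "\<And>J. idealistic_filtration J \<Longrightarrow> saturated_under \<D> J \<Longrightarrow> I \<subseteq> J \<Longrightarrow> H \<subseteq> J"
  shows "saturation \<D> I = H"
  unfolding saturation_def using assms by blast

text \<open>
  A family of spaces of operators as formed by the (logarithmic) differential operators
  of order at most \<open>t\<close>; the last condition is the higher Leibniz rule.
\<close>

locale operator_family =
  fixes \<D> :: "nat \<Rightarrow> ('r::comm_ring_1 \<Rightarrow> 'r) set"
  assumes noeth: "noetherian (UNIV :: 'r set)"
    and ident: "(\<lambda>x. x) \<in> \<D> 0"
    and zero: "\<And>t. (\<lambda>x. 0) \<in> \<D> t"
    and add: "\<And>t d e. d \<in> \<D> t \<Longrightarrow> e \<in> \<D> t \<Longrightarrow> (\<lambda>x. d x + e x) \<in> \<D> t"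
    and scale: "\<And>t d c. d \<in> \<D> t \<Longrightarrow> (\<lambda>x. c * d x) \<in> \<D> t"
    and premult: "\<And>t d c. d \<in> \<D> t \<Longrightarrow> (\<lambda>x. d (c * x)) \<in> \<D> t"
    and additive: "\<And>t d x y. d \<in> \<D> t \<Longrightarrow> d (x + y) = d x + d y"
    and comp: "\<And>s t d e. d \<in> \<D> s \<Longrightarrow> e \<in> \<D> t \<Longrightarrow> (\<lambda>x. d (e x)) \<in> \<D> (s + t)"
    and leibniz: "\<And>t d f g. d \<in> \<D> t \<Longrightarrow>
      d (f * g) \<in> ideal_gen {d1 f * d2 g | d1 d2 i j. i + j \<le> t \<and> d1 \<in> \<D> i \<and> d2 \<in> \<D> j}"
begin

lemma ideal_orbit: "ideal {d f | d. d \<in> \<D> t}"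
proof (rule idealI)
  show "0 \<in> {d f | d. d \<in> \<D> t}" using zero[of t] by (intro CollectI exI[of _ "\<lambda>x. 0"]) simp
  fix x y assume "x \<in> {d f | d. d \<in> \<D> t}" "y \<in> {d f | d. d \<in> \<D> t}"
  then obtain d e where "x = d f" "y = e f" "d \<in> \<D> t" "e \<in> \<D> t" by blast
  thus "x + y \<in> {d f | d. d \<in> \<D> t}" using add[of d t e] by (intro CollectI exI[of _ "\<lambda>x. d x + e x"]) simp
next
  fix c x assume "x \<in> {d f | d. d \<in> \<D> t}"
  then obtain d where "x = d f" "d \<in> \<D> t" by blast
  thus "c * x \<in> {d f | d. d \<in> \<D> t}" using scale[of d t c] by (intro CollectI exI[of _ "\<lambda>x. c * d x"]) simp
qed

text \<open>Closure under products is the Leibniz rule: orders with i + j \<le> t lower the two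
  levels by at most t in total. If the generators of H belong to this filtration, so does H, which
  is then saturated.\<close>

lemma saturated_closure:
  assumes H: "idealistic_filtration H"
  shows "idealistic_filtration {(g, b). \<forall>t. \<forall>d\<in>\<D> t. (d g, b - real t) \<in> H}" (is "idealistic_filtration ?H")
  unfolding idealistic_filtration_iff
proof (intro conjI allI impI)
  show "(f, 0) \<in> ?H" for f using idealistic_filtrationD(5)[OF H] by simp
  show "ideal (level ?H a)" for a
  proof (rule idealI)
    note l = idealistic_filtrationD(2)[OF H, unfolded level_def]
    have d0: "d 0 = 0" if "d \<in> \<D> t" for d t using additive[OF that, of 0 0] by simp
    have levelI: "x \<in> level ?H a" if "\<And>t d. d \<in> \<D> t \<Longrightarrow> (d x, a - real t) \<in> H" for x
      unfolding level_def using that by blast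
    have levelD: "(d x, a - real t) \<in> H" if "x \<in> level ?H a" "d \<in> \<D> t" for x t d
      using that unfolding level_def by blast
    show "0 \<in> level ?H a"
    proof (rule levelI)
      fix t d assume "d \<in> \<D> t"
      thus "(d 0, a - real t) \<in> H" using ideal_0[OF l[of "a - real t"]] by (simp add: d0)
    qed
    show "x + y \<in> level ?H a" if x: "x \<in> level ?H a" and y: "y \<in> level ?H a" for x y
    proof (rule levelI)
      fix t d assume d: "d \<in> \<D> t"
      show "(d (x + y), a - real t) \<in> H"
        using ideal_add[OF l, of "d x" _ "d y"] levelD[OF x d] levelD[OF y d] by (simp add: additive[OF d])
    qed
    show "c * x \<in> level ?H a" if x: "x \<in> level ?H a" for c x
      using levelD[OF x premult[of _ _ c]] by (rule levelI)
  qed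
  show "(f * g, a + b) \<in> ?H" if f: "(f, a) \<in> ?H" and g: "(g, b) \<in> ?H" for f g a b
  proof (intro CollectI case_prodI allI ballI)
    fix t d assume d: "d \<in> \<D> t"
    have "{d1 f * d2 g | d1 d2 i j. i + j \<le> t \<and> d1 \<in> \<D> i \<and> d2 \<in> \<D> j} \<subseteq> level H (a + b - real t)"
    proof
      fix z assume "z \<in> {d1 f * d2 g | d1 d2 i j. i + j \<le> t \<and> d1 \<in> \<D> i \<and> d2 \<in> \<D> j}"
      then obtain d1 d2 i j where z: "z = d1 f * d2 g" "i + j \<le> t" "d1 \<in> \<D> i" "d2 \<in> \<D> j" by blast
      have "(d1 f, a - real i) \<in> H" "(d2 g, b - real j) \<in> H" using f g z by auto
      hence "(z, (a - real i) + (b - real j)) \<in> H" unfolding z(1) by (rule idealistic_filtrationD(3)[OF H])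
      moreover have "a + b - real t \<le> (a - real i) + (b - real j)" using z(2) by linarith
      ultimately have "(z, a + b - real t) \<in> H" by (rule idealistic_filtrationD(4)[OF H])
      thus "z \<in> level H (a + b - real t)" by (simp add: level_def)
    qed
    hence "d (f * g) \<in> level H (a + b - real t)"
      using leibniz[OF d, of f g] ideal_gen_minimal[OF _ idealistic_filtrationD(2)[OF H]] by blast
    thus "(d (f * g), a + b - real t) \<in> H" by (simp add: level_def)
  qed
  show "(f, b) \<in> ?H" if f: "(f, a) \<in> ?H" and ba: "b \<le> a" for f a b
  proof (intro CollectI case_prodI allI ballI)
    fix t d assume "d \<in> \<D> t"
    hence "(d f, a - real t) \<in> H" using f by blast
    moreover have "b - real t \<le> a - real t" using ba by simp
    ultimately show "(d f, b - real t) \<in> H" by (rule idealistic_filtrationD(4)[OF H])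
  qed
qed

lemma rfg_type_saturation:
  assumes "rfg_type I" shows "rfg_type (saturation \<D> I)"
proof -
  obtain T where T: "finite T" "T \<subseteq> UNIV \<times> \<rat>" "I = generated_filtration T"
    using assms unfolding rfg_type_def by blast
  define gens where "gens f t F \<longleftrightarrow> finite F \<and> F \<subseteq> {d f | d. d \<in> \<D> t} \<and> {d f | d. d \<in> \<D> t} = ideal_gen F" for f t F
  have ex: "\<exists>F. gens f t F" for f t
    unfolding gens_def by (rule noetherian_finitely_generated[OF noeth ideal_orbit[of f t]]) (intro exI conjI)
  define F where "F f t = (SOME F. gens f t F)" for f t
  have "gens f t (F f t)" for f t unfolding F_def by (rule someI_ex[OF ex])
  note F = this[unfolded gens_def, THEN conjunct1] this[unfolded gens_def, THEN conjunct2, THEN conjunct1]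
    this[unfolded gens_def, THEN conjunct2, THEN conjunct2]
  \<comment> \<open>Orders above the ceiling of a lead to nonpositive levels, where a filtration
    contains all of R. Subtracting the natural number t keeps the levels rational.\<close>
  define T' where "T' = (\<Union>(f, a)\<in>T. \<Union>t\<le>nat \<lceil>a\<rceil>. (\<lambda>g. (g, a - real t)) ` F f t)"
  have "finite T'" unfolding T'_def using T(1) F(1) by auto
  moreover have "T' \<subseteq> UNIV \<times> \<rat>" unfolding T'_def using T(2) by (auto intro!: Rats_diff)
  ultimately have rfg: "rfg_type (generated_filtration T')" unfolding rfg_type_def by blast
  let ?H = "generated_filtration T'"
  note H = idealistic_filtration_generated[of T']
  have in_H: "(d f, a - real t) \<in> ?H" if fa: "(f, a) \<in> T" and d: "d \<in> \<D> t" for f a d t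
  proof (cases "t \<le> nat \<lceil>a\<rceil>")
    case True
    have "F f t \<subseteq> level ?H (a - real t)"
    proof
      fix g assume "g \<in> F f t"
      hence "(g, a - real t) \<in> T'" unfolding T'_def using fa True by blast
      thus "g \<in> level ?H (a - real t)" using generated_filtration_base by (auto simp: level_def)
    qed
    from ideal_gen_minimal[OF this idealistic_filtrationD(2)[OF H]]
    have "{d f | d. d \<in> \<D> t} \<subseteq> level ?H (a - real t)" unfolding F(3) .
    thus ?thesis using d by (auto simp: level_def)
  next
    case False
    hence "a - real t \<le> 0" by linarith
    thus ?thesis by (rule idealistic_filtrationD(5)[OF H])
  qed
  have "saturation \<D> I = ?H"
  proof (rule saturation_eqI[OF H])
    \<comment> \<open>A derivative of a generator e f is again a derivative of f, of the summed
      order, by \<open>comp\<close>.\<close>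
    have "T' \<subseteq> {(g, b). \<forall>t. \<forall>d\<in>\<D> t. (d g, b - real t) \<in> ?H}"
    proof
      fix y assume "y \<in> T'"
      then obtain f a t g where y: "(f, a) \<in> T" "g \<in> F f t" "y = (g, a - real t)" unfolding T'_def by auto
      then obtain e where e: "e \<in> \<D> t" "g = e f" using F(2) by blast
      have "(d (e f), a - real t - real s) \<in> ?H" if "d \<in> \<D> s" for d s
        using in_H[OF y(1) comp[OF that e(1)]] by (simp add: algebra_simps)
      thus "y \<in> {(g, b). \<forall>t. \<forall>d\<in>\<D> t. (d g, b - real t) \<in> ?H}" unfolding y(3) e(2) by simp
    qed
    from generated_filtration_minimal[OF saturated_closure[OF H] this]
    show "saturated_under \<D> ?H" unfolding saturated_under_def by blast
    have "T \<subseteq> ?H" using in_H[OF _ ident] by auto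
    thus "I \<subseteq> ?H" unfolding T(3) by (rule generated_filtration_minimal[OF H])
  next
    fix J assume J: "idealistic_filtration J" "saturated_under \<D> J" "I \<subseteq> J"
    have "T' \<subseteq> J"
    proof
      fix y assume "y \<in> T'"
      then obtain f a t g where y: "(f, a) \<in> T" "g \<in> F f t" "y = (g, a - real t)" unfolding T'_def by auto
      then obtain e where e: "e \<in> \<D> t" "g = e f" using F(2) by blast
      have "(f, a) \<in> J" using y(1) T(3) generated_filtration_base J(3) by blast
      thus "y \<in> J" using J(2) e y(3) unfolding saturated_under_def by blast
    qed
    thus "?H \<subseteq> J" by (rule generated_filtration_minimal[OF J(1)])
  qed
  thus ?thesis using rfg by simp
qed

end

section \<open>Saturation by logarithmic differential operators\<close>

text \<open>Local to global: the multipliers that bring d (f g) into the ideal form an ideal C. By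
  \<open>local_leibniz\<close> each prime misses an element of C, so C is contained in no prime and
  contains 1.\<close>

lemma Diff_log_leibniz:
  fixes \<kappa> :: "'k::alg_closed_field \<Rightarrow> 'a::idom" and \<phi> :: "'a \<Rightarrow> 'r::idom"
  assumes ft: "finite_type \<kappa> n a \<phi> S" and smooth: "\<And>P. prime_ideal P \<Longrightarrow> smooth_at \<kappa> n a P"
    and noeth: "noetherian (UNIV :: 'r set)" and snc: "snc_divisor_ideal E"
    and d: "d \<in> Diff_log (\<phi> \<circ> \<kappa>) E t"
  shows "d (f * g) \<in> ideal_gen {d1 f * d2 g | d1 d2 i j. i + j \<le> t \<and>
    d1 \<in> Diff_log (\<phi> \<circ> \<kappa>) E i \<and> d2 \<in> Diff_log (\<phi> \<circ> \<kappa>) E j}"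
proof -
  define G where "G = {d1 f * d2 g | d1 d2 i j. i + j \<le> t \<and>
    d1 \<in> Diff_log (\<phi> \<circ> \<kappa>) E i \<and> d2 \<in> Diff_log (\<phi> \<circ> \<kappa>) E j}"
  define C where "C = {s. d (f * g) * s \<in> ideal_gen G}"
  have Q: "ideal (ideal_gen G)" by (rule ideal_ideal_gen)
  have prod: "d1 f * d2 g \<in> ideal_gen G"
    if "i + j \<le> t" "d1 \<in> Diff_log (\<phi> \<circ> \<kappa>) E i" "d2 \<in> Diff_log (\<phi> \<circ> \<kappa>) E j" for i j d1 d2
    unfolding G_def using that by (intro ideal_gen_base CollectI exI conjI) (rule refl)
  have C: "ideal C"
  proof (rule idealI)
    show "0 \<in> C" using ideal_0[OF Q] by (simp add: C_def)
    show "x + y \<in> C" if "x \<in> C" "y \<in> C" for x y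
      using that ideal_add[OF Q] by (simp add: C_def distrib_left)
    show "c * x \<in> C" if "x \<in> C" for c x
      using that ideal_mult[OF Q, of "d (f * g) * x" c] by (simp add: C_def mult.left_commute)
  qed
  have "1 \<in> C"
  proof (rule ccontr)
    assume "1 \<notin> C"
    then obtain P where P: "prime_ideal P" "C \<subseteq> P" by (rule noetherian_prime_ideal[OF noeth C])
    obtain M r X D where L: "log_coordinates (\<phi> \<circ> \<kappa>) P E M r X D"
      using smooth_log_coordinates[OF ft smooth noeth snc P(1)] by blast
    have "\<exists>s. s \<notin> P \<and> d (f * g) * s \<in> ideal_gen G"
      by (rule log_coordinates.local_leibniz[OF L d Q]) (fact prod)
    thus False using P(2) by (auto simp: C_def)
  qed
  thus ?thesis by (simp add: C_def G_def)
qed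

lemma Diff_log_UNIV: "Diff_log \<iota> UNIV = Diff \<iota>"
  by (auto simp: Diff_log_def ideal_power_UNIV fun_eq_iff)

lemma snc_divisor_ideal_UNIV: "snc_divisor_ideal (UNIV :: 'r::idom set)"
  unfolding snc_divisor_ideal_def by (auto simp: ideal_UNIV prime_ideal_def)

lemma operator_family_Diff_log:
  fixes \<iota> :: "'k::field \<Rightarrow> 'r::idom"
  assumes hom: "is_ring_hom \<iota>" and noeth: "noetherian (UNIV :: 'r set)"
    and leibniz: "\<And>t d f g. d \<in> Diff_log \<iota> E t \<Longrightarrow> d (f * g) \<in>
      ideal_gen {d1 f * d2 g | d1 d2 i j. i + j \<le> t \<and> d1 \<in> Diff_log \<iota> E i \<and> d2 \<in> Diff_log \<iota> E j}"
  shows "operator_family (Diff_log \<iota> E)"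
proof (rule operator_family.intro)
  show "noetherian (UNIV :: 'r set)" by (rule noeth)
  note iff = Diff_log_iff[OF hom] and I = ideal_ideal_power
  show "(\<lambda>x. x) \<in> Diff_log \<iota> E 0" unfolding iff using diffop_ident[OF ring_hom_id] by blast
  show "(\<lambda>x. 0) \<in> Diff_log \<iota> E t" for t unfolding iff using diffop_zero ideal_0[OF I] by blast
  show "(\<lambda>x. d x + e x) \<in> Diff_log \<iota> E t" if "d \<in> Diff_log \<iota> E t" "e \<in> Diff_log \<iota> E t" for t d e
    using that diffop_add ideal_add[OF I] unfolding iff by blast
  show "(\<lambda>x. c * d x) \<in> Diff_log \<iota> E t" if "d \<in> Diff_log \<iota> E t" for t d c
    using that diffop_scale ideal_mult[OF I] unfolding iff by blast
  show "(\<lambda>x. d (c * x)) \<in> Diff_log \<iota> E t" if "d \<in> Diff_log \<iota> E t" for t d c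
    using that diffop_premult[OF ring_hom_id] ideal_mult[OF I] unfolding iff by blast
  show "d (x + y) = d x + d y" if "d \<in> Diff_log \<iota> E t" for t d x y
    using that klinearD(1)[OF diffop_klinear] unfolding iff by blast
  show "(\<lambda>x. d (e x)) \<in> Diff_log \<iota> E (s + t)" if "d \<in> Diff_log \<iota> E s" "e \<in> Diff_log \<iota> E t" for s t d e
    using that diffop_comp[OF ring_hom_id ring_hom_id, of \<iota> s d t e] unfolding iff comp_def by blast
  show "d (f * g) \<in> ideal_gen {d1 f * d2 g | d1 d2 i j. i + j \<le> t \<and> d1 \<in> Diff_log \<iota> E i \<and> d2 \<in> Diff_log \<iota> E j}"
    if "d \<in> Diff_log \<iota> E t" for t d f g using that by (rule leibniz)
qed

theorem proposition2p3p1p1: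
  fixes \<kappa> :: "'k::alg_closed_field \<Rightarrow> 'a::idom"
    and S :: "'a set"
    and \<phi> :: "'a \<Rightarrow> 'r::idom"
    and I :: "('r \<times> real) set"
  assumes "smooth_affine_variety \<kappa>"
    and "multiplicative_set S"
    and "is_localization \<phi> S"
    and "idealistic_filtration I"
    and "rfg_type I"
  shows "rfg_type (D_saturation (\<phi> \<circ> \<kappa>) I) \<and>
         (\<forall>E. snc_divisor_ideal E \<longrightarrow> rfg_type (log_D_saturation (\<phi> \<circ> \<kappa>) E I))"
proof -
  from assms(1) obtain n a where gen: "is_ring_hom \<kappa>" "alg_generators \<kappa> n a"
    and smooth: "\<And>P. prime_ideal P \<Longrightarrow> smooth_at \<kappa> n a P"
    unfolding smooth_affine_variety_def by blast
  have ft: "finite_type \<kappa> n a \<phi> S" using gen assms(3) by (rule finite_type.intro)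
  have noeth: "noetherian (UNIV :: 'r set)"
    by (rule noetherian_localization[OF noetherian_algebra[OF gen] assms(3)])
  have log: "rfg_type (saturation (Diff_log (\<phi> \<circ> \<kappa>) E) I)" if "snc_divisor_ideal E" for E
    by (intro operator_family.rfg_type_saturation operator_family_Diff_log assms(5) noeth
      finite_type.\<iota>[OF ft] Diff_log_leibniz[OF ft smooth noeth that])
  show ?thesis
    using log log[OF snc_divisor_ideal_UNIV]
    unfolding D_saturation_def log_D_saturation_def Diff_log_UNIV by blast
qed

end
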